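(* If $(M,g)$ contains a Cauchy hypersurface $S$, then $(M,g)$ is globally hyperbolic.
   Context: $M$ is a smooth connected manifold, $g$ a continuous Lorentzian metric, $(M,g)$ time-oriented. Causal curves are locally Lipschitz curves $\lambda$ with $g(\dot\lambda,\dot\lambda)\le0$, $\dot\lambda\ne0$ a.e. A Cauchy hypersurface is a subset $S\subseteq M$ met exactly once by every inextendible causal curve. $(M,g)$ is non-totally imprisoning if no future or past inextendible causal curve is contained in a compact set; globally hyperbolic if non-totally imprisoning and all $J^+(p)\cap J^-(q)$ are compact. *)

theory Defs
  imports "HOL-Analysis.Analysis"
begin

text \<open>A chart on the manifold (the whole type 'm) is a pair (U, phi) of an open domain U
  and a map phi : U -> real^'n which is a homeomorphism onto an open subset.
  The dimension is the cardinality of the finite index type 'n.\<close>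

type_synonym ('m, 'n) chart = "'m set \<times> ('m \<Rightarrow> real ^ 'n)"

fun Ck :: "nat \<Rightarrow> (real ^ 'n) set \<Rightarrow> (real ^ 'n \<Rightarrow> real) \<Rightarrow> bool" where
  "Ck 0 S h = continuous_on S h"
| "Ck (Suc k) S h = (continuous_on S h \<and>
     (\<forall>i. \<exists>g. (\<forall>x\<in>S. ((\<lambda>t. h (x + t *\<^sub>R axis i 1)) has_real_derivative g x) (at 0))
               \<and> Ck k S g))"

definition smooth_on :: "(real ^ 'n) set \<Rightarrow> (real ^ 'n \<Rightarrow> real ^ 'k) \<Rightarrow> bool" where
  "smooth_on S f \<longleftrightarrow> (\<forall>k j. Ck k S (\<lambda>x. f x $ j))"

definition is_chart :: "('m::topological_space, 'n::finite) chart \<Rightarrow> bool" where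
  "is_chart c \<longleftrightarrow> open (fst c) \<and> open (snd c ` fst c) \<and>
     (\<exists>psi. homeomorphism (fst c) (snd c ` fst c) (snd c) psi)"

definition transition :: "('m, 'n) chart \<Rightarrow> ('m, 'n) chart \<Rightarrow> real ^ 'n \<Rightarrow> real ^ 'n" where
  "transition c d = snd d \<circ> inv_into (fst c) (snd c)"

definition smooth_atlas :: "('m::topological_space, 'n::finite) chart set \<Rightarrow> bool" where
  "smooth_atlas A \<longleftrightarrow> (\<forall>c\<in>A. is_chart c) \<and> (\<Union>c\<in>A. fst c) = UNIV \<and>
     (\<forall>c\<in>A. \<forall>d\<in>A. smooth_on (snd c ` (fst c \<inter> fst d)) (transition c d))"

definition smooth_connected_manifold ::
  "('m::{t2_space, second_countable_topology}, 'n::finite) chart set \<Rightarrow> bool" where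
  "smooth_connected_manifold A \<longleftrightarrow> connected (UNIV :: 'm set) \<and> smooth_atlas A"

definition lorentzian_matrix :: "real ^ 'n ^ 'n \<Rightarrow> bool" where
  "lorentzian_matrix Q \<longleftrightarrow> transpose Q = Q \<and>
     (\<exists>(P :: real ^ 'n ^ 'n) i0. invertible P \<and>
        transpose P ** Q ** P = (\<chi> i j. if i = j then (if i = i0 then -1 else 1) else 0))"

definition bil :: "real ^ 'n ^ 'n \<Rightarrow> real ^ 'n \<Rightarrow> real ^ 'n \<Rightarrow> real" where
  "bil Q v w = v \<bullet> (Q *v w)"

text \<open>G c p is the coefficient matrix of g at p \<in> U_c with respect to the coordinates of chart c.
  Continuity of g means continuity of each such coefficient field; compatibility is the
  tensor transformation law under the Jacobian of the transition maps.\<close>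
definition continuous_lorentzian_metric ::
  "('m::topological_space, 'n::finite) chart set \<Rightarrow> (('m, 'n) chart \<Rightarrow> 'm \<Rightarrow> real ^ 'n ^ 'n) \<Rightarrow> bool" where
  "continuous_lorentzian_metric A G \<longleftrightarrow>
     (\<forall>c\<in>A. continuous_on (fst c) (G c) \<and> (\<forall>p\<in>fst c. lorentzian_matrix (G c p))) \<and>
     (\<forall>c\<in>A. \<forall>d\<in>A. \<forall>p\<in>fst c \<inter> fst d.
        G c p = transpose (jacobian (transition c d) (at (snd c p))) ** G d p **
                jacobian (transition c d) (at (snd c p)))"

definition time_orientation ::
  "('m::topological_space, 'n::finite) chart set \<Rightarrow> (('m, 'n) chart \<Rightarrow> 'm \<Rightarrow> real ^ 'n ^ 'n)
    \<Rightarrow> (('m, 'n) chart \<Rightarrow> 'm \<Rightarrow> real ^ 'n) \<Rightarrow> bool" where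
  "time_orientation A G X \<longleftrightarrow>
     (\<forall>c\<in>A. continuous_on (fst c) (X c) \<and> (\<forall>p\<in>fst c. bil (G c p) (X c p) (X c p) < 0)) \<and>
     (\<forall>c\<in>A. \<forall>d\<in>A. \<forall>p\<in>fst c \<inter> fst d.
        X d p = jacobian (transition c d) (at (snd c p)) *v X c p)"

definition spacetime where
  "spacetime A G X \<longleftrightarrow> smooth_connected_manifold A \<and> continuous_lorentzian_metric A G
     \<and> time_orientation A G X"

definition future_causal_vec :: "real ^ 'n ^ 'n \<Rightarrow> real ^ 'n \<Rightarrow> real ^ 'n \<Rightarrow> bool" where
  "future_causal_vec Q x v \<longleftrightarrow> v \<noteq> 0 \<and> bil Q v v \<le> 0 \<and> bil Q x v < 0"

definition past_causal_vec :: "real ^ 'n ^ 'n \<Rightarrow> real ^ 'n \<Rightarrow> real ^ 'n \<Rightarrow> bool" where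
  "past_causal_vec Q x v \<longleftrightarrow> v \<noteq> 0 \<and> bil Q v v \<le> 0 \<and> bil Q x v > 0"

definition param_interval :: "real set \<Rightarrow> bool" where
  "param_interval I \<longleftrightarrow> is_interval I \<and> (\<exists>a\<in>I. \<exists>b\<in>I. a < b)"

definition loc_lipschitz_curve ::
  "('m::topological_space, 'n::finite) chart set \<Rightarrow> (real \<Rightarrow> 'm) \<Rightarrow> real set \<Rightarrow> bool" where
  "loc_lipschitz_curve A lam I \<longleftrightarrow> continuous_on I lam \<and>
     (\<forall>t\<in>I. \<exists>c\<in>A. \<exists>e>0. \<exists>L. lam ` (I \<inter> ball t e) \<subseteq> fst c \<and>
        L-lipschitz_on (I \<inter> ball t e) (snd c \<circ> lam))"

definition fd_causal_curve where
  "fd_causal_curve A G X lam I \<longleftrightarrow> param_interval I \<and> loc_lipschitz_curve A lam I \<and>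
     (AE t in lebesgue. t \<in> I \<longrightarrow>
        (\<exists>c\<in>A. lam t \<in> fst c \<and>
           (\<exists>v. ((snd c \<circ> lam) has_vector_derivative v) (at t within I) \<and>
                future_causal_vec (G c (lam t)) (X c (lam t)) v)))"

definition pd_causal_curve where
  "pd_causal_curve A G X lam I \<longleftrightarrow> param_interval I \<and> loc_lipschitz_curve A lam I \<and>
     (AE t in lebesgue. t \<in> I \<longrightarrow>
        (\<exists>c\<in>A. lam t \<in> fst c \<and>
           (\<exists>v. ((snd c \<circ> lam) has_vector_derivative v) (at t within I) \<and>
                past_causal_vec (G c (lam t)) (X c (lam t)) v)))"

definition causal_curve where
  "causal_curve A G X lam I \<longleftrightarrow> fd_causal_curve A G X lam I \<or> pd_causal_curve A G X lam I"

definition upper_end :: "real set \<Rightarrow> real filter" where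
  "upper_end I = (if bdd_above I then at_left (Sup I) else at_top)"

definition lower_end :: "real set \<Rightarrow> real filter" where
  "lower_end I = (if bdd_below I then at_right (Inf I) else at_bot)"

definition no_endpoint :: "(real \<Rightarrow> 'm::topological_space) \<Rightarrow> real filter \<Rightarrow> bool" where
  "no_endpoint lam F \<longleftrightarrow> \<not> (\<exists>p. (lam \<longlongrightarrow> p) F)"

definition future_inextendible where
  "future_inextendible A G X lam I \<longleftrightarrow>
     (fd_causal_curve A G X lam I \<and> no_endpoint lam (upper_end I)) \<or>
     (pd_causal_curve A G X lam I \<and> no_endpoint lam (lower_end I))"

definition past_inextendible where
  "past_inextendible A G X lam I \<longleftrightarrow>
     (fd_causal_curve A G X lam I \<and> no_endpoint lam (lower_end I)) \<or>
     (pd_causal_curve A G X lam I \<and> no_endpoint lam (upper_end I))"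

definition inextendible_causal where
  "inextendible_causal A G X lam I \<longleftrightarrow> causal_curve A G X lam I \<and>
     no_endpoint lam (upper_end I) \<and> no_endpoint lam (lower_end I)"

definition J_future where
  "J_future A G X p = {q. q = p \<or> (\<exists>lam a b. a < b \<and> fd_causal_curve A G X lam {a..b}
                                   \<and> lam a = p \<and> lam b = q)}"

definition J_past where
  "J_past A G X p = {q. q = p \<or> (\<exists>lam a b. a < b \<and> fd_causal_curve A G X lam {a..b}
                                   \<and> lam a = q \<and> lam b = p)}"

definition cauchy_hypersurface where
  "cauchy_hypersurface A G X S \<longleftrightarrow>
     (\<forall>lam I. inextendible_causal A G X lam I \<longrightarrow> (\<exists>!t. t \<in> I \<and> lam t \<in> S))"

definition non_totally_imprisoning where
  "non_totally_imprisoning A G X \<longleftrightarrow>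
     \<not> (\<exists>lam I K. compact K \<and> lam ` I \<subseteq> K \<and>
          (future_inextendible A G X lam I \<or> past_inextendible A G X lam I))"

definition globally_hyperbolic where
  "globally_hyperbolic A G X \<longleftrightarrow> non_totally_imprisoning A G X \<and>
     (\<forall>p q. compact (J_future A G X p \<inter> J_past A G X q))"

end

theory Submission
  imports Defs "HOL-Complex_Analysis.Great_Picard"
begin

text \<open>
  Write \<open>x < y\<close> if a future directed causal curve runs from \<open>x\<close> to \<open>y\<close>. Since every causal curve
  extends to an inextendible one, no two points of \<open>S\<close> are related by \<open><\<close>, and the manifold is the
  disjoint union of \<open>S\<close>, its strict future and its strict past. The strict future is open: if \<open>p\<close> lies
  in it, the inextendible curve that passes straight up through \<open>p\<close> must meet \<open>S\<close> strictly before \<open>p\<close>,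
  and points slightly below \<open>p\<close> have a neighbourhood of \<open>p\<close> in their future.

  Limits of causal curves are taken inside small coordinate balls only. There the time coordinate \<open>w\<close>
  parametrises causal curves as uniformly Lipschitz maps, so Arzela--Ascoli applies, and the limit is
  causal because every functional positive on the cone at a point is positive on all nearby cones.
  Countably many balls, each with a concentric inner ball, replace a complete background metric: a chain
  of points that goes from the inner ball of least index to the boundary of the corresponding outer
  ball in each step cannot converge, so its concatenation is future inextendible and enters the
  future of \<open>S\<close>. Hence causal curves that stay out of the future of \<open>S\<close> cannot take more and more such
  steps, which gives limit points. Applied to both time orientations, this shows that the causal
  relation is closed and that causal diamonds are sequentially compact; applied to the limit set of an
  imprisoned curve it yields a contradiction.
\<close>

section \<open>Lipschitz functions are differentiable almost everywhere\<close>

text \<open>Openness of futures therefore cannot be imported from the smooth theory; it is drawn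
  from \<open>S\<close> itself, and the local constructions use only straight chart segments close
  to the orienting direction. A limit of causal curves is a priori only Lipschitz, whereas causality
  demands a derivative almost everywhere; this is why Lebesgue's differentiation theorem on the line
  opens the proof. The opposite passage, from the almost everywhere cone condition to increments of
  coordinates, is \<open>ae_nonneg_derivative_imp_le\<close>. Inextendible curves are produced as
  discrete chains: a chain only has to be non-convergent, which spares a global arc length and a
  diagonal choice of limit curves.\<close>

lemma countable_imp_negligible:
  fixes C :: "real set"
  assumes "countable C"
  shows "negligible C"
  using assms by (simp add: negligible_iff_null_sets countable_imp_null_set_lborel null_sets_completionI)

text \<open>Strict monotonicity keeps the intervals spanned by the end values disjoint, even where
  \<open>F\<close> jumps, so measures add up. It is applied to a general \<open>F\<close> and to the
  identity.\<close>

lemma emeasure_Union_increments: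
  fixes F :: "real \<Rightarrow> real"
  assumes C: "countable C" and le: "\<And>u v. (u, v) \<in> C \<Longrightarrow> u < v"
    and disj: "pairwise (\<lambda>i j. disjnt {fst i..snd i} {fst j..snd j}) C"
    and F: "strict_mono F"
  shows "emeasure lebesgue (\<Union>i\<in>C. {F (fst i)..F (snd i)})
    = (\<integral>\<^sup>+i. ennreal (F (snd i) - F (fst i)) \<partial>count_space C)"
proof -
  have sep: "{F (fst i)..F (snd i)} \<inter> {F (fst j)..F (snd j)} = {}"
    if "i \<in> C" "j \<in> C" "i \<noteq> j" for i j
  proof -
    have d: "disjnt {fst i..snd i} {fst j..snd j}"
      using disj that by (auto simp: pairwise_def)
    have "fst i < snd i" "fst j < snd j"
      using le that by (metis prod.collapse)+
    with d have "snd i < fst j \<or> snd j < fst i"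
    proof -
      have "max (fst i) (fst j) \<notin> {fst i..snd i} \<or> max (fst i) (fst j) \<notin> {fst j..snd j}"
        using d unfolding disjnt_def by blast
      with \<open>fst i < snd i\<close> \<open>fst j < snd j\<close> show ?thesis by (auto simp: max_def split: if_splits)
    qed
    then have "F (snd i) < F (fst j) \<or> F (snd j) < F (fst i)"
      using F by (auto simp: strict_mono_def)
    then show ?thesis by auto
  qed
  have "emeasure lebesgue (\<Union>i\<in>C. {F (fst i)..F (snd i)})
     = (\<integral>\<^sup>+i. emeasure lebesgue {F (fst i)..F (snd i)} \<partial>count_space C)"
    by (rule emeasure_UN_countable) (use C sep in \<open>auto simp: disjoint_family_on_def\<close>)
  also have "\<dots> = (\<integral>\<^sup>+i. ennreal (F (snd i) - F (fst i)) \<partial>count_space C)"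
  proof (rule nn_integral_cong)
    fix i assume "i \<in> space (count_space C)"
    then have "F (fst i) \<le> F (snd i)"
      using le[of "fst i" "snd i"] F by (auto simp: strict_mono_def intro!: less_imp_le)
    then show "emeasure lebesgue {F (fst i)..F (snd i)} = ennreal (F (snd i) - F (fst i))"
      by simp
  qed
  finally show ?thesis .
qed

lemma Vitali_intervals:
  fixes K :: "(real \<times> real) set"
  assumes K: "\<And>u v. (u, v) \<in> K \<Longrightarrow> u < v"
    and S: "\<And>x d. \<lbrakk>x \<in> S; 0 < d\<rbrakk> \<Longrightarrow> \<exists>u v. (u, v) \<in> K \<and> u \<le> x \<and> x \<le> v \<and> v - u < d"
  obtains C where "countable C" "C \<subseteq> K"
    "pairwise (\<lambda>i j. disjnt {fst i..snd i} {fst j..snd j}) C"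
    "negligible (S - (\<Union>i\<in>C. {fst i..snd i}))"
proof -
  have cb: "cball ((fst i + snd i) / 2) ((snd i - fst i) / 2) = {fst i..snd i}" for i :: "real \<times> real"
    by (auto simp: cball_eq_atLeastAtMost field_simps)
  show ?thesis
  proof (rule Vitali_covering_theorem_cballs[of K "\<lambda>i. (snd i - fst i) / 2" S "\<lambda>i. (fst i + snd i) / 2"])
    show "0 < (snd i - fst i) / 2" if "i \<in> K" for i
      using K that by (metis diff_gt_0_iff_gt half_gt_zero prod.collapse)
    show "\<exists>i. i \<in> K \<and> x \<in> cball ((fst i + snd i) / 2) ((snd i - fst i) / 2) \<and> (snd i - fst i) / 2 < d"
      if "x \<in> S" "0 < d" for x d
    proof -
      from S[OF that] obtain u v where "(u, v) \<in> K" "u \<le> x" "x \<le> v" "v - u < d" by blast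
      then show ?thesis
        using K[of u v] cb[of "(u, v)"] by (intro exI[of _ "(u, v)"]) auto
    qed
  qed (use that in \<open>auto simp: cb\<close>)
qed

text \<open>The slopes are taken over intervals containing \<open>x\<close>, not only over those with endpoint \<open>x\<close>, so
  that the intervals form a Vitali cover.\<close>
definition fast_slow_set :: "(real \<Rightarrow> real) \<Rightarrow> real \<Rightarrow> real \<Rightarrow> real set" where
  "fast_slow_set F p q = {x. \<forall>d>0.
     (\<exists>u v. u < v \<and> u \<le> x \<and> x \<le> v \<and> v - u < d \<and> F v - F u < p * (v - u)) \<and>
     (\<exists>u v. u < v \<and> u \<le> x \<and> x \<le> v \<and> v - u < d \<and> F v - F u > q * (v - u))}"

text \<open>Two nested Vitali selections. Intervals of slope below \<open>p\<close> inside
  \<open>W\<close> have total \<open>F\<close>-increment at most \<open>p\<close> times the measure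
  of \<open>W\<close>; intervals of slope above \<open>q\<close> chosen inside those have increment
  at least \<open>q\<close> times their length, and nesting compares the increments. The null
  remainder of \<open>E\<close> is added to the cover at the end, so \<open>E\<close> may be any
  set, measurable or not.\<close>

lemma fast_slow_set_cover:
  fixes F :: "real \<Rightarrow> real"
  assumes F: "strict_mono F" and pq: "0 < p" "p < q"
    and E: "E \<subseteq> fast_slow_set F p q" and W: "open W" "E \<subseteq> W"
  obtains V where "V \<in> sets lebesgue" "E \<subseteq> V"
    "ennreal q * emeasure lebesgue V \<le> ennreal p * emeasure lebesgue W"
proof -
  define K where "K = {(u, v). u < v \<and> {u..v} \<subseteq> W \<and> F v - F u < p * (v - u)}"
  have Kcov: "\<exists>u v. (u, v) \<in> K \<and> u \<le> x \<and> x \<le> v \<and> v - u < d" if x: "x \<in> E" and d: "0 < d" for x d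
  proof -
    obtain e where e: "0 < e" "ball x e \<subseteq> W"
      using W x by (meson open_contains_ball subsetD)
    have "x \<in> fast_slow_set F p q" using E x by auto
    then obtain u v where uv: "u < v" "u \<le> x" "x \<le> v" "v - u < min d e" "F v - F u < p * (v - u)"
      unfolding fast_slow_set_def using d e by (auto dest!: spec[of _ "min d e"])
    have "{u..v} \<subseteq> ball x e"
      using uv by (auto simp: dist_real_def)
    then show ?thesis using uv e unfolding K_def by (intro exI[of _ u] exI[of _ v]) auto
  qed
  have Klt: "\<And>u v. (u, v) \<in> K \<Longrightarrow> u < v" by (simp add: K_def)
  obtain C where C: "countable C" "C \<subseteq> K"
    "pairwise (\<lambda>i j. disjnt {fst i..snd i} {fst j..snd j}) C"
    "negligible (E - (\<Union>i\<in>C. {fst i..snd i}))"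
    by (rule Vitali_intervals[OF Klt Kcov])
  \<comment> \<open>Endpoints of the first family are dropped so that every remaining point has room
    for a shorter interval inside the same member; they are countably many, hence null.\<close>
  define E2 where "E2 = E \<inter> (\<Union>i\<in>C. {fst i<..<snd i})"
  define K2 where "K2 = {(u, v). u < v \<and> (\<exists>i\<in>C. fst i < u \<and> v < snd i) \<and> F v - F u > q * (v - u)}"
  have K2cov: "\<exists>u v. (u, v) \<in> K2 \<and> u \<le> x \<and> x \<le> v \<and> v - u < d" if x: "x \<in> E2" and d: "0 < d" for x d
  proof -
    obtain i where i: "i \<in> C" "fst i < x" "x < snd i"
      using x unfolding E2_def by auto
    have "x \<in> fast_slow_set F p q" using E x E2_def by auto
    then obtain u v where uv: "u < v" "u \<le> x" "x \<le> v" "v - u < min d (min (x - fst i) (snd i - x))"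
        "F v - F u > q * (v - u)"
      unfolding fast_slow_set_def using d i by (auto dest!: spec[of _ "min d (min (x - fst i) (snd i - x))"])
    then show ?thesis using i unfolding K2_def
      by (intro exI[of _ u] exI[of _ v]) (auto intro!: bexI[of _ i])
  qed
  have K2lt: "\<And>u v. (u, v) \<in> K2 \<Longrightarrow> u < v" by (simp add: K2_def)
  obtain C2 where C2: "countable C2" "C2 \<subseteq> K2"
    "pairwise (\<lambda>i j. disjnt {fst i..snd i} {fst j..snd j}) C2"
    "negligible (E2 - (\<Union>i\<in>C2. {fst i..snd i}))"
    by (rule Vitali_intervals[OF K2lt K2cov])
  define V where "V = (\<Union>i\<in>C2. {fst i..snd i})"
  have neg: "negligible (E - V)"
  proof (rule negligible_subset)
    show "negligible ((E - (\<Union>i\<in>C. {fst i..snd i})) \<union> (fst ` C \<union> snd ` C) \<union> (E2 - V))"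
      using C(1,4) C2(4) countable_imp_negligible[of "fst ` C \<union> snd ` C"]
      unfolding V_def by (intro negligible_Un) auto
    show "E - V \<subseteq> (E - (\<Union>i\<in>C. {fst i..snd i})) \<union> (fst ` C \<union> snd ` C) \<union> (E2 - V)"
    proof
      fix x assume x: "x \<in> E - V"
      show "x \<in> (E - (\<Union>i\<in>C. {fst i..snd i})) \<union> (fst ` C \<union> snd ` C) \<union> (E2 - V)"
      proof (cases "\<exists>i\<in>C. fst i \<le> x \<and> x \<le> snd i")
        case True
        then obtain i where "i \<in> C" "fst i \<le> x" "x \<le> snd i" by blast
        then show ?thesis using x unfolding E2_def
          by (cases "x = fst i \<or> x = snd i") (auto simp: less_le)
      next
        case False
        then show ?thesis using x by auto
      qed
    qed
  qed
  have Vs: "V \<in> sets lebesgue"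
    unfolding V_def using C2(1) by (intro sets.countable_UN') auto
  have lt: "\<And>u v. (u, v) \<in> C \<Longrightarrow> u < v" "\<And>u v. (u, v) \<in> C2 \<Longrightarrow> u < v"
    using subsetD[OF C(2)] subsetD[OF C2(2)] unfolding K_def K2_def by fast+
  have id: "strict_mono (\<lambda>x::real. x)" by (simp add: strict_mono_def)
  have "ennreal q * emeasure lebesgue V = (\<integral>\<^sup>+i. ennreal q * ennreal (snd i - fst i) \<partial>count_space C2)"
    unfolding V_def using emeasure_Union_increments[OF C2(1) lt(2) C2(3) id]
    by (simp add: nn_integral_cmult)
  also have "\<dots> \<le> (\<integral>\<^sup>+i. ennreal (F (snd i) - F (fst i)) \<partial>count_space C2)"
  proof (rule nn_integral_mono)
    fix i assume "i \<in> space (count_space C2)"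
    then have "i \<in> K2" using C2(2) by auto
    then have "0 \<le> snd i - fst i" "q * (snd i - fst i) \<le> F (snd i) - F (fst i)"
      by (auto simp: K2_def split: prod.splits)
    moreover have "0 \<le> q" using pq by simp
    ultimately show "ennreal q * ennreal (snd i - fst i) \<le> ennreal (F (snd i) - F (fst i))"
      by (metis ennreal_mult ennreal_leI)
  qed
  also have "\<dots> = emeasure lebesgue (\<Union>i\<in>C2. {F (fst i)..F (snd i)})"
    using emeasure_Union_increments[OF C2(1) lt(2) C2(3) F] by (rule sym)
  also have "\<dots> \<le> emeasure lebesgue (\<Union>i\<in>C. {F (fst i)..F (snd i)})"
  proof (rule emeasure_mono)
    show "(\<Union>i\<in>C. {F (fst i)..F (snd i)}) \<in> sets lebesgue"
      using C(1) by (intro sets.countable_UN') auto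
    show "(\<Union>i\<in>C2. {F (fst i)..F (snd i)}) \<subseteq> (\<Union>i\<in>C. {F (fst i)..F (snd i)})"
    proof (rule UN_least)
      fix i assume "i \<in> C2"
      then have "i \<in> K2" using C2(2) by auto
      then obtain j where "j \<in> C" "fst j < fst i" "snd i < snd j"
        unfolding K2_def by (auto split: prod.splits)
      then have "F (fst j) < F (fst i)" "F (snd i) < F (snd j)"
        using F by (auto simp: strict_mono_def)
      then have "{F (fst i)..F (snd i)} \<subseteq> {F (fst j)..F (snd j)}" by auto
      then show "{F (fst i)..F (snd i)} \<subseteq> (\<Union>i\<in>C. {F (fst i)..F (snd i)})"
        using \<open>j \<in> C\<close> by auto
    qed
  qed
  also have "\<dots> = (\<integral>\<^sup>+i. ennreal (F (snd i) - F (fst i)) \<partial>count_space C)"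
    using emeasure_Union_increments[OF C(1) lt(1) C(3) F] .
  also have "\<dots> \<le> (\<integral>\<^sup>+i. ennreal p * ennreal (snd i - fst i) \<partial>count_space C)"
  proof (rule nn_integral_mono)
    fix i assume "i \<in> space (count_space C)"
    then have "i \<in> K" using C(2) by auto
    then have "0 \<le> snd i - fst i" "F (snd i) - F (fst i) \<le> p * (snd i - fst i)"
      by (auto simp: K_def split: prod.splits)
    moreover have "0 \<le> p" using pq by simp
    ultimately show "ennreal (F (snd i) - F (fst i)) \<le> ennreal p * ennreal (snd i - fst i)"
      by (metis ennreal_mult ennreal_leI)
  qed
  also have "\<dots> = ennreal p * emeasure lebesgue (\<Union>i\<in>C. {fst i..snd i})"
    using emeasure_Union_increments[OF C(1) lt(1) C(3) id]
    by (simp add: nn_integral_cmult)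
  also have "\<dots> \<le> ennreal p * emeasure lebesgue W"
  proof (intro mult_left_mono emeasure_mono)
    have "{fst i..snd i} \<subseteq> W" if "i \<in> C" for i
      using subsetD[OF C(2) that] unfolding K_def by (simp split: prod.splits)
    then show "(\<Union>i\<in>C. {fst i..snd i}) \<subseteq> W" by (rule UN_least)
  qed (use W(1) in auto)
  finally have *: "ennreal q * emeasure lebesgue V \<le> ennreal p * emeasure lebesgue W" .
  have null: "E - V \<in> null_sets lebesgue"
    using neg by (simp add: negligible_iff_null_sets)
  show ?thesis
  proof
    show "V \<union> (E - V) \<in> sets lebesgue" using Vs null by (intro sets.Un) (auto simp: null_sets_def)
    show "ennreal q * emeasure lebesgue (V \<union> (E - V)) \<le> ennreal p * emeasure lebesgue W"
      using * emeasure_Un_null_set[OF Vs null] by simp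
  qed auto
qed

text \<open>Each pass of \<open>fast_slow_set_cover\<close> shrinks an outer cover by the factor
  \<open>p / q < 1\<close>, so a bounded piece has outer measure zero.\<close>

lemma negligible_fast_slow_set:
  fixes F :: "real \<Rightarrow> real"
  assumes F: "strict_mono F" and pq: "0 < p" "p < q"
  shows "negligible (fast_slow_set F p q)"
proof -
  have bdd: "negligible E" if E: "E \<subseteq> fast_slow_set F p q" "bounded E" for E
  proof -
    \<comment> \<open>Strictly between \<open>p / q\<close> and 1: the slack pays for replacing the
      measurable cover \<open>V\<close> by an open one, which the next pass requires.\<close>
    define \<rho> where "\<rho> = (p / q + 1) / 2"
    have \<rho>: "p / q < \<rho>" "\<rho> < 1" "0 < \<rho>"
      using pq by (auto simp: \<rho>_def field_simps)
    obtain R where R: "R > 0" "E \<subseteq> ball 0 R"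
      using E(2) bounded_subset_ballD by blast
    define M where "M = 2 * R"
    have step: "\<exists>W. open W \<and> E \<subseteq> W \<and> emeasure lebesgue W \<le> ennreal (M * \<rho> ^ n)" for n
    proof (induction n)
      case 0
      show ?case using R by (intro exI[of _ "ball 0 R"]) (auto simp: M_def ball_eq_greaterThanLessThan)
    next
      case (Suc n)
      then obtain W where W: "open W" "E \<subseteq> W" "emeasure lebesgue W \<le> ennreal (M * \<rho> ^ n)" by auto
      obtain V where V: "V \<in> sets lebesgue" "E \<subseteq> V"
        "ennreal q * emeasure lebesgue V \<le> ennreal p * emeasure lebesgue W"
        using fast_slow_set_cover[OF F pq E(1) W(1,2)] by blast
      define m where "m = M * \<rho> ^ n"
      have m: "m > 0" using R \<rho> by (simp add: m_def M_def)
      have "ennreal q * emeasure lebesgue V \<le> ennreal p * ennreal m"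
        using V(3) W(3) unfolding m_def by (meson mult_left_mono order_trans zero_le)
      then have "ennreal (1/q) * (ennreal q * emeasure lebesgue V) \<le> ennreal (1/q) * (ennreal p * ennreal m)"
        by (rule mult_left_mono) simp
      then have Vm: "emeasure lebesgue V \<le> ennreal (p / q * m)"
        using pq m by (simp add: mult.assoc[symmetric] ennreal_mult[symmetric] mult.commute)
      obtain T where T: "open T" "V \<subseteq> T" "T - V \<in> lmeasurable" "emeasure lebesgue (T - V) < ennreal ((\<rho> - p / q) * m)"
        using sets_lebesgue_outer_open[OF V(1), of "(\<rho> - p / q) * m"] \<rho> m by auto
      have "emeasure lebesgue T = emeasure lebesgue V + emeasure lebesgue (T - V)"
        using T V plus_emeasure[of V lebesgue "T - V"] by (metis Diff_disjoint Un_Diff_cancel fmeasurableD sup.absorb_iff2)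
      also have "\<dots> \<le> ennreal (p / q * m) + ennreal ((\<rho> - p / q) * m)"
        using Vm T by (intro add_mono) auto
      also have "\<dots> = ennreal (p / q * m + (\<rho> - p / q) * m)"
        using \<rho> m pq by (intro ennreal_plus[symmetric]) auto
      also have "p / q * m + (\<rho> - p / q) * m = \<rho> * m"
        by (simp add: left_diff_distrib)
      finally show ?case
        using T V by (intro exI[of _ T]) (auto simp: m_def mult_ac)
    qed
    show ?thesis
    proof (rule negligible_outer[THEN iffD2], intro allI impI)
      fix e :: real assume "e > 0"
      have "(\<lambda>n. M * \<rho> ^ n) \<longlonglongrightarrow> M * 0"
        using \<rho> by (intro tendsto_intros LIMSEQ_realpow_zero) auto
      then have "eventually (\<lambda>n. M * \<rho> ^ n < e) sequentially"
        using \<open>e > 0\<close> by (intro order_tendstoD) auto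
      then obtain n where n: "M * \<rho> ^ n < e" by (auto simp: eventually_sequentially)
      obtain W where W: "open W" "E \<subseteq> W" "emeasure lebesgue W \<le> ennreal (M * \<rho> ^ n)"
        using step by blast
      have lm: "W \<in> lmeasurable"
        using W by (intro fmeasurableI) (auto intro: order.strict_trans1)
      have "measure lebesgue W \<le> M * \<rho> ^ n"
        using W(3) lm R \<rho> by (simp add: emeasure_eq_measure2 M_def)
      then show "\<exists>T. E \<subseteq> T \<and> T \<in> lmeasurable \<and> measure lebesgue T < e"
        using W lm n by (intro exI[of _ W]) auto
    qed
  qed
  have "fast_slow_set F p q = (\<Union>n::nat. fast_slow_set F p q \<inter> ball 0 (real n))"
    by (auto simp: reals_Archimedean2)
  moreover have "negligible (\<Union>n::nat. fast_slow_set F p q \<inter> ball 0 (real n))"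
    by (rule negligible_countable_Union) (auto intro!: bdd bounded_Int)
  ultimately show ?thesis by simp
qed

text \<open>If the lower and upper limits of the difference quotients differ at \<open>x\<close>,
  two rationals between them put \<open>x\<close> into one of countably many null sets
  \<open>fast_slow_set F p q\<close>.\<close>

lemma lipschitz_real_differentiable_ae:
  fixes f :: "real \<Rightarrow> real"
  assumes L: "\<And>x y. \<bar>f x - f y\<bar> \<le> L * \<bar>x - y\<bar>"
  shows "negligible {x. \<not> f differentiable at x}"
proof -
  \<comment> \<open>The linear term forces all slopes into the interval from 1 to
    \<open>2 * L + 1\<close>: \<open>F\<close> is strictly increasing, the rationals can be taken
    positive, and the limit is finite.\<close>
  define F where "F x = f x + (L + 1) * x" for x
  have slope: "y - x \<le> F y - F x" "F y - F x \<le> (2 * L + 1) * (y - x)" if "x < y" for x y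
    using L[of x y] that by (auto simp: F_def algebra_simps)
  have F: "strict_mono F"
    using slope(1) by (fastforce simp: strict_mono_def)
  define s where "s x h = (F (x + h) - F x) / h" for x h
  have s_bd: "1 \<le> s x h" "s x h \<le> 2 * L + 1" if "h \<noteq> 0" for x h
    using slope[of x "x + h"] slope[of "x + h" x] that
    by (auto simp: s_def field_simps neq_iff)
  have ev0: "eventually (\<lambda>h::real. h \<noteq> 0) (at 0)"
    by (simp add: eventually_at_filter)
  have diff: "f differentiable at x" if nE: "\<And>p q. \<lbrakk>p \<in> \<rat>; q \<in> \<rat>; 0 < p; p < q\<rbrakk> \<Longrightarrow> x \<notin> fast_slow_set F p q" for x
  proof -
    define l where "l = Liminf (at 0) (\<lambda>h. ereal (s x h))"
    define u where "u = Limsup (at 0) (\<lambda>h. ereal (s x h))"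
    have l: "1 \<le> l"
      unfolding l_def using s_bd by (intro Liminf_bounded eventually_mono[OF ev0]) auto
    have u: "u \<le> ereal (2 * L + 1)"
      unfolding u_def using s_bd by (intro Limsup_bounded eventually_mono[OF ev0]) auto
    have lu: "l \<le> u" unfolding l_def u_def by (intro Liminf_le_Limsup) simp
    have "\<not> l < u"
    proof
      assume "l < u"
      then obtain p where p: "l < ereal (real_of_rat p)" "ereal (real_of_rat p) < u"
        using ereal_dense3 by blast
      then obtain q where q: "ereal (real_of_rat p) < ereal (real_of_rat q)" "ereal (real_of_rat q) < u"
        using ereal_dense3 by blast
      have pp: "0 < real_of_rat p" proof -
        have "(0::ereal) < ereal (real_of_rat p)"
          using l p(1) by (meson le_less_trans less_le_trans zero_less_one_ereal order.strict_trans)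
        then show ?thesis by simp
      qed
      have fr1: "frequently (\<lambda>h. s x h < of_rat p) (at 0)"
      proof (rule ccontr)
        assume "\<not> frequently (\<lambda>h. s x h < of_rat p) (at 0)"
        then have "eventually (\<lambda>h. ereal (of_rat p) \<le> ereal (s x h)) (at 0)"
          by (simp add: frequently_def not_less)
        then have "ereal (of_rat p) \<le> l" unfolding l_def by (rule Liminf_bounded)
        with p show False by simp
      qed
      have fr2: "frequently (\<lambda>h. s x h > of_rat q) (at 0)"
      proof (rule ccontr)
        assume "\<not> frequently (\<lambda>h. s x h > of_rat q) (at 0)"
        then have "eventually (\<lambda>h. ereal (s x h) \<le> ereal (of_rat q)) (at 0)"
          by (simp add: frequently_def not_less)
        then have "u \<le> ereal (of_rat q)" unfolding u_def by (rule Limsup_bounded)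
        with q show False by simp
      qed
      have small: "\<exists>h. h \<noteq> 0 \<and> \<bar>h\<bar> < d \<and> P h" if "frequently P (at (0::real))" "d > 0" for P d
        using that by (auto simp: frequently_at dist_real_def)
      have "x \<in> fast_slow_set F (of_rat p) (of_rat q)"
        unfolding fast_slow_set_def
      proof (intro CollectI allI impI conjI)
        fix d :: real assume d: "d > 0"
        obtain h where h: "h \<noteq> 0" "\<bar>h\<bar> < d" "s x h < of_rat p" using small[OF fr1 d] by blast
        show "\<exists>u v. u < v \<and> u \<le> x \<and> x \<le> v \<and> v - u < d \<and> F v - F u < real_of_rat p * (v - u)"
        proof (cases "h > 0")
          case True
          then show ?thesis using h
            by (intro exI[of _ x] exI[of _ "x + h"]) (auto simp: s_def field_simps)
        next
          case False
          then show ?thesis using h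
            by (intro exI[of _ "x + h"] exI[of _ x]) (auto simp: s_def field_simps)
        qed
        obtain h where h: "h \<noteq> 0" "\<bar>h\<bar> < d" "s x h > of_rat q" using small[OF fr2 d] by blast
        show "\<exists>u v. u < v \<and> u \<le> x \<and> x \<le> v \<and> v - u < d \<and> F v - F u > real_of_rat q * (v - u)"
        proof (cases "h > 0")
          case True
          then show ?thesis using h
            by (intro exI[of _ x] exI[of _ "x + h"]) (auto simp: s_def field_simps)
        next
          case False
          then show ?thesis using h
            by (intro exI[of _ "x + h"] exI[of _ x]) (auto simp: s_def field_simps)
        qed
      qed
      with nE[of "of_rat p" "of_rat q"] pp q show False by auto
    qed
    with lu have "l = u" by simp
    moreover obtain D where D: "l = ereal D"
      using l u \<open>l = u\<close> by (cases l) (auto simp: one_ereal_def)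
    ultimately have "((\<lambda>h. ereal (s x h)) \<longlongrightarrow> ereal D) (at 0)"
      unfolding l_def u_def by (intro Liminf_eq_Limsup) auto
    then have "(s x \<longlongrightarrow> D) (at 0)" by simp
    then have "(F has_real_derivative D) (at x)"
      unfolding s_def DERIV_def by simp
    then have "((\<lambda>x. F x - (L + 1) * x) has_real_derivative D - (L + 1)) (at x)"
      by (auto intro!: derivative_eq_intros)
    then have "(f has_real_derivative D - (L + 1)) (at x)"
      by (simp add: F_def)
    then show ?thesis by (metis real_differentiable_def)
  qed
  have "negligible (\<Union>p\<in>{r. r \<in> \<rat> \<and> 0 < r}. \<Union>q\<in>{r. r \<in> \<rat> \<and> p < r}. fast_slow_set F p q)"
  proof (intro negligible_countable_Union)
    show "countable ((\<lambda>p. \<Union>q\<in>{r. r \<in> \<rat> \<and> p < r}. fast_slow_set F p q) ` {r. r \<in> \<rat> \<and> 0 < r})"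
      by (intro countable_image countable_subset[OF _ countable_rat]) auto
    fix T assume "T \<in> (\<lambda>p. \<Union>q\<in>{r. r \<in> \<rat> \<and> p < r}. fast_slow_set F p q) ` {r. r \<in> \<rat> \<and> 0 < r}"
    then obtain p where p: "0 < p" "T = (\<Union>q\<in>{r. r \<in> \<rat> \<and> p < r}. fast_slow_set F p q)" by auto
    have "countable (fast_slow_set F p ` {r. r \<in> \<rat> \<and> p < r})"
      by (intro countable_image countable_subset[OF _ countable_rat]) auto
    then show "negligible T"
      unfolding p(2) by (intro negligible_countable_Union) (auto intro: negligible_fast_slow_set F p(1))
  qed
  then show ?thesis
    by (rule negligible_subset) (use diff in blast)
qed

lemma lipschitz_vec_differentiable_ae:
  fixes g :: "real \<Rightarrow> real ^ 'n"
  assumes "L-lipschitz_on {0..1} g"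
  shows "negligible {u \<in> {0<..<1}. \<not> g differentiable at u}"
proof -
  \<comment> \<open>Clamping the argument extends \<open>g\<close> to a Lipschitz map of the whole
    line that is unchanged near each point of \<open>{0<..<1}\<close>.\<close>
  define cl where "cl u = max 0 (min 1 u)" for u :: real
  have cl: "cl u \<in> {0..1}" "\<bar>cl u - cl v\<bar> \<le> \<bar>u - v\<bar>" for u v
    by (auto simp: cl_def)
  have L0: "0 \<le> L" using assms lipschitz_on_nonneg by blast
  have lip: "\<bar>g (cl x) $ i - g (cl y) $ i\<bar> \<le> L * \<bar>x - y\<bar>" for i x y
  proof -
    have "\<bar>g (cl x) $ i - g (cl y) $ i\<bar> \<le> norm (g (cl x) - g (cl y))"
      using component_le_norm_cart[of "g (cl x) - g (cl y)" i] by simp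
    also have "\<dots> \<le> L * \<bar>cl x - cl y\<bar>"
      using lipschitz_onD[OF assms cl(1) cl(1)] by (simp add: dist_norm)
    also have "\<dots> \<le> L * \<bar>x - y\<bar>" using cl(2) L0 by (intro mult_left_mono) auto
    finally show ?thesis .
  qed
  have "negligible (\<Union>i. {x. \<not> (\<lambda>u. g (cl u) $ i) differentiable at x})"
    using lip by (intro negligible_Union_nat negligible_Union) (auto intro!: lipschitz_real_differentiable_ae)
  then show ?thesis
  proof (rule negligible_subset, intro subsetI)
    fix u assume u: "u \<in> {u \<in> {0<..<1}. \<not> g differentiable at u}"
    show "u \<in> (\<Union>i. {x. \<not> (\<lambda>u. g (cl u) $ i) differentiable at x})"
    proof (rule ccontr)
      assume "u \<notin> (\<Union>i. {x. \<not> (\<lambda>u. g (cl u) $ i) differentiable at x})"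
      then have "\<forall>i. (\<lambda>u. g (cl u) $ i) differentiable at u" by auto
      then have "\<forall>i. \<exists>D. ((\<lambda>u. g (cl u) $ i) has_real_derivative D) (at u)"
        by (simp add: real_differentiable_def)
      then obtain D where D: "\<And>i. ((\<lambda>u. g (cl u) $ i) has_real_derivative D i) (at u)" by metis
      have "((\<lambda>u. g (cl u)) has_vector_derivative (\<chi> i. D i)) (at u)"
        using D by (auto simp: has_vector_derivative_def has_field_derivative_def mult_commute_abs
            has_derivative_componentwise_within[of "\<lambda>u. g (cl u)"] Basis_vec_def inner_axis)
      then have "(g has_vector_derivative (\<chi> i. D i)) (at u)"
        by (rule has_vector_derivative_transform_within_open[of _ _ _ "{0<..<1}"])
           (use u in \<open>auto simp: cl_def\<close>)
      with u show False
        by (auto simp: has_vector_derivative_def differentiable_def)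
    qed
  qed
qed

text \<open>Lipschitz maps send null sets to null sets, so after tilting by a small slope some level
  between \<open>h b\<close> and \<open>h a\<close> is not attained on \<open>N\<close>. At the last
  point where this level is reached the derivative is positive, yet the function stays below the
  level afterwards.\<close>

lemma ae_nonneg_derivative_imp_le:
  fixes g :: "real \<Rightarrow> real"
  assumes ab: "a \<le> b" and cont: "continuous_on {a..b} g" and neg: "negligible N"
    and lip: "\<And>t. t \<in> {a..b} \<Longrightarrow> \<exists>T B. open T \<and> t \<in> T \<and> (\<forall>y\<in>{a..b} \<inter> T. \<bar>g y - g t\<bar> \<le> B * \<bar>y - t\<bar>)"
    and der: "\<And>t. t \<in> {a<..<b} - N \<Longrightarrow> \<exists>D\<ge>0. (g has_real_derivative D) (at t)"
  shows "g a \<le> g b"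
proof (rule ccontr)
  assume "\<not> g a \<le> g b"
  then have lt: "g b < g a" and "a < b" using ab by (auto simp: less_le)
  \<comment> \<open>Half the mean rate of descent: the tilted \<open>h\<close> still falls from
    \<open>a\<close> to \<open>b\<close>, but its derivative off \<open>N\<close> is at least
    \<open>e\<close>.\<close>
  define e where "e = (g a - g b) / (2 * (b - a))"
  have e: "e > 0" using lt \<open>a < b\<close> by (simp add: e_def)
  define h where "h t = g t + e * t" for t
  have "e * (b - a) = (g a - g b) / 2" using \<open>a < b\<close> by (simp add: e_def field_simps)
  then have hba: "h b < h a" using lt by (simp add: h_def algebra_simps)
  have conth: "continuous_on {a..b} h" unfolding h_def by (intro continuous_intros cont)
  have "negligible (h ` (N \<inter> {a..b}))"
  proof (rule negligible_locally_Lipschitz_image)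
    show "negligible (N \<inter> {a..b})" using neg by (rule negligible_subset) auto
    fix x assume x: "x \<in> N \<inter> {a..b}"
    then obtain T B where T: "open T" "x \<in> T" "\<forall>y\<in>{a..b} \<inter> T. \<bar>g y - g x\<bar> \<le> B * \<bar>y - x\<bar>"
      using lip by blast
    show "\<exists>T B. open T \<and> x \<in> T \<and> (\<forall>y\<in>N \<inter> {a..b} \<inter> T. norm (h y - h x) \<le> B * norm (y - x))"
    proof (intro exI[of _ T] exI[of _ "B + e"] conjI ballI)
      fix y assume "y \<in> N \<inter> {a..b} \<inter> T"
      then have "\<bar>g y - g x\<bar> \<le> B * \<bar>y - x\<bar>" using T by auto
      moreover have "h y - h x = (g y - g x) + e * (y - x)" by (simp add: h_def algebra_simps)
      moreover have "\<bar>e * (y - x)\<bar> = e * \<bar>y - x\<bar>" using e by (simp add: abs_mult)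
      ultimately show "norm (h y - h x) \<le> (B + e) * norm (y - x)"
        by (simp add: distrib_right)
    qed (use T in auto)
  qed simp
  moreover have "\<not> negligible {h b<..<h a}"
    using hba by (simp add: negligible_iff_null_sets null_sets_def)
  ultimately have "\<not> {h b<..<h a} \<subseteq> h ` (N \<inter> {a..b})"
    using negligible_subset by blast
  then obtain y where "y \<in> {h b<..<h a}" "y \<notin> h ` (N \<inter> {a..b})" by blast
  then have y: "h b < y" "y < h a" "y \<notin> h ` (N \<inter> {a..b})" by auto
  define T where "T = {t \<in> {a..b}. y \<le> h t}"
  have "compact T"
  proof -
    have "T = {a..b} \<inter> h -` {y..}" by (auto simp: T_def)
    then show ?thesis
      using continuous_on_closed_vimage[THEN iffD1, OF closed_atLeastAtMost conth, rule_format, of "{y..}"]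
      by (metis compact_Icc compact_Int_closed Int_assoc Int_commute Int_absorb closed_atLeast)
  qed
  moreover have "a \<in> T" using y \<open>a < b\<close> by (auto simp: T_def)
  ultimately obtain t where t: "t \<in> T" "\<And>s. s \<in> T \<Longrightarrow> s \<le> t"
    using compact_attains_sup[of T] by blast
  have tb: "t \<in> {a..b}" "y \<le> h t" using t(1) by (auto simp: T_def)
  have "t < b" using tb y by (cases "t = b") auto
  have after: "h s < y" if "t < s" "s \<le> b" for s
    using t(2)[of s] that tb by (force simp: T_def)
  have hty: "h t = y"
  proof (rule ccontr)
    assume "h t \<noteq> y"
    then have "y < h t" using tb by simp
    moreover have "continuous_on {t..b} h" using conth by (rule continuous_on_subset) (use tb in auto)
    ultimately obtain s where "t \<le> s" "s \<le> b" "h s = y"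
      using IVT2'[of h b y t] y \<open>t < b\<close> by auto
    then show False using after[of s] \<open>y < h t\<close> by (cases "s = t") auto
  qed
  have "t \<noteq> a" "t \<notin> N" using hty y tb by auto
  then obtain D where D: "D \<ge> 0" "(g has_real_derivative D) (at t)"
    using der[of t] tb \<open>t < b\<close> by auto
  have "(h has_real_derivative D + e) (at t)"
    unfolding h_def by (auto intro!: derivative_eq_intros D(2))
  then obtain d where d: "d > 0" "\<forall>k>0. k < d \<longrightarrow> h t < h (t + k)"
    using DERIV_pos_inc_right[of h "D + e" t] D(1) e by auto
  define k where "k = min (d / 2) (b - t)"
  have "0 < k" "k < d" "t + k \<le> b" using d \<open>t < b\<close> by (auto simp: k_def min_def)
  then show False using d(2) after[of "t + k"] hty by force
qed

section \<open>Strict differentiability of smooth maps\<close>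

lemma C1_strict_differentiable:
  fixes h :: "real ^ 'n \<Rightarrow> real" and g :: "'n \<Rightarrow> real ^ 'n \<Rightarrow> real"
  assumes S: "open S" "x0 \<in> S"
    and der: "\<And>i x. x \<in> S \<Longrightarrow> ((\<lambda>t. h (x + t *\<^sub>R axis i 1)) has_real_derivative g i x) (at 0)"
    and cont: "\<And>i. continuous_on S (g i)" and e: "e > 0"
  shows "\<exists>d>0. \<forall>x\<in>ball x0 d. \<forall>y\<in>ball x0 d.
    \<bar>h y - h x - (\<Sum>i\<in>UNIV. g i x0 * (y - x) $ i)\<bar> \<le> e * norm (y - x)"
proof -
  \<comment> \<open>Each of the \<open>CARD('n)\<close> coordinate changes is bounded by
    \<open>norm (y - x)\<close>, so \<open>\<eta>\<close> per coordinate adds up to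
    \<open>e\<close>.\<close>
  define \<eta> where "\<eta> = e / real CARD('n)"
  have \<eta>: "\<eta> > 0" using e by (simp add: \<eta>_def)
  have "eventually (\<lambda>z. \<forall>i. \<bar>g i z - g i x0\<bar> < \<eta>) (nhds x0)"
  proof (rule eventually_all_finite)
    fix i
    have "(g i \<longlongrightarrow> g i x0) (nhds x0)"
      using cont[of i] S by (simp add: continuous_on_eq_continuous_at continuous_at tendsto_at_iff_tendsto_nhds)
    then show "eventually (\<lambda>z. \<bar>g i z - g i x0\<bar> < \<eta>) (nhds x0)"
      using \<eta> by (auto simp: tendsto_iff dist_real_def)
  qed
  moreover have "eventually (\<lambda>z. z \<in> S) (nhds x0)" using S by (rule eventually_nhds_in_open)
  ultimately have "eventually (\<lambda>z. z \<in> S \<and> (\<forall>i. \<bar>g i z - g i x0\<bar> < \<eta>)) (nhds x0)"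
    by (auto elim: eventually_elim2)
  then obtain d0 where d0: "d0 > 0" "\<And>z. dist z x0 < d0 \<Longrightarrow> z \<in> S \<and> (\<forall>i. \<bar>g i z - g i x0\<bar> < \<eta>)"
    unfolding eventually_nhds_metric by blast
  \<comment> \<open>A third of \<open>d0\<close>: intermediate points lie within
    \<open>norm (y - x) < 2 * d0 / 3\<close> of \<open>x\<close>, hence in the ball where the
    partial derivatives are controlled.\<close>
  have main: "\<bar>h y - h x - (\<Sum>i\<in>UNIV. g i x0 * (y - x) $ i)\<bar> \<le> e * norm (y - x)"
    if xy: "x \<in> ball x0 (d0 / 3)" "y \<in> ball x0 (d0 / 3)" for x y
  proof -
    \<comment> \<open>The path from \<open>x\<close> to \<open>y\<close> changes one coordinate at a
      time, so that only partial derivatives enter; \<open>F\<close> collects the coordinates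
      already changed.\<close>
    define z where "z F = (\<chi> i. if i \<in> F then y $ i else x $ i)" for F
    have near: "dist w x0 < d0" if "norm (w - x) \<le> norm (y - x)" for w
    proof -
      have "norm (y - x) \<le> dist y x0 + dist x x0"
        by (metis dist_norm dist_triangle2)
      then have "dist w x < 2 * d0 / 3" using that xy by (auto simp: dist_norm norm_minus_commute)
      then show ?thesis using xy dist_triangle[of w x0 x] by (auto simp: dist_commute)
    qed
    have "\<bar>h (z F) - h x - (\<Sum>i\<in>F. g i x0 * (y - x) $ i)\<bar> \<le> \<eta> * (\<Sum>i\<in>F. \<bar>(y - x) $ i\<bar>)" if "finite F" for F
      using that
    proof (induction F)
      case empty
      have "z {} = x" by (simp add: z_def vec_eq_iff)
      then show ?case by simp
    next
      case (insert j F)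
      define dj where "dj = (y - x) $ j"
      have zin: "z (insert j F) = z F + dj *\<^sub>R axis j 1"
        using insert by (auto simp: z_def vec_eq_iff axis_def dj_def)
      have nr: "dist (z F + t *\<^sub>R axis j 1) x0 < d0" if t: "t \<in> closed_segment 0 dj" for t
      proof (rule near, rule norm_le_componentwise_cart)
        fix i
        have "\<bar>t\<bar> \<le> \<bar>dj\<bar>" using t by (auto simp: closed_segment_eq_real_ivl split: if_splits)
        then show "norm ((z F + t *\<^sub>R axis j 1 - x) $ i) \<le> norm ((y - x) $ i)"
          using insert(2) by (auto simp: z_def axis_def dj_def)
      qed
      define k where "k t = h (z F + t *\<^sub>R axis j 1) - g j x0 * t" for t
      have "norm (k dj - k 0) \<le> \<eta> * norm (dj - 0)"
      proof (rule field_differentiable_bound)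
        show "convex (closed_segment 0 dj)" by simp
        fix t assume t: "t \<in> closed_segment 0 dj"
        let ?w = "z F + t *\<^sub>R axis j 1"
        have w: "?w \<in> S" "\<bar>g j ?w - g j x0\<bar> < \<eta>" using d0(2)[OF nr[OF t]] by auto
        have "((\<lambda>s. h (z F + (s + t) *\<^sub>R axis j 1)) has_real_derivative g j ?w) (at 0)"
          using der[OF w(1), of j] by (simp add: algebra_simps)
        then have "((\<lambda>s. h (z F + s *\<^sub>R axis j 1)) has_real_derivative g j ?w) (at t)"
          using DERIV_shift[of "\<lambda>s. h (z F + s *\<^sub>R axis j 1)" "g j ?w" 0 t] by simp
        then have "(k has_real_derivative g j ?w - g j x0) (at t)"
          unfolding k_def by (auto intro!: derivative_eq_intros)
        then show "(k has_real_derivative g j ?w - g j x0) (at t within closed_segment 0 dj)"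
          by (rule has_field_derivative_at_within)
        show "norm (g j ?w - g j x0) \<le> \<eta>" using w by simp
      qed auto
      then have "\<bar>h (z (insert j F)) - h (z F) - g j x0 * dj\<bar> \<le> \<eta> * \<bar>dj\<bar>"
        by (simp add: k_def zin algebra_simps)
      then show ?case using insert by (simp add: dj_def algebra_simps)
    qed
    from this[of UNIV] have "\<bar>h (z UNIV) - h x - (\<Sum>i\<in>UNIV. g i x0 * (y - x) $ i)\<bar> \<le> \<eta> * (\<Sum>i\<in>UNIV. \<bar>(y - x) $ i\<bar>)"
      by simp
    also have "(\<Sum>i\<in>UNIV. \<bar>(y - x) $ i\<bar>) \<le> (\<Sum>i\<in>(UNIV::'n set). norm (y - x))"
      by (intro sum_mono component_le_norm_cart)
    also have "\<eta> * (\<Sum>i\<in>(UNIV::'n set). norm (y - x)) = e * norm (y - x)"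
      by (simp add: \<eta>_def)
    also have "z UNIV = y" by (simp add: z_def)
    finally show ?thesis using \<eta> by (simp add: mult_left_mono)
  qed
  show ?thesis using d0(1) main by (intro exI[of _ "d0 / 3"]) auto
qed

text \<open>Both arguments vary near \<open>x0\<close>, more than differentiability at
  \<open>x0\<close> gives. Fixing \<open>x = x0\<close> yields the derivative, leaving both free
  yields a local Lipschitz bound.\<close>

lemma smooth_on_imp_strict:
  fixes f :: "real ^ 'n \<Rightarrow> real ^ 'k"
  assumes f: "smooth_on S f" and S: "open S" "x0 \<in> S"
  obtains f' where "bounded_linear f'"
    "\<And>e. e > 0 \<Longrightarrow> \<exists>d>0. \<forall>x\<in>ball x0 d. \<forall>y\<in>ball x0 d. norm (f y - f x - f' (y - x)) \<le> e * norm (y - x)"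
proof -
  have "\<forall>j i. \<exists>g. (\<forall>x\<in>S. ((\<lambda>t. f (x + t *\<^sub>R axis i 1) $ j) has_real_derivative g x) (at 0)) \<and> continuous_on S g"
    using f unfolding smooth_on_def by (auto dest!: spec[of _ "Suc 0"])
  then obtain g where g: "\<And>j i x. x \<in> S \<Longrightarrow> ((\<lambda>t. f (x + t *\<^sub>R axis i 1) $ j) has_real_derivative g j i x) (at 0)"
    "\<And>j i. continuous_on S (g j i)" by metis
  define f' where "f' v = (\<chi> j. \<Sum>i\<in>UNIV. g j i x0 * v $ i)" for v
  have "f' = (\<lambda>v. (\<chi> j i. g j i x0) *v v)" by (auto simp: f'_def matrix_vector_mult_def)
  then have bl: "bounded_linear f'" by simp
  show ?thesis
  proof (rule that[OF bl])
    fix e :: real assume e: "e > 0"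
    let ?e = "e / real CARD('k)"
    have e': "?e > 0" using e by simp
    have "\<forall>j. \<exists>d>0. \<forall>x\<in>ball x0 d. \<forall>y\<in>ball x0 d.
       \<bar>f y $ j - f x $ j - (\<Sum>i\<in>UNIV. g j i x0 * (y - x) $ i)\<bar> \<le> ?e * norm (y - x)"
      by (intro allI C1_strict_differentiable[OF S _ _ e'] g)
    from choice[OF this] obtain d where d': "\<forall>j. d j > 0 \<and> (\<forall>x\<in>ball x0 (d j). \<forall>y\<in>ball x0 (d j).
       \<bar>f y $ j - f x $ j - (\<Sum>i\<in>UNIV. g j i x0 * (y - x) $ i)\<bar> \<le> ?e * norm (y - x))" by blast
    have d: "\<And>j. d j > 0" "\<And>j x y. x \<in> ball x0 (d j) \<Longrightarrow> y \<in> ball x0 (d j) \<Longrightarrow>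
       \<bar>f y $ j - f x $ j - (\<Sum>i\<in>UNIV. g j i x0 * (y - x) $ i)\<bar> \<le> ?e * norm (y - x)"
      using d' by blast+
    define D where "D = Min (range d)"
    have D: "D > 0" "\<And>j. D \<le> d j" using d(1) by (auto simp: D_def)
    show "\<exists>d>0. \<forall>x\<in>ball x0 d. \<forall>y\<in>ball x0 d. norm (f y - f x - f' (y - x)) \<le> e * norm (y - x)"
    proof (intro exI[of _ D] conjI ballI D(1))
      fix x y assume xy: "x \<in> ball x0 D" "y \<in> ball x0 D"
      have "norm (f y - f x - f' (y - x)) \<le> (\<Sum>j\<in>UNIV. \<bar>(f y - f x - f' (y - x)) $ j\<bar>)"
        by (rule norm_le_l1_cart)
      also have "\<dots> \<le> (\<Sum>j\<in>(UNIV::'k set). ?e * norm (y - x))"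
      proof (rule sum_mono)
        fix j
        have "x \<in> ball x0 (d j)" "y \<in> ball x0 (d j)" using xy D(2)[of j] by auto
        then show "\<bar>(f y - f x - f' (y - x)) $ j\<bar> \<le> ?e * norm (y - x)"
          using d(2)[of x j y] by (simp add: f'_def)
      qed
      also have "\<dots> = e * norm (y - x)" by simp
      finally show "norm (f y - f x - f' (y - x)) \<le> e * norm (y - x)" .
    qed
  qed
qed

text \<open>Makes the \<open>jacobian\<close> in the transformation laws of \<open>G\<close> and
  \<open>X\<close> the actual derivative of the transition map.\<close>

lemma smooth_on_has_jacobian:
  fixes f :: "real ^ 'n \<Rightarrow> real ^ 'k"
  assumes "smooth_on S f" "open S" "x0 \<in> S"
  shows "(f has_derivative (\<lambda>v. jacobian f (at x0) *v v)) (at x0)"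
proof -
  obtain f' where f': "bounded_linear f'"
    "\<And>e. e > 0 \<Longrightarrow> \<exists>d>0. \<forall>x\<in>ball x0 d. \<forall>y\<in>ball x0 d. norm (f y - f x - f' (y - x)) \<le> e * norm (y - x)"
    using smooth_on_imp_strict[OF assms] by blast
  have "(f has_derivative f') (at x0)"
    unfolding has_derivative_at_alt
  proof (intro conjI f'(1) allI impI)
    fix e :: real assume "e > 0"
    then obtain d where "d > 0" "\<forall>x\<in>ball x0 d. \<forall>y\<in>ball x0 d. norm (f y - f x - f' (y - x)) \<le> e * norm (y - x)"
      using f'(2) by blast
    then show "\<exists>d>0. \<forall>y. norm (y - x0) < d \<longrightarrow> norm (f y - f x0 - f' (y - x0)) \<le> e * norm (y - x0)"
      by (intro exI[of _ d]) (auto simp: dist_norm norm_minus_commute[of x0])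
  qed
  then show ?thesis using jacobian_works differentiableI by blast
qed

lemma smooth_on_locally_lipschitz:
  fixes f :: "real ^ 'n \<Rightarrow> real ^ 'k"
  assumes "smooth_on S f" "open S" "x0 \<in> S"
  obtains d L where "d > 0" "L-lipschitz_on (ball x0 d) f"
proof -
  obtain f' where f': "bounded_linear f'"
    "\<And>e. e > 0 \<Longrightarrow> \<exists>d>0. \<forall>x\<in>ball x0 d. \<forall>y\<in>ball x0 d. norm (f y - f x - f' (y - x)) \<le> e * norm (y - x)"
    using smooth_on_imp_strict[OF assms] by blast
  obtain d where d: "d > 0" "\<forall>x\<in>ball x0 d. \<forall>y\<in>ball x0 d. norm (f y - f x - f' (y - x)) \<le> 1 * norm (y - x)"
    using f'(2)[of 1] by auto
  obtain K where K: "0 \<le> K" "\<And>v. norm (f' v) \<le> norm v * K"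
    using bounded_linear.nonneg_bounded[OF f'(1)] by blast
  have "(1 + K)-lipschitz_on (ball x0 d) f"
  proof (rule lipschitz_onI)
    fix x y assume "x \<in> ball x0 d" "y \<in> ball x0 d"
    then have "norm (f x - f y - f' (x - y)) \<le> norm (x - y)" using d(2) by auto
    moreover have "norm (f x - f y) \<le> norm (f x - f y - f' (x - y)) + norm (f' (x - y))"
      using norm_triangle_ineq[of "f x - f y - f' (x - y)" "f' (x - y)"] by simp
    ultimately show "dist (f x) (f y) \<le> (1 + K) * dist x y"
      using K(2)[of "x - y"] by (simp add: dist_norm algebra_simps)
  qed (use K in auto)
  then show ?thesis using that d(1) by blast
qed

section \<open>Lorentzian cones\<close>

lemma bil_sum: "bil Q v w = (\<Sum>i\<in>UNIV. \<Sum>j\<in>UNIV. v $ i * (Q $ i $ j * w $ j))"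
  by (simp add: bil_def inner_vec_def matrix_vector_mult_def sum_distrib_left)

lemma tendsto_bil:
  assumes "(Q \<longlongrightarrow> Q0) F" "(v \<longlongrightarrow> v0) F" "(w \<longlongrightarrow> w0) F"
  shows "((\<lambda>x. bil (Q x) (v x) (w x)) \<longlongrightarrow> bil Q0 v0 w0) F"
  unfolding bil_sum using assms by (intro tendsto_intros)

lemma bil_linear [simp]:
  "bil Q (v + v') w = bil Q v w + bil Q v' w"
  "bil Q v (w + w') = bil Q v w + bil Q v w'"
  "bil Q (r *\<^sub>R v) w = r * bil Q v w"
  "bil Q v (r *\<^sub>R w) = r * bil Q v w"
  "bil Q (- v) w = - bil Q v w"
  "bil Q v (- w) = - bil Q v w"
  "bil Q (v - v') w = bil Q v w - bil Q v' w"
  "bil Q v (w - w') = bil Q v w - bil Q v w'"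
  "bil Q 0 w = 0" "bil Q v 0 = 0"
  by (simp_all add: bil_sum algebra_simps sum.distrib sum_distrib_left sum_negf sum_subtractf)

lemma bil_commute: "transpose Q = Q \<Longrightarrow> bil Q v w = bil Q w v"
  unfolding bil_def by (metis dot_lmul_matrix inner_commute transpose_matrix_vector)

lemma bil_congruence:
  "bil (transpose P ** Q ** P) v w = bil Q (P *v v) (P *v w)"
  unfolding bil_def
  by (metis dot_lmul_matrix matrix_vector_mul_assoc transpose_matrix_vector inner_commute)

text \<open>Reversed Cauchy-Schwarz inequality, read off in a basis where \<open>Q\<close> is
  diagonal: orthogonality would equate the product of the time components with the inner product of
  the space parts, which is strictly smaller in absolute value unless \<open>b $ i0 = 0\<close>, and
  then \<open>w = 0\<close>. It turns weak inequalities obtained in limits back into strict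
  ones.\<close>

lemma lorentzian_timelike_causal_not_orthogonal:
  fixes Q :: "real ^ 'n ^ 'n"
  assumes Q: "lorentzian_matrix Q" and n: "bil Q n n < 0" and w: "bil Q w w \<le> 0" "w \<noteq> 0"
  shows "bil Q n w \<noteq> 0"
proof
  assume orth: "bil Q n w = 0"
  obtain P :: "real ^ 'n ^ 'n" and i0 where P: "invertible P"
    "transpose P ** Q ** P = (\<chi> i j. if i = j then (if i = i0 then -1 else 1) else (0::real))"
    using Q unfolding lorentzian_matrix_def by blast
  obtain P' where P': "P ** P' = mat 1" using P(1) unfolding invertible_def by blast
  define a b where "a = P' *v n" and "b = P' *v w"
  have nw: "n = P *v a" "w = P *v b"
    by (simp_all add: a_def b_def matrix_vector_mul_assoc P')
  have D: "bil Q (P *v x) (P *v y) = (\<Sum>i\<in>UNIV - {i0}. x $ i * y $ i) - x $ i0 * y $ i0" for x y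
  proof -
    have "bil Q (P *v x) (P *v y) = (\<Sum>i\<in>UNIV. \<Sum>j\<in>UNIV. x $ i * ((if i = j then (if i = i0 then -1 else 1) else 0) * y $ j))"
      using bil_congruence[of P Q x y] unfolding P(2) by (simp add: bil_sum[of "vec_lambda _"])
    also have "\<dots> = (\<Sum>i\<in>UNIV. x $ i * ((if i = i0 then -1 else 1) * y $ i))"
      by (intro sum.cong refl) (simp add: if_distrib[of "\<lambda>z. z * _"] if_distrib[of "\<lambda>z. _ * z"] sum.delta cong: if_cong)
    also have "\<dots> = x $ i0 * (- 1 * y $ i0) + (\<Sum>i\<in>UNIV - {i0}. x $ i * ((if i = i0 then -1 else 1) * y $ i))"
      by (subst sum.remove[of _ i0]) auto
    also have "(\<Sum>i\<in>UNIV - {i0}. x $ i * ((if i = i0 then -1 else 1) * y $ i)) = (\<Sum>i\<in>UNIV - {i0}. x $ i * y $ i)"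
      by (intro sum.cong) auto
    finally show ?thesis by simp
  qed
  define na nb where "na = (\<Sum>i\<in>UNIV - {i0}. (a $ i)\<^sup>2)" and "nb = (\<Sum>i\<in>UNIV - {i0}. (b $ i)\<^sup>2)"
  have na: "na < (a $ i0)\<^sup>2" and nb: "nb \<le> (b $ i0)\<^sup>2"
    using n w(1) unfolding nw D na_def nb_def by (simp_all add: power2_eq_square)
  have na0: "0 \<le> na" and nb0: "0 \<le> nb" unfolding na_def nb_def by (simp_all add: sum_nonneg)
  have b0: "b $ i0 \<noteq> 0"
  proof
    assume z: "b $ i0 = 0"
    then have "nb = 0" using nb nb0 by simp
    then have "\<forall>i\<in>UNIV - {i0}. (b $ i)\<^sup>2 = 0"
      unfolding nb_def by (subst (asm) sum_nonneg_eq_0_iff) auto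
    then have "b = 0" using z by (auto simp: vec_eq_iff)
    then show False using w(2) nw by simp
  qed
  have "(a $ i0 * b $ i0)\<^sup>2 = (\<Sum>i\<in>UNIV - {i0}. a $ i * b $ i)\<^sup>2"
    using orth unfolding nw D by simp
  also have "\<dots> \<le> na * nb" unfolding na_def nb_def by (rule Cauchy_Schwarz_ineq_sum)
  also have "\<dots> \<le> na * (b $ i0)\<^sup>2" using nb na0 by (intro mult_left_mono)
  also have "\<dots> < (a $ i0)\<^sup>2 * (b $ i0)\<^sup>2" using na b0 by (intro mult_strict_right_mono) auto
  finally show False by (simp add: power_mult_distrib)
qed

text \<open>If \<open>v\<close> leans to the future, its \<open>Q\<close>-orthogonal complement still contains the timelike vector
  \<open>x - (bil Q x v / bil Q v v) v\<close>, which is joined to \<open>x\<close> by a segment of timelike vectors.\<close>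
lemma lorentzian_separate_spacelike:
  fixes Q :: "real ^ 'n ^ 'n"
  assumes Q: "lorentzian_matrix Q" and x: "bil Q x x < 0" and v: "bil Q v v > 0"
  obtains l where "l \<bullet> v \<le> 0" "\<And>w. future_causal_vec Q x w \<Longrightarrow> l \<bullet> w > 0"
proof -
  have sym: "bil Q p q = bil Q q p" for p q
    using Q bil_commute unfolding lorentzian_matrix_def by blast
  have inner: "- (N v* Q) \<bullet> w = - bil Q N w" for N w
    by (simp add: bil_def dot_lmul_matrix)
  show ?thesis
  proof (cases "bil Q x v \<ge> 0")
    case True
    then show ?thesis
      using that[of "- (x v* Q)"] by (simp add: inner future_causal_vec_def del: inner_minus_left)
  next
    case False
    define m a where "m = bil Q x v" and "a = bil Q v v"
    define s where "s = - m / a"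
    have ma: "m < 0" "a > 0" "s > 0" "m + s * a = 0"
      using False v by (auto simp: m_def a_def s_def divide_neg_pos)
    have tl: "bil Q (x + r *\<^sub>R v) (x + r *\<^sub>R v) < 0" if r: "0 \<le> r" "r \<le> s" for r
    proof -
      have "bil Q (x + r *\<^sub>R v) (x + r *\<^sub>R v) = bil Q x x + r * (2 * m + r * a)"
        using sym[of v x] by (simp add: m_def a_def algebra_simps)
      moreover have "r * a \<le> s * a" using r ma by simp
      then have "2 * m + r * a \<le> 0" using ma by linarith
      then have "r * (2 * m + r * a) \<le> 0" using r by (intro mult_nonneg_nonpos)
      ultimately show ?thesis using x by simp
    qed
    show ?thesis
    proof (rule that[of "- ((x + s *\<^sub>R v) v* Q)"])
      show "- ((x + s *\<^sub>R v) v* Q) \<bullet> v \<le> 0"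
        unfolding inner using ma by (simp add: m_def a_def)
      fix w assume w: "future_causal_vec Q x w"
      have "bil Q (x + s *\<^sub>R v) w < 0"
      proof (rule ccontr)
        assume "\<not> bil Q (x + s *\<^sub>R v) w < 0"
        then have ge: "bil Q x w + s * bil Q v w \<ge> 0" by simp
        have xw: "bil Q x w < 0" using w by (simp add: future_causal_vec_def)
        have vw: "bil Q v w > 0" using ge xw ma by (smt (verit) mult_nonneg_nonpos)
        \<comment> \<open>Were the sign changed at \<open>s\<close>, the timelike vector
          \<open>x + r *\<^sub>R v\<close> on the segment would be orthogonal to the causal vector
          \<open>w\<close>.\<close>
        define r where "r = - bil Q x w / bil Q v w"
        have "0 \<le> r" "r \<le> s" using ge xw vw by (auto simp: r_def field_simps)
        moreover have "bil Q (x + r *\<^sub>R v) w = 0" using vw by (simp add: r_def)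
        ultimately show False
          using lorentzian_timelike_causal_not_orthogonal[OF Q tl[of r], of w] w
          by (auto simp: future_causal_vec_def)
      qed
      then show "- ((x + s *\<^sub>R v) v* Q) \<bullet> w > 0" unfolding inner by simp
    qed
  qed
qed

text \<open>Compactness of the unit sphere: normalised counterexamples for shrinking
  \<open>k\<close> accumulate at a vector that is future causal for \<open>Q\<close> itself but
  where \<open>l\<close> is not positive. The gain \<open>k * norm v\<close> is what later lets time
  control distance.\<close>

lemma future_cone_functional_stable:
  fixes Q :: "real ^ 'n ^ 'n"
  assumes Q: "lorentzian_matrix Q" and x: "bil Q x x < 0"
    and l: "\<And>v. future_causal_vec Q x v \<Longrightarrow> l \<bullet> v > 0"
  shows "\<exists>k>0. \<forall>Q' x' v. norm (Q' - Q) < k \<longrightarrow> norm (x' - x) < k \<longrightarrow>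
    future_causal_vec Q' x' v \<longrightarrow> l \<bullet> v \<ge> k * norm v"
proof (rule ccontr)
  assume neg: "\<not> ?thesis"
  have "\<exists>Q' x' v. norm (Q' - Q) < inverse (real (Suc n)) \<and> norm (x' - x) < inverse (real (Suc n)) \<and>
    future_causal_vec Q' x' v \<and> l \<bullet> v < inverse (real (Suc n)) * norm v" for n
    using neg by (metis inverse_positive_iff_positive not_le of_nat_0_less_iff zero_less_Suc)
  then obtain Qs xs vs where s: "\<And>n. norm (Qs n - Q) < inverse (real (Suc n))"
    "\<And>n. norm (xs n - x) < inverse (real (Suc n))" "\<And>n. future_causal_vec (Qs n) (xs n) (vs n)"
    "\<And>n. l \<bullet> vs n < inverse (real (Suc n)) * norm (vs n)"
    by metis
  have lim: "Qs \<longlonglongrightarrow> Q" "xs \<longlonglongrightarrow> x"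
    using s(1,2) LIMSEQ_inverse_real_of_nat
    by (auto intro!: LIM_zero_cancel[where l=Q] LIM_zero_cancel[where l=x] Lim_null_comparison[OF _ LIMSEQ_inverse_real_of_nat] always_eventually less_imp_le)
  define u where "u n = vs n /\<^sub>R norm (vs n)" for n
  have v0: "vs n \<noteq> 0" for n using s(3) by (simp add: future_causal_vec_def)
  have "\<forall>n. u n \<in> sphere 0 1" using v0 by (simp add: u_def)
  then obtain u0 \<sigma> where u0: "u0 \<in> sphere 0 1" "strict_mono \<sigma>" "(u \<circ> \<sigma>) \<longlonglongrightarrow> u0"
    using compact_sphere[of "0 :: real ^ 'n" 1] unfolding compact_def by blast
  have lims: "(\<lambda>n. Qs (\<sigma> n)) \<longlonglongrightarrow> Q" "(\<lambda>n. xs (\<sigma> n)) \<longlonglongrightarrow> x" "(\<lambda>n. u (\<sigma> n)) \<longlonglongrightarrow> u0"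
    using LIMSEQ_subseq_LIMSEQ[OF lim(1) u0(2)] LIMSEQ_subseq_LIMSEQ[OF lim(2) u0(2)] u0(3)
    by (simp_all add: o_def)
  have un: "bil (Qs n) (u n) (u n) \<le> 0" "bil (Qs n) (xs n) (u n) \<le> 0" "l \<bullet> u n \<le> inverse (real (Suc n))" for n
    using s(3,4)[of n] v0[of n]
    by (auto simp: u_def future_causal_vec_def field_simps mult_le_0_iff)
  have "bil Q u0 u0 \<le> 0"
    by (rule LIMSEQ_le_const2[OF tendsto_bil[OF lims(1,3,3)]]) (use un in auto)
  moreover have "bil Q x u0 \<le> 0"
    by (rule LIMSEQ_le_const2[OF tendsto_bil[OF lims]]) (use un in auto)
  moreover have "u0 \<noteq> 0" using u0(1) by auto
  ultimately have "future_causal_vec Q x u0"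
    using lorentzian_timelike_causal_not_orthogonal[OF Q x, of u0] by (auto simp: future_causal_vec_def)
  then have "l \<bullet> u0 > 0" by (rule l)
  moreover have "l \<bullet> u0 \<le> 0"
  proof (rule LIMSEQ_le)
    show "(\<lambda>n. l \<bullet> u (\<sigma> n)) \<longlonglongrightarrow> l \<bullet> u0" by (intro tendsto_intros lims)
    show "(\<lambda>n. inverse (real (Suc (\<sigma> n)))) \<longlonglongrightarrow> 0"
      using LIMSEQ_subseq_LIMSEQ[OF LIMSEQ_inverse_real_of_nat u0(2)] by (simp add: o_def)
  qed (use un in auto)
  ultimately show False by simp
qed

text \<open>Being timelike is an open condition jointly in metric, orientation and vector; this is
  what makes straight chart segments causal.\<close>

lemma timelike_direction_stable:
  fixes Q :: "real ^ 'n ^ 'n"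
  assumes x: "bil Q x x < 0"
  shows "\<exists>k>0. \<forall>Q' x' v. norm (Q' - Q) < k \<longrightarrow> norm (x' - x) < k \<longrightarrow> norm (v - x) < k \<longrightarrow>
    future_causal_vec Q' x' v"
proof (rule ccontr)
  assume neg: "\<not> ?thesis"
  have "\<exists>Q' x' v. norm (Q' - Q) < inverse (real (Suc n)) \<and> norm (x' - x) < inverse (real (Suc n)) \<and>
    norm (v - x) < inverse (real (Suc n)) \<and> \<not> future_causal_vec Q' x' v" for n
    using neg by (metis inverse_positive_iff_positive of_nat_0_less_iff zero_less_Suc)
  then obtain Qs xs vs where s: "\<And>n. norm (Qs n - Q) < inverse (real (Suc n))"
    "\<And>n. norm (xs n - x) < inverse (real (Suc n))" "\<And>n. norm (vs n - x) < inverse (real (Suc n))"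
    "\<And>n. \<not> future_causal_vec (Qs n) (xs n) (vs n)"
    by metis
  have lim: "Qs \<longlonglongrightarrow> Q" "xs \<longlonglongrightarrow> x" "vs \<longlonglongrightarrow> x"
    using s(1,2,3) LIMSEQ_inverse_real_of_nat
    by (auto intro!: LIM_zero_cancel[where l=Q] LIM_zero_cancel[where l=x] Lim_null_comparison[OF _ LIMSEQ_inverse_real_of_nat] always_eventually less_imp_le)
  have "eventually (\<lambda>n. bil (Qs n) (vs n) (vs n) < 0) sequentially"
    using tendsto_bil[OF lim(1,3,3)] x by (rule order_tendstoD)
  moreover have "eventually (\<lambda>n. bil (Qs n) (xs n) (vs n) < 0) sequentially"
    using tendsto_bil[OF lim] x by (rule order_tendstoD)
  ultimately have "eventually (\<lambda>n. future_causal_vec (Qs n) (xs n) (vs n)) sequentially"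
    by eventually_elim (auto simp: future_causal_vec_def)
  then show False using s(4) by simp
qed

section \<open>Causal curves in charts\<close>

locale lorentzian_spacetime =
  fixes A :: "('m::{t2_space, second_countable_topology}, 'n::finite) chart set"
    and G :: "('m, 'n) chart \<Rightarrow> 'm \<Rightarrow> real ^ 'n ^ 'n"
    and X :: "('m, 'n) chart \<Rightarrow> 'm \<Rightarrow> real ^ 'n"
  assumes spacetime: "spacetime A G X"
begin

abbreviation fd :: "(real \<Rightarrow> 'm) \<Rightarrow> real set \<Rightarrow> bool" where
  "fd \<equiv> fd_causal_curve A G X"

definition cinv :: "('m, 'n) chart \<Rightarrow> real ^ 'n \<Rightarrow> 'm" where
  "cinv c = inv_into (fst c) (snd c)"

lemma atlas: "smooth_atlas A"
  using spacetime by (simp add: spacetime_def smooth_connected_manifold_def)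

lemma chart_open: "c \<in> A \<Longrightarrow> open (fst c)" "c \<in> A \<Longrightarrow> open (snd c ` fst c)"
  using atlas by (auto simp: smooth_atlas_def is_chart_def)

lemma chart_cover: obtains c where "c \<in> A" "p \<in> fst c"
  using atlas unfolding smooth_atlas_def by blast

lemma chart_homeomorphism:
  assumes "c \<in> A"
  shows "homeomorphism (fst c) (snd c ` fst c) (snd c) (cinv c)"
proof -
  obtain psi where psi: "homeomorphism (fst c) (snd c ` fst c) (snd c) psi"
    using atlas assms by (auto simp: smooth_atlas_def is_chart_def)
  have "inj_on (snd c) (fst c)"
    using psi by (metis homeomorphism_apply1 inj_on_inverseI)
  then have "cinv c y = psi y" if "y \<in> snd c ` fst c" for y
    using that psi unfolding cinv_def by (auto simp: homeomorphism_apply1)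
  then show ?thesis
    using psi by (intro homeomorphism_cong[OF psi]) auto
qed

lemma cinv_chart [simp]: "c \<in> A \<Longrightarrow> p \<in> fst c \<Longrightarrow> cinv c (snd c p) = p"
  using chart_homeomorphism homeomorphism_apply1 by blast

lemma chart_cinv [simp]: "c \<in> A \<Longrightarrow> y \<in> snd c ` fst c \<Longrightarrow> snd c (cinv c y) = y"
  using chart_homeomorphism homeomorphism_apply2 by blast

lemma cinv_in: "c \<in> A \<Longrightarrow> y \<in> snd c ` fst c \<Longrightarrow> cinv c y \<in> fst c"
  by auto

lemma continuous_on_chart: "c \<in> A \<Longrightarrow> continuous_on (fst c) (snd c)"
  and continuous_on_cinv: "c \<in> A \<Longrightarrow> continuous_on (snd c ` fst c) (cinv c)"
  using chart_homeomorphism homeomorphism_def by blast+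

lemma isCont_chart: "c \<in> A \<Longrightarrow> p \<in> fst c \<Longrightarrow> isCont (snd c) p"
  using continuous_on_chart chart_open by (simp add: continuous_on_eq_continuous_at)

lemma isCont_cinv: "c \<in> A \<Longrightarrow> y \<in> snd c ` fst c \<Longrightarrow> isCont (cinv c) y"
  using continuous_on_cinv chart_open(2) continuous_on_eq_continuous_at by blast

lemma open_chart_image:
  assumes "c \<in> A" "open W"
  shows "open (snd c ` (fst c \<inter> W))"
proof -
  have "openin (top_of_set (fst c)) (fst c \<inter> W)" using assms by (simp add: openin_open_Int)
  then have "openin (top_of_set (snd c ` fst c)) (snd c ` (fst c \<inter> W))"
    using homeomorphism_imp_open_map[OF chart_homeomorphism[OF assms(1)]] by blast
  then show ?thesis using chart_open(2)[OF assms(1)] by (meson openin_open_eq)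
qed

lemma open_chart_preimage:
  assumes "c \<in> A" "open W"
  shows "open {p \<in> fst c. snd c p \<in> W}"
  using continuous_open_preimage[OF continuous_on_chart[OF assms(1)] chart_open(1)[OF assms(1)] assms(2)]
  by (simp add: vimage_def Int_def)

lemma transition_chart:
  "c \<in> A \<Longrightarrow> p \<in> fst c \<Longrightarrow> transition c d (snd c p) = snd d p"
  using cinv_chart by (simp add: transition_def cinv_def)

lemma transition_has_jacobian:
  assumes "c \<in> A" "d \<in> A" "p \<in> fst c" "p \<in> fst d"
  shows "(transition c d has_derivative (\<lambda>v. jacobian (transition c d) (at (snd c p)) *v v)) (at (snd c p))"
proof (rule smooth_on_has_jacobian)
  show "smooth_on (snd c ` (fst c \<inter> fst d)) (transition c d)"
    using atlas assms by (auto simp: smooth_atlas_def)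
qed (use assms open_chart_image chart_open in auto)

lemma transition_locally_lipschitz:
  assumes "c \<in> A" "d \<in> A" "p \<in> fst c" "p \<in> fst d"
  obtains r L where "r > 0" "L-lipschitz_on (ball (snd c p) r) (transition c d)"
proof (rule smooth_on_locally_lipschitz)
  show "smooth_on (snd c ` (fst c \<inter> fst d)) (transition c d)"
    using atlas assms by (auto simp: smooth_atlas_def)
qed (use assms open_chart_image chart_open that in auto)

lemma metric_continuous: "c \<in> A \<Longrightarrow> continuous_on (fst c) (G c)"
  and metric_lorentzian: "c \<in> A \<Longrightarrow> p \<in> fst c \<Longrightarrow> lorentzian_matrix (G c p)"
  and orientation_continuous: "c \<in> A \<Longrightarrow> continuous_on (fst c) (X c)"
  and orientation_timelike: "c \<in> A \<Longrightarrow> p \<in> fst c \<Longrightarrow> bil (G c p) (X c p) (X c p) < 0"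
  using spacetime unfolding spacetime_def continuous_lorentzian_metric_def time_orientation_def by blast+

abbreviation fcv :: "('m, 'n) chart \<Rightarrow> 'm \<Rightarrow> real ^ 'n \<Rightarrow> bool" where
  "fcv c p \<equiv> future_causal_vec (G c p) (X c p)"

lemma future_causal_vec_transition:
  assumes "c \<in> A" "d \<in> A" "p \<in> fst c" "p \<in> fst d"
    and v: "fcv c p v"
  shows "fcv d p (jacobian (transition c d) (at (snd c p)) *v v)"
proof -
  let ?J = "jacobian (transition c d) (at (snd c p))"
  have Gc: "G c p = transpose ?J ** G d p ** ?J"
    using spacetime assms unfolding spacetime_def continuous_lorentzian_metric_def by blast
  have Xd: "X d p = ?J *v X c p"
    using spacetime assms unfolding spacetime_def time_orientation_def by blast
  have "bil (G d p) (?J *v w) (?J *v v) = bil (G c p) w v" for w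
    by (subst Gc) (simp add: bil_congruence)
  moreover have "bil (G d p) (?J *v v) (?J *v v) = bil (G c p) v v"
    by (subst Gc) (simp add: bil_congruence)
  ultimately show ?thesis
    using v unfolding future_causal_vec_def Xd by (auto simp: future_causal_vec_def)
qed

section \<open>Pointwise form of causal curves, independent of the chart\<close>

definition causal_at :: "(real \<Rightarrow> 'm) \<Rightarrow> real \<Rightarrow> bool" where
  "causal_at lam t \<longleftrightarrow> (\<exists>c\<in>A. lam t \<in> fst c \<and>
     (\<exists>v. ((snd c \<circ> lam) has_vector_derivative v) (at t) \<and>
          fcv c (lam t) v))"

text \<open>Taken relative to \<open>I\<close>, so that endpoints count; being local in the
  parameter, it can be restricted and glued.\<close>

definition lipschitz_at :: "(real \<Rightarrow> 'm) \<Rightarrow> real set \<Rightarrow> real \<Rightarrow> bool" where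
  "lipschitz_at lam I t \<longleftrightarrow> (\<exists>c\<in>A. \<exists>e>0. \<exists>L. lam ` (I \<inter> ball t e) \<subseteq> fst c \<and>
     L-lipschitz_on (I \<inter> ball t e) (snd c \<circ> lam))"

lemma lipschitz_at_imp_continuous:
  assumes "lipschitz_at lam I t" "t \<in> I"
  shows "continuous (at t within I) lam"
proof -
  obtain c e L where c: "c \<in> A" "e > 0" "lam ` (I \<inter> ball t e) \<subseteq> fst c"
    "L-lipschitz_on (I \<inter> ball t e) (snd c \<circ> lam)"
    using assms(1) unfolding lipschitz_at_def by blast
  have "continuous_on (I \<inter> ball t e) (cinv c \<circ> (snd c \<circ> lam))"
  proof (rule continuous_on_compose)
    show "continuous_on (I \<inter> ball t e) (snd c \<circ> lam)"
      using c(4) by (rule lipschitz_on_continuous_on)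
    show "continuous_on ((snd c \<circ> lam) ` (I \<inter> ball t e)) (cinv c)"
      using continuous_on_cinv[OF c(1)] by (rule continuous_on_subset) (use c(3) in auto)
  qed
  then have "continuous_on (I \<inter> ball t e) lam"
    by (rule continuous_on_eq) (use c cinv_chart[OF c(1)] in \<open>simp add: image_subset_iff\<close>)
  then have "continuous (at t within (I \<inter> ball t e)) lam"
    using assms(2) c(2) by (auto simp: continuous_on_eq_continuous_within)
  moreover have "at t within (I \<inter> ball t e) = at t within I"
    using c(2) by (intro at_within_nhd[of _ "ball t e"]) auto
  ultimately show ?thesis by simp
qed

text \<open>Continuity follows from the Lipschitz condition through the continuous inverse chart,
  and the frontier of an interval is null, so derivatives within \<open>I\<close> may be replaced by
  two-sided ones in the interior.\<close>

lemma fd_iff: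
  "fd lam I \<longleftrightarrow> param_interval I \<and> (\<forall>t\<in>I. lipschitz_at lam I t) \<and>
     negligible {t \<in> interior I. \<not> causal_at lam t}"
proof -
  let ?P = "\<lambda>t. \<exists>c\<in>A. lam t \<in> fst c \<and>
           (\<exists>v. ((snd c \<circ> lam) has_vector_derivative v) (at t within I) \<and>
                fcv c (lam t) v)"
  have AE: "(AE t in lebesgue. t \<in> I \<longrightarrow> ?P t) \<longleftrightarrow> negligible {t \<in> I. \<not> ?P t}"
  proof
    assume "AE t in lebesgue. t \<in> I \<longrightarrow> ?P t"
    then obtain N where N: "N \<in> null_sets lebesgue" "{t \<in> space lebesgue. \<not> (t \<in> I \<longrightarrow> ?P t)} \<subseteq> N"
      unfolding eventually_ae_filter by blast
    have "negligible N" using N(1) by (simp add: negligible_iff_null_sets)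
    then show "negligible {t \<in> I. \<not> ?P t}" by (rule negligible_subset) (use N(2) in auto)
  next
    assume "negligible {t \<in> I. \<not> ?P t}"
    then have "AE t in lebesgue. t \<notin> {t \<in> I. \<not> ?P t}"
      by (intro AE_not_in) (simp add: negligible_iff_null_sets)
    then show "AE t in lebesgue. t \<in> I \<longrightarrow> ?P t" by eventually_elim blast
  qed
  have ll: "loc_lipschitz_curve A lam I \<longleftrightarrow> (\<forall>t\<in>I. lipschitz_at lam I t)"
    unfolding loc_lipschitz_curve_def lipschitz_at_def[symmetric] continuous_on_eq_continuous_within
    using lipschitz_at_imp_continuous by blast
  have PC: "?P t \<longleftrightarrow> causal_at lam t" if "t \<in> interior I" for t
    unfolding causal_at_def at_within_interior[OF that] ..
  have "negligible {t \<in> I. \<not> ?P t} \<longleftrightarrow> negligible {t \<in> interior I. \<not> causal_at lam t}" if "param_interval I"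
  proof
    assume "negligible {t \<in> I. \<not> ?P t}"
    then show "negligible {t \<in> interior I. \<not> causal_at lam t}"
      by (rule negligible_subset) (use PC interior_subset in blast)
  next
    assume n: "negligible {t \<in> interior I. \<not> causal_at lam t}"
    have "negligible (frontier I)"
      using that by (intro negligible_convex_frontier) (simp add: param_interval_def is_interval_convex)
    with n have "negligible ({t \<in> interior I. \<not> causal_at lam t} \<union> frontier I)" by (rule negligible_Un)
    then show "negligible {t \<in> I. \<not> ?P t}"
    proof (rule negligible_subset)
      show "{t \<in> I. \<not> ?P t} \<subseteq> {t \<in> interior I. \<not> causal_at lam t} \<union> frontier I"
        using PC closure_subset[of I] by (auto simp: frontier_def)
    qed
  qed
  then show ?thesis
    unfolding fd_causal_curve_def AE ll by blast
qed

lemma fd_interval: "fd lam I \<Longrightarrow> param_interval I"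
  by (simp add: fd_iff)

lemma fd_lipschitz_at: "fd lam I \<Longrightarrow> t \<in> I \<Longrightarrow> lipschitz_at lam I t"
  by (simp add: fd_iff)

lemma fd_negligible: "fd lam I \<Longrightarrow> negligible {t \<in> interior I. \<not> causal_at lam t}"
  by (simp add: fd_iff)

lemma fd_continuous: "fd lam I \<Longrightarrow> continuous_on I lam"
  by (simp add: fd_causal_curve_def loc_lipschitz_curve_def)

lemma fd_isCont: "fd lam I \<Longrightarrow> t \<in> interior I \<Longrightarrow> isCont lam t"
  using fd_continuous continuous_on_interior by blast

text \<open>Transition maps are locally Lipschitz, so the chart around the point may be chosen
  freely; gluing depends on this, since two curves must be compared in one chart.\<close>

lemma lipschitz_at_chart:
  assumes ll: "lipschitz_at lam I t" and t: "t \<in> I" and d: "d \<in> A" "lam t \<in> fst d"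
  obtains e L where "e > 0" "lam ` (I \<inter> ball t e) \<subseteq> fst d" "L-lipschitz_on (I \<inter> ball t e) (snd d \<circ> lam)"
proof -
  obtain c e L where c: "c \<in> A" "e > 0" "lam ` (I \<inter> ball t e) \<subseteq> fst c"
    "L-lipschitz_on (I \<inter> ball t e) (snd c \<circ> lam)"
    using ll unfolding lipschitz_at_def by blast
  have tc: "lam t \<in> fst c" using c t by auto
  obtain r M where r: "r > 0" "M-lipschitz_on (ball (snd c (lam t)) r) (transition c d)"
    using transition_locally_lipschitz[OF c(1) d(1) tc d(2)] by blast
  define W where "W = {p \<in> fst c. snd c p \<in> ball (snd c (lam t)) r} \<inter> fst d"
  have "open W" "lam t \<in> W"
    using open_chart_preimage[OF c(1) open_ball] chart_open(1)[OF d(1)] tc d(2) r(1) by (auto simp: W_def)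
  then have "eventually (\<lambda>s. lam s \<in> W) (at t within I)"
    using lipschitz_at_imp_continuous[OF ll t] by (auto simp: continuous_within tendsto_def)
  then obtain e2 where e2: "e2 > 0" "\<And>s. s \<in> I \<Longrightarrow> s \<noteq> t \<Longrightarrow> dist s t < e2 \<Longrightarrow> lam s \<in> W"
    unfolding eventually_at by blast
  have inW: "lam s \<in> W" if "s \<in> I \<inter> ball t (min e e2)" for s
    using that e2(2)[of s] \<open>lam t \<in> W\<close> by (cases "s = t") (auto simp: dist_commute)
  have "(M * L)-lipschitz_on (I \<inter> ball t (min e e2)) (transition c d \<circ> (snd c \<circ> lam))"
  proof (rule lipschitz_on_compose)
    show "L-lipschitz_on (I \<inter> ball t (min e e2)) (snd c \<circ> lam)"
      using c(4) by (rule lipschitz_on_subset) auto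
    show "M-lipschitz_on ((snd c \<circ> lam) ` (I \<inter> ball t (min e e2))) (transition c d)"
      using r(2) by (rule lipschitz_on_subset) (use inW in \<open>auto simp: W_def\<close>)
  qed
  then have "(M * L)-lipschitz_on (I \<inter> ball t (min e e2)) (snd d \<circ> lam)"
    by (rule lipschitz_on_transform) (use inW transition_chart[OF c(1)] in \<open>auto simp: W_def\<close>)
  moreover have "lam ` (I \<inter> ball t (min e e2)) \<subseteq> fst d" using inW by (auto simp: W_def)
  ultimately show ?thesis using that[of "min e e2"] c(2) e2(1) by auto
qed

text \<open>Chain rule: the Jacobian of the transition map carries the velocity along with the
  cone.\<close>

lemma causal_at_chart:
  assumes "causal_at lam t" "isCont lam t" and d: "d \<in> A" "lam t \<in> fst d"
  obtains v where "((snd d \<circ> lam) has_vector_derivative v) (at t)"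
    "fcv d (lam t) v"
proof -
  obtain c v where c: "c \<in> A" "lam t \<in> fst c" "((snd c \<circ> lam) has_vector_derivative v) (at t)"
    "fcv c (lam t) v"
    using assms(1) unfolding causal_at_def by blast
  let ?J = "jacobian (transition c d) (at (snd c (lam t)))"
  have "((transition c d \<circ> (snd c \<circ> lam)) has_vector_derivative ?J *v v) (at t)"
    using vector_derivative_diff_chain_within[of "snd c \<circ> lam" v t UNIV "transition c d" "\<lambda>v. ?J *v v"]
      c(3) has_derivative_at_withinI[OF transition_has_jacobian[OF c(1) d(1) c(2) d(2)]] by auto
  moreover have "eventually (\<lambda>s. (transition c d \<circ> (snd c \<circ> lam)) s = (snd d \<circ> lam) s) (nhds t)"
  proof -
    have "(lam \<longlongrightarrow> lam t) (nhds t)"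
      using assms(2) by (simp add: isCont_def tendsto_at_iff_tendsto_nhds)
    then have "eventually (\<lambda>s. lam s \<in> fst c) (nhds t)"
      using topological_tendstoD chart_open(1)[OF c(1)] c(2) by blast
    then show ?thesis by eventually_elim (simp add: transition_chart[OF c(1)])
  qed
  ultimately have "((snd d \<circ> lam) has_vector_derivative ?J *v v) (at t)"
    using has_vector_derivative_cong_ev[of UNIV "transition c d \<circ> (snd c \<circ> lam)" "snd d \<circ> lam" t]
      eventually_nhds_x_imp_x[of _ t] by (simp add: transition_chart[OF c(1,2)])
  then show ?thesis
    using that future_causal_vec_transition[OF c(1) d(1) c(2) d(2) c(4)] by blast
qed

lemma causal_at_cong:
  assumes "eventually (\<lambda>s. lam s = lam' s) (nhds t)" "causal_at lam t"
  shows "causal_at lam' t"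
proof -
  obtain c v where c: "c \<in> A" "lam t \<in> fst c" "((snd c \<circ> lam) has_vector_derivative v) (at t)"
    "fcv c (lam t) v"
    using assms(2) unfolding causal_at_def by blast
  have eq: "lam t = lam' t" using assms(1) by (rule eventually_nhds_x_imp_x)
  have "((snd c \<circ> lam') has_vector_derivative v) (at t)"
    using c(3) has_vector_derivative_cong_ev[of UNIV "snd c \<circ> lam" "snd c \<circ> lam'" t]
      eventually_mono[OF assms(1), of "\<lambda>s. (snd c \<circ> lam) s = (snd c \<circ> lam') s"] eq by simp
  then show ?thesis using c eq unfolding causal_at_def by auto
qed

section \<open>Restriction, gluing and reparametrisation\<close>

lemma lipschitz_at_subset:
  assumes "lipschitz_at lam I t" "e > 0" "J \<inter> ball t e \<subseteq> I"
  shows "lipschitz_at lam J t"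
proof -
  obtain c r L where c: "c \<in> A" "r > 0" "lam ` (I \<inter> ball t r) \<subseteq> fst c"
    "L-lipschitz_on (I \<inter> ball t r) (snd c \<circ> lam)"
    using assms(1) unfolding lipschitz_at_def by blast
  have sub: "J \<inter> ball t (min e r) \<subseteq> I \<inter> ball t r" using assms(3) by auto
  then show ?thesis unfolding lipschitz_at_def
    using c assms(2) lipschitz_on_subset[OF c(4) sub]
    by (intro bexI[of _ c] exI[of _ "min e r"] conjI exI[of _ L]) auto
qed

lemma fd_subset:
  assumes "fd lam I" "J \<subseteq> I" "param_interval J"
  shows "fd lam J"
  unfolding fd_iff
proof (intro conjI ballI assms(3))
  show "lipschitz_at lam J t" if "t \<in> J" for t
    using assms(2) that by (intro lipschitz_at_subset[OF fd_lipschitz_at[OF assms(1)], of t 1]) auto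
  have "negligible {t \<in> interior I. \<not> causal_at lam t}" by (rule fd_negligible[OF assms(1)])
  then show "negligible {t \<in> interior J. \<not> causal_at lam t}"
    by (rule negligible_subset) (use interior_mono[OF assms(2)] in auto)
qed

lemma fd_cong:
  assumes "fd lam I" "\<And>t. t \<in> I \<Longrightarrow> lam t = lam' t"
  shows "fd lam' I"
  unfolding fd_iff
proof (intro conjI ballI)
  show "param_interval I" using assms(1) by (rule fd_interval)
  show "lipschitz_at lam' I t" if tI: "t \<in> I" for t
  proof -
    obtain c r L where c: "c \<in> A" "r > 0" "lam ` (I \<inter> ball t r) \<subseteq> fst c"
      "L-lipschitz_on (I \<inter> ball t r) (snd c \<circ> lam)"
      using fd_lipschitz_at[OF assms(1) tI] unfolding lipschitz_at_def by blast
    have "L-lipschitz_on (I \<inter> ball t r) (snd c \<circ> lam')"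
      using c(4) by (rule lipschitz_on_transform) (use assms(2) in auto)
    moreover have "lam' ` (I \<inter> ball t r) \<subseteq> fst c" using c(3) assms(2) by force
    ultimately show ?thesis using c unfolding lipschitz_at_def by blast
  qed
  have "causal_at lam' t" if "t \<in> interior I" "causal_at lam t" for t
  proof (rule causal_at_cong[OF _ that(2)])
    have "eventually (\<lambda>s. s \<in> interior I) (nhds t)" using that(1) by (intro eventually_nhds_in_open) auto
    then show "eventually (\<lambda>s. lam s = lam' s) (nhds t)"
      by eventually_elim (use assms(2) interior_subset in blast)
  qed
  moreover have "negligible {t \<in> interior I. \<not> causal_at lam t}" by (rule fd_negligible[OF assms(1)])
  ultimately show "negligible {t \<in> interior I. \<not> causal_at lam' t}"
    by (elim negligible_subset) auto
qed

text \<open>Only the joint needs care: in one chart around \<open>lam b\<close> both one-sided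
  Lipschitz bounds hold, and parameter distances across \<open>b\<close> add up. For the derivative
  condition the joint is a null set.\<close>

lemma fd_glue:
  assumes 1: "fd lam I" "b \<in> I" "I \<subseteq> {..b}" and 2: "fd lam J" "b \<in> J" "J \<subseteq> {b..}"
  shows "fd lam (I \<union> J)"
  unfolding fd_iff
proof (intro conjI ballI)
  have pI: "is_interval I" "is_interval J" "\<exists>a\<in>I. \<exists>b\<in>I. a < b"
    using fd_interval 1(1) 2(1) by (auto simp: param_interval_def)
  have "connected (I \<union> J)" using pI 1(2) 2(2) by (intro connected_Un) (auto simp: is_interval_connected_1)
  then show "param_interval (I \<union> J)"
    using pI(3) unfolding param_interval_def by (auto simp: is_interval_connected_1)
  show "lipschitz_at lam (I \<union> J) t" if t: "t \<in> I \<union> J" for t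
  proof -
    consider "t < b" | "t > b" | "t = b" by linarith
    then show ?thesis
    proof cases
      case 1
      then have "t \<in> I" "(I \<union> J) \<inter> ball t (b - t) \<subseteq> I"
        using t assms(6) by (force simp: dist_real_def)+
      with 1 show ?thesis
        by (intro lipschitz_at_subset[OF fd_lipschitz_at[OF assms(1)], of t "b - t"]) auto
    next
      case 2
      then have "t \<in> J" "(I \<union> J) \<inter> ball t (t - b) \<subseteq> J"
        using t assms(3) by (force simp: dist_real_def)+
      with 2 show ?thesis
        by (intro lipschitz_at_subset[OF fd_lipschitz_at[OF assms(4)], of t "t - b"]) auto
    next
      case 3
      obtain d where d: "d \<in> A" "lam b \<in> fst d" using chart_cover by blast
      obtain e L where I: "e > 0" "lam ` (I \<inter> ball b e) \<subseteq> fst d" "L-lipschitz_on (I \<inter> ball b e) (snd d \<circ> lam)"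
        by (rule lipschitz_at_chart[OF fd_lipschitz_at[OF assms(1,2)] assms(2) d])
      obtain e' L' where J: "e' > 0" "lam ` (J \<inter> ball b e') \<subseteq> fst d" "L'-lipschitz_on (J \<inter> ball b e') (snd d \<circ> lam)"
        by (rule lipschitz_at_chart[OF fd_lipschitz_at[OF assms(4,5)] assms(5) d])
      define r M where "r = min e e'" and "M = max L L'"
      have I': "M-lipschitz_on (I \<inter> ball b r) (snd d \<circ> lam)"
        by (rule lipschitz_on_le[OF lipschitz_on_subset[OF I(3)]]) (auto simp: r_def M_def)
      have J': "M-lipschitz_on (J \<inter> ball b r) (snd d \<circ> lam)"
        by (rule lipschitz_on_le[OF lipschitz_on_subset[OF J(3)]]) (auto simp: r_def M_def)
      let ?f = "snd d \<circ> lam"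
      have r: "r > 0" using I J by (simp add: r_def)
      have cross: "dist (?f x) (?f y) \<le> M * dist x y" if "x \<in> I \<inter> ball b r" "y \<in> J \<inter> ball b r" for x y
      proof -
        have "dist (?f x) (?f b) \<le> M * dist x b" "dist (?f b) (?f y) \<le> M * dist b y"
          using lipschitz_onD[OF I', of x b] lipschitz_onD[OF J', of b y] that assms r by auto
        moreover have "x \<le> b" "b \<le> y" using that assms(3,6) by auto
        then have "dist x y = dist x b + dist b y" by (simp add: dist_real_def)
        ultimately show ?thesis using dist_triangle[of "?f x" "?f y" "?f b"] by (simp add: distrib_left)
      qed
      have "M-lipschitz_on ((I \<union> J) \<inter> ball b r) ?f"
      proof (rule lipschitz_onI)
        fix x y assume "x \<in> (I \<union> J) \<inter> ball b r" "y \<in> (I \<union> J) \<inter> ball b r"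
        then show "dist (?f x) (?f y) \<le> M * dist x y"
          using cross[of x y] cross[of y x] lipschitz_onD[OF I', of x y] lipschitz_onD[OF J', of x y]
          by (auto simp: dist_commute)
      qed (use lipschitz_on_nonneg[OF I'] in auto)
      moreover have "lam ` ((I \<union> J) \<inter> ball b r) \<subseteq> fst d" using I(2) J(2) by (auto simp: r_def)
      ultimately show ?thesis unfolding lipschitz_at_def 3 using d r by blast
    qed
  qed
  have "negligible ({t \<in> interior I. \<not> causal_at lam t} \<union> {t \<in> interior J. \<not> causal_at lam t} \<union> {b})"
    using fd_negligible[OF assms(1)] fd_negligible[OF assms(4)] by (intro negligible_Un) auto
  then show "negligible {t \<in> interior (I \<union> J). \<not> causal_at lam t}"
  proof (rule negligible_subset, intro subsetI)
    fix t assume t: "t \<in> {t \<in> interior (I \<union> J). \<not> causal_at lam t}"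
    then obtain e where e: "e > 0" "ball t e \<subseteq> I \<union> J" using mem_interior by blast
    have "t \<in> interior I" if "t < b"
    proof -
      have "ball t (min e (b - t)) \<subseteq> I" using e(2) 2(3) by (auto simp: dist_real_def subset_iff)
      then show ?thesis using e(1) that unfolding mem_interior by (intro exI[of _ "min e (b - t)"]) auto
    qed
    moreover have "t \<in> interior J" if "b < t"
    proof -
      have "ball t (min e (t - b)) \<subseteq> J" using e(2) 1(3) by (auto simp: dist_real_def subset_iff)
      then show ?thesis using e(1) that unfolding mem_interior by (intro exI[of _ "min e (t - b)"]) auto
    qed
    ultimately show "t \<in> {t \<in> interior I. \<not> causal_at lam t} \<union> {t \<in> interior J. \<not> causal_at lam t} \<union> {b}"
      using t by (cases t b rule: linorder_cases) auto
  qed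
qed

lemma fd_join:
  assumes "fd lam I" "b \<in> I" "I \<subseteq> {..b}" "fd mu J" "b \<in> J" "J \<subseteq> {b..}" "lam b = mu b"
  shows "fd (\<lambda>t. if t \<le> b then lam t else mu t) (I \<union> J)"
proof (rule fd_glue)
  show "fd (\<lambda>t. if t \<le> b then lam t else mu t) I"
    using assms(1) by (rule fd_cong) (use assms(3) in auto)
  show "fd (\<lambda>t. if t \<le> b then lam t else mu t) J"
    using assms(4) by (rule fd_cong) (use assms(6,7) in \<open>auto simp: le_less\<close>)
qed (use assms in auto)

text \<open>One proof for both signs of \<open>k\<close>: a decreasing substitution reverses
  velocities, which is compensated by reversing the orientation field. So it serves
  reparametrisation as well as time reversal.\<close>

lemma fd_affine_oriented:
  assumes fd: "fd lam I" and k: "k \<noteq> 0" and X': "lorentzian_spacetime A G X'"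
    and or: "\<And>c p. X' c p = sgn k *\<^sub>R X c p"
  shows "fd_causal_curve A G X' (\<lambda>t. lam (k * t + m)) {t. k * t + m \<in> I}"
proof -
  interpret D: lorentzian_spacetime A G X' by (rule X')
  let ?I = "{t. k * t + m \<in> I}" and ?lam = "\<lambda>t. lam (k * t + m)"
  have I_eq: "?I = (\<lambda>s. (s - m) / k) ` I"
  proof
    show "?I \<subseteq> (\<lambda>s. (s - m) / k) ` I"
      using k by (auto intro!: image_eqI[of _ _ "k * _ + m"])
    show "(\<lambda>s. (s - m) / k) ` I \<subseteq> ?I" using k by auto
  qed
  have pI: "is_interval I" "\<exists>a\<in>I. \<exists>b\<in>I. a < b"
    using fd_interval[OF fd] by (auto simp: param_interval_def)
  show ?thesis unfolding D.fd_iff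
  proof (intro conjI ballI)
    have "connected ?I" unfolding I_eq
      using pI(1) by (intro connected_continuous_image continuous_intros) (auto simp: is_interval_connected_1 k)
    moreover obtain a b where ab: "a \<in> I" "b \<in> I" "a < b" using pI(2) by blast
    then have "(a - m) / k \<noteq> (b - m) / k" using k by simp
    moreover have "(a - m) / k \<in> ?I" "(b - m) / k \<in> ?I" using ab k by auto
    ultimately show "param_interval ?I"
      unfolding param_interval_def is_interval_connected_1 by (metis linorder_neqE_linordered_idom)
    fix t assume t: "t \<in> ?I"
    then have "k * t + m \<in> I" by simp
    then obtain c e L where c: "c \<in> A" "e > 0" "lam ` (I \<inter> ball (k * t + m) e) \<subseteq> fst c"
      "L-lipschitz_on (I \<inter> ball (k * t + m) e) (snd c \<circ> lam)"
      using fd_lipschitz_at[OF fd] unfolding lipschitz_at_def by blast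
    have sub: "k * s + m \<in> I \<inter> ball (k * t + m) e" if "s \<in> ?I \<inter> ball t (e / \<bar>k\<bar>)" for s
    proof -
      have "\<bar>k * t + m - (k * s + m)\<bar> = \<bar>k\<bar> * \<bar>t - s\<bar>"
        by (simp add: abs_mult[symmetric] algebra_simps)
      then show ?thesis using that k by (simp add: dist_real_def field_simps)
    qed
    have "(L * \<bar>k\<bar>)-lipschitz_on (?I \<inter> ball t (e / \<bar>k\<bar>)) ((snd c \<circ> lam) \<circ> (\<lambda>s. k * s + m))"
    proof (rule lipschitz_on_compose)
      show "\<bar>k\<bar>-lipschitz_on (?I \<inter> ball t (e / \<bar>k\<bar>)) (\<lambda>s. k * s + m)"
        by (rule lipschitz_onI) (auto simp: dist_real_def abs_mult[symmetric] algebra_simps)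
      show "L-lipschitz_on ((\<lambda>s. k * s + m) ` (?I \<inter> ball t (e / \<bar>k\<bar>))) (snd c \<circ> lam)"
        using c(4) by (rule lipschitz_on_subset) (use sub in blast)
    qed
    moreover have "?lam ` (?I \<inter> ball t (e / \<bar>k\<bar>)) \<subseteq> fst c" using sub c(3) by blast
    moreover have "e / \<bar>k\<bar> > 0" using c(2) k by simp
    ultimately show "D.lipschitz_at ?lam ?I t"
      unfolding D.lipschitz_at_def using c(1) by (auto simp: o_def)
  next
    let ?N = "{s \<in> interior I. \<not> causal_at lam s}"
    have "negligible ((\<lambda>s. (s - m) / k) ` ?N)"
    proof (rule negligible_locally_Lipschitz_image)
      show "negligible ?N" using fd by (rule fd_negligible)
      show "\<exists>T B. open T \<and> x \<in> T \<and> (\<forall>y\<in>?N \<inter> T. norm ((y - m) / k - (x - m) / k) \<le> B * norm (y - x))" for x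
        by (intro exI[of _ UNIV] exI[of _ "1 / \<bar>k\<bar>"]) (simp add: diff_divide_distrib[symmetric])
    qed simp
    then show "negligible {t \<in> interior ?I. \<not> D.causal_at ?lam t}"
    proof (rule negligible_subset, intro subsetI)
      fix t assume t: "t \<in> {t \<in> interior ?I. \<not> D.causal_at ?lam t}"
      let ?s = "k * t + m"
      have "open ((\<lambda>x. m + k *\<^sub>R x) ` interior ?I)" using k by (intro open_affinity) auto
      moreover have "(\<lambda>x. m + k *\<^sub>R x) ` interior ?I \<subseteq> I"
        using interior_subset[of ?I] by (auto simp: add.commute)
      ultimately have "(\<lambda>x. m + k *\<^sub>R x) ` interior ?I \<subseteq> interior I" by (rule interior_maximal[rotated])
      then have si: "?s \<in> interior I" using t by (auto simp: add.commute)
      have "D.causal_at ?lam t" if g: "causal_at lam ?s"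
      proof -
        obtain c v where c: "c \<in> A" "lam ?s \<in> fst c" "((snd c \<circ> lam) has_vector_derivative v) (at ?s)"
          "fcv c (lam ?s) v"
          using g unfolding causal_at_def by blast
        have "((\<lambda>t. k * t + m) has_vector_derivative k) (at t)"
          by (auto intro!: derivative_eq_intros simp: has_real_derivative_iff_has_vector_derivative[symmetric])
        from vector_diff_chain_at[OF this c(3)]
        have "((snd c \<circ> ?lam) has_vector_derivative k *\<^sub>R v) (at t)" by (simp add: o_def)
        moreover have "future_causal_vec (G c (lam ?s)) (X' c (lam ?s)) (k *\<^sub>R v)"
        proof -
          let ?Q = "G c (lam ?s)" and ?x = "X c (lam ?s)"
          have "k * k > 0" using k not_real_square_gt_zero by blast
          then have "(k * k) * bil ?Q v v \<le> 0"
            using c(4) by (simp add: future_causal_vec_def mult_le_0_iff)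
          moreover have "sgn k * k > 0" using k by (simp add: sgn_if)
          then have "(sgn k * k) * bil ?Q ?x v < 0"
            using c(4) unfolding future_causal_vec_def by (intro mult_pos_neg) auto
          ultimately show ?thesis
            using c(4) k unfolding future_causal_vec_def or by (simp add: mult_ac)
        qed
        ultimately show ?thesis unfolding D.causal_at_def using c by auto
      qed
      then have "?s \<in> ?N" using t si by auto
      then show "t \<in> (\<lambda>s. (s - m) / k) ` ?N" using k by (intro image_eqI[of _ _ ?s]) auto
    qed
  qed
qed

lemma fd_affine:
  assumes "fd lam I" "k > 0"
  shows "fd (\<lambda>t. lam (k * t + m)) {t. k * t + m \<in> I}"
  using assms by (intro fd_affine_oriented lorentzian_spacetime_axioms) auto

text \<open>The source of all time-dual statements: the locale can be interpreted again with the
  reversed orientation.\<close>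

lemma dual: "lorentzian_spacetime A G (\<lambda>c p. - X c p)"
proof
  have mv: "J *v (- v) = - (J *v v)" for J :: "real ^ 'n ^ 'n" and v
    using matrix_vector_mult_scaleR[of J "-1" v] by simp
  have "time_orientation A G (\<lambda>c p. - X c p)"
    unfolding time_orientation_def
  proof (intro conjI ballI)
    fix c d p assume cd: "c \<in> A" "d \<in> A" "p \<in> fst c \<inter> fst d"
    have "X d p = jacobian (transition c d) (at (snd c p)) *v X c p"
      using spacetime cd unfolding spacetime_def time_orientation_def by blast
    then show "- X d p = jacobian (transition c d) (at (snd c p)) *v - X c p"
      by (simp only: mv)
  qed (simp_all add: orientation_timelike orientation_continuous continuous_on_minus)
  then show "spacetime A G (\<lambda>c p. - X c p)"
    using spacetime unfolding spacetime_def by blast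
qed

lemma fd_reverse:
  assumes "fd lam I"
  shows "fd_causal_curve A G (\<lambda>c p. - X c p) (\<lambda>t. lam (- t)) {t. - t \<in> I}"
  using fd_affine_oriented[OF assms _ dual, of "-1" 0] by simp

lemma fd_Union_nat:
  assumes "\<And>n. fd lam {0..real (Suc n)}"
  shows "fd lam {0..}"
  unfolding fd_iff
proof (intro conjI ballI)
  show "param_interval {0::real..}"
    unfolding param_interval_def is_interval_1
    by (intro conjI bexI[where x = 0] bexI[where x = 1]) auto
  fix t :: real assume t: "t \<in> {0..}"
  obtain n where n: "t < real n" using reals_Archimedean2 by blast
  have "lipschitz_at lam {0..real (Suc n)} t" using t n by (intro fd_lipschitz_at assms) auto
  then show "lipschitz_at lam {0..} t"
    by (rule lipschitz_at_subset[of _ _ _ "real n - t"]) (use n in \<open>auto simp: dist_real_def\<close>)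
next
  have "negligible (\<Union>n. {t \<in> interior {0..real (Suc n)}. \<not> causal_at lam t})"
  proof (rule negligible_countable_Union)
    fix T assume "T \<in> range (\<lambda>n. {t \<in> interior {0..real (Suc n)}. \<not> causal_at lam t})"
    then show "negligible T" using fd_negligible[OF assms] by blast
  qed simp
  then show "negligible {t \<in> interior {0..}. \<not> causal_at lam t}"
  proof (rule negligible_subset, intro subsetI)
    fix t assume t: "t \<in> {t \<in> interior {0..}. \<not> causal_at lam t}"
    obtain n where "t < real n" using reals_Archimedean2 by blast
    with t show "t \<in> (\<Union>n. {t \<in> interior {0..real (Suc n)}. \<not> causal_at lam t})"
      by (auto intro!: exI[of _ n])
  qed
qed

section \<open>The causal relation between points\<close>

definition cc :: "'m \<Rightarrow> 'm \<Rightarrow> bool" where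
  "cc p q \<longleftrightarrow> (\<exists>lam. fd lam {0..1} \<and> lam 0 = p \<and> lam 1 = q)"

lemma ccI:
  assumes "fd lam {a..b}" "a < b"
  shows "cc (lam a) (lam b)"
proof -
  have "{t. (b - a) * t + a \<in> {a..b}} = {0..1}"
  proof -
    have d: "0 < b - a" using assms(2) by simp
    have "a \<le> (b - a) * t + a \<longleftrightarrow> 0 \<le> t" for t
      using mult_le_cancel_left_pos[OF d, of 0 t] by simp
    moreover have "(b - a) * t + a \<le> b \<longleftrightarrow> t \<le> 1" for t
      using mult_le_cancel_left_pos[OF d, of t 1] by (simp add: le_diff_eq)
    ultimately show ?thesis by (auto simp: set_eq_iff)
  qed
  then have "fd (\<lambda>t. lam ((b - a) * t + a)) {0..1}"
    using fd_affine[OF assms(1), of "b - a" a] assms(2) by simp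
  then show ?thesis unfolding cc_def by (intro exI[of _ "\<lambda>t. lam ((b - a) * t + a)"]) auto
qed

lemma cc_iff: "cc p q \<longleftrightarrow> (\<exists>lam a b. a < b \<and> fd lam {a..b} \<and> lam a = p \<and> lam b = q)"
proof
  show "cc p q \<Longrightarrow> \<exists>lam a b. a < b \<and> fd lam {a..b} \<and> lam a = p \<and> lam b = q"
    unfolding cc_def using zero_less_one by blast
  show "\<exists>lam a b. a < b \<and> fd lam {a..b} \<and> lam a = p \<and> lam b = q \<Longrightarrow> cc p q"
    using ccI by blast
qed

lemma ccI_sub:
  assumes "fd lam I" "a \<in> I" "b \<in> I" "a < b"
  shows "cc (lam a) (lam b)"
proof (rule ccI[OF _ assms(4)])
  have "{a..b} \<subseteq> I"
    using fd_interval[OF assms(1)] assms(2,3) mem_is_interval_1_I[of I a b]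
    unfolding param_interval_def by (meson atLeastAtMost_iff subsetI)
  moreover have "param_interval {a..b}"
    unfolding param_interval_def using assms(4)
    by (intro conjI is_interval_cc bexI[where x = a] bexI[where x = b]) auto
  ultimately show "fd lam {a..b}" by (rule fd_subset[OF assms(1)])
qed

lemma fd_shift:
  assumes "fd lam {a..b}"
  shows "fd (\<lambda>t. lam (t - s)) {a + s..b + s}"
proof -
  have "{t. t - s \<in> {a..b}} = {a + s..b + s}" by auto
  then show ?thesis using fd_affine[OF assms, of 1 "- s"] by simp
qed

lemma cc_trans:
  assumes "cc p q" "cc q r"
  shows "cc p r"
proof -
  obtain lam mu where lam: "fd lam {0..1}" "lam 0 = p" "lam 1 = q" and mu: "fd mu {0..1}" "mu 0 = q" "mu 1 = r"
    using assms unfolding cc_def by blast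
  have mu': "fd (\<lambda>t. mu (t - 1)) {1..2}" using fd_shift[OF mu(1), of 1] by simp
  have "fd (\<lambda>t. if t \<le> 1 then lam t else mu (t - 1)) ({0..1} \<union> {1..2})"
    by (rule fd_join[OF lam(1) _ _ mu']) (use lam mu in auto)
  moreover have "{0..1} \<union> {1..2} = {0..2::real}" by auto
  ultimately have "fd (\<lambda>t. if t \<le> 1 then lam t else mu (t - 1)) {0..2}" by simp
  from ccI[OF this] show ?thesis using lam mu by simp
qed

text \<open>Constant curves are not causal, hence the separate case of equality.\<close>

definition J :: "'m \<Rightarrow> 'm \<Rightarrow> bool" where
  "J p q \<longleftrightarrow> p = q \<or> cc p q"

lemma J_refl [simp]: "J p p" by (simp add: J_def)

lemma J_trans: "J p q \<Longrightarrow> J q r \<Longrightarrow> J p r"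
  and J_cc: "J p q \<Longrightarrow> cc q r \<Longrightarrow> cc p r"
  and cc_J: "cc p q \<Longrightarrow> J q r \<Longrightarrow> cc p r"
  and cc_imp_J: "cc p q \<Longrightarrow> J p q"
  unfolding J_def using cc_trans by blast+

lemma J_future_eq: "J_future A G X p = {q. J p q}"
  and J_past_eq: "J_past A G X q = {p. J p q}"
  unfolding J_future_def J_past_def J_def cc_iff by auto

lemma concat_curves:
  assumes "\<And>i. cc (e i) (e (Suc i))"
  obtains lam where "fd lam {0..}" "\<And>i. lam (real i) = e i"
proof -
  have "\<forall>i. \<exists>lam. fd lam {0..1} \<and> lam 0 = e i \<and> lam 1 = e (Suc i)"
    using assms unfolding cc_def by blast
  from choice[OF this] obtain g where "\<forall>i. fd (g i) {0..1} \<and> g i 0 = e i \<and> g i 1 = e (Suc i)" ..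
  then have g: "\<And>i. fd (g i) {0..1}" "\<And>i. g i 0 = e i" "\<And>i. g i 1 = e (Suc i)" by blast+
  \<comment> \<open>At an integer the floor already selects the next piece; this is harmless because
    consecutive pieces share the node.\<close>
  define lam where "lam t = g (nat \<lfloor>t\<rfloor>) (t - of_int \<lfloor>t\<rfloor>)" for t
  have node: "lam (real i) = e i" for i by (simp add: lam_def g)
  have piece: "fd lam {real i..real i + 1}" for i
  proof (rule fd_cong)
    show "fd (\<lambda>t. g i (t - real i)) {real i..real i + 1}"
      using fd_shift[OF g(1)[of i], of "real i"] by (simp add: add.commute)
    fix t assume t: "t \<in> {real i..real i + 1}"
    show "g i (t - real i) = lam t"
    proof (cases "t = real i + 1")
      case True
      have "lam (real (Suc i)) = e (Suc i)" by (rule node)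
      then show ?thesis using True g(3)[of i] by (simp add: add.commute)
    next
      case False
      then have "\<lfloor>t\<rfloor> = int i" using t by (auto simp: floor_eq_iff)
      then show ?thesis by (simp add: lam_def)
    qed
  qed
  have "fd lam {0..real (Suc n)}" for n
  proof (induction n)
    case 0
    show ?case using piece[of 0] by simp
  next
    case (Suc n)
    have "fd lam ({0..real (Suc n)} \<union> {real (Suc n)..real (Suc n) + 1})"
      by (rule fd_glue[OF Suc, where b = "real (Suc n)"]) (use piece[of "Suc n"] in auto)
    moreover have "{0..real (Suc n)} \<union> {real (Suc n)..real (Suc n) + 1} = {0..real (Suc (Suc n))}" by auto
    ultimately show ?case by simp
  qed
  then have "fd lam {0..}" by (rule fd_Union_nat)
  then show ?thesis using that node by blast
qed

text \<open>Bridge from velocities to positions: along the curve the functional is locally Lipschitz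
  with nonnegative derivative almost everywhere. The estimates inside boxes arise from it by a
  suitable choice of \<open>l\<close>.\<close>

lemma fd_functional_mono:
  assumes fd: "fd lam I" and st: "s \<le> t" "{s..t} \<subseteq> I" and c: "c \<in> A" "lam ` {s..t} \<subseteq> fst c"
    and l: "\<And>u v. u \<in> {s<..<t} \<Longrightarrow> fcv c (lam u) v \<Longrightarrow> l \<bullet> v \<ge> 0"
  shows "l \<bullet> snd c (lam s) \<le> l \<bullet> snd c (lam t)"
proof (rule ae_nonneg_derivative_imp_le[OF st(1)])
  let ?f = "snd c \<circ> lam"
  have cl: "continuous_on {s..t} lam" using fd_continuous[OF fd] st(2) continuous_on_subset by blast
  have "continuous_on {s..t} ?f"
    using continuous_on_chart[OF c(1)] c(2) by (intro continuous_on_compose cl) (rule continuous_on_subset)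
  then show "continuous_on {s..t} (\<lambda>t. l \<bullet> snd c (lam t))"
    by (auto simp: o_def intro!: continuous_intros)
  show "negligible {u \<in> interior I. \<not> causal_at lam u}" using fd by (rule fd_negligible)
  fix u assume u: "u \<in> {s..t}"
  have uI: "u \<in> I" "lam u \<in> fst c" using u st(2) c(2) by auto
  obtain e L where e: "e > 0" "lam ` (I \<inter> ball u e) \<subseteq> fst c" "L-lipschitz_on (I \<inter> ball u e) ?f"
    by (rule lipschitz_at_chart[OF fd_lipschitz_at[OF fd uI(1)] uI(1) c(1) uI(2)])
  show "\<exists>T B. open T \<and> u \<in> T \<and> (\<forall>y\<in>{s..t} \<inter> T. \<bar>l \<bullet> snd c (lam y) - l \<bullet> snd c (lam u)\<bar> \<le> B * \<bar>y - u\<bar>)"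
  proof (intro exI[of _ "ball u e"] exI[of _ "norm l * L"] conjI ballI)
    fix y assume y: "y \<in> {s..t} \<inter> ball u e"
    have "\<bar>l \<bullet> (?f y - ?f u)\<bar> \<le> norm l * norm (?f y - ?f u)" by (rule Cauchy_Schwarz_ineq2)
    also have "norm (?f y - ?f u) \<le> L * \<bar>y - u\<bar>"
      using lipschitz_onD[OF e(3), of y u] y uI st(2) e(1) by (auto simp: dist_norm dist_real_def)
    finally show "\<bar>l \<bullet> snd c (lam y) - l \<bullet> snd c (lam u)\<bar> \<le> norm l * L * \<bar>y - u\<bar>"
      by (simp add: inner_diff_right mult.assoc mult_left_mono)
  qed (use e in auto)
next
  fix u assume u: "u \<in> {s<..<t} - {u \<in> interior I. \<not> causal_at lam u}"
  have "{s<..<t} \<subseteq> interior I" using st(2) by (intro interior_maximal) auto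
  then have ui: "u \<in> interior I" "causal_at lam u" using u by auto
  have "lam u \<in> fst c" using u c(2) by auto
  then obtain v where v: "((snd c \<circ> lam) has_vector_derivative v) (at u)"
    "fcv c (lam u) v"
    using causal_at_chart[OF ui(2) fd_isCont[OF fd ui(1)] c(1)] by blast
  have "((\<lambda>t. l \<bullet> (snd c \<circ> lam) t) has_vector_derivative l \<bullet> v) (at u)"
    by (rule bounded_linear.has_vector_derivative[OF bounded_linear_inner_right v(1)])
  then show "\<exists>D\<ge>0. ((\<lambda>t. l \<bullet> snd c (lam t)) has_real_derivative D) (at u)"
    using l[OF _ v(2)] u by (auto simp: has_real_derivative_iff_has_vector_derivative o_def)
qed

end

section \<open>Causal boxes\<close>

context lorentzian_spacetime
begin

definition closed_box :: "('m, 'n) chart \<Rightarrow> real ^ 'n \<Rightarrow> real \<Rightarrow> 'm set" where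
  "closed_box c z r = {p \<in> fst c. snd c p \<in> cball z r}"

definition open_box :: "('m, 'n) chart \<Rightarrow> real ^ 'n \<Rightarrow> real \<Rightarrow> 'm set" where
  "open_box c z r = {p \<in> fst c. snd c p \<in> ball z r}"

text \<open>Reflexive on the box, so that limits of curves that shrink to a point are still
  covered.\<close>

definition box_causal :: "('m, 'n) chart \<Rightarrow> real ^ 'n \<Rightarrow> real \<Rightarrow> 'm \<Rightarrow> 'm \<Rightarrow> bool" where
  "box_causal c z r x y \<longleftrightarrow> x \<in> closed_box c z r \<and> y \<in> closed_box c z r \<and>
     (x = y \<or> (\<exists>lam a b. a < b \<and> fd lam {a..b} \<and> lam a = x \<and> lam b = y \<and>
        lam ` {a..b} \<subseteq> closed_box c z r))"

lemma box_causal_imp_J: "box_causal c z r x y \<Longrightarrow> J x y"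
  unfolding box_causal_def J_def cc_iff by blast

text \<open>The functional \<open>w\<close> is a local time function, uniformly positive on all future cones in the box,
  and all directions close to \<open>x0\<close> are future causal throughout the box.\<close>
definition causal_box :: "('m, 'n) chart \<Rightarrow> real ^ 'n \<Rightarrow> real \<Rightarrow> real ^ 'n \<Rightarrow> real \<Rightarrow> real ^ 'n \<Rightarrow> bool" where
  "causal_box c z r w k x0 \<longleftrightarrow> c \<in> A \<and> r > 0 \<and> k > 0 \<and> cball z r \<subseteq> snd c ` fst c \<and>
     (\<forall>p\<in>closed_box c z r.
        (\<forall>v. fcv c p v \<longrightarrow> k * norm v \<le> w \<bullet> v) \<and>
        (\<forall>v. norm (v - x0) < k \<longrightarrow> fcv c p v))"

lemma metric_near:
  assumes c: "c \<in> A" "p \<in> fst c" and k: "k > 0"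
  obtains e where "e > 0" "\<And>q. q \<in> fst c \<Longrightarrow> dist (snd c q) (snd c p) < e \<Longrightarrow>
    norm (G c q - G c p) < k \<and> norm (X c q - X c p) < k"
proof -
  have "(G c \<longlongrightarrow> G c p) (nhds p)" "(X c \<longlongrightarrow> X c p) (nhds p)"
    using metric_continuous[OF c(1)] orientation_continuous[OF c(1)] chart_open(1)[OF c(1)] c(2)
    by (simp_all add: continuous_on_eq_continuous_at continuous_at tendsto_at_iff_tendsto_nhds)
  then have "eventually (\<lambda>q. dist (G c q) (G c p) < k) (nhds p)" "eventually (\<lambda>q. dist (X c q) (X c p) < k) (nhds p)"
    using k by (auto simp: tendsto_iff)
  then have "eventually (\<lambda>q. norm (G c q - G c p) < k \<and> norm (X c q - X c p) < k) (nhds p)"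
    by eventually_elim (simp add: dist_norm)
  then obtain S where S: "open S" "p \<in> S" "\<forall>q\<in>S. norm (G c q - G c p) < k \<and> norm (X c q - X c p) < k"
    unfolding eventually_nhds by blast
  have "open (snd c ` (fst c \<inter> S))" "snd c p \<in> snd c ` (fst c \<inter> S)"
    using open_chart_image[OF c(1) S(1)] S(2) c(2) by auto
  then obtain e where e: "e > 0" "ball (snd c p) e \<subseteq> snd c ` (fst c \<inter> S)"
    unfolding open_contains_ball by blast
  show ?thesis
  proof (rule that[OF e(1)])
    fix q assume q: "q \<in> fst c" "dist (snd c q) (snd c p) < e"
    then have "snd c q \<in> ball (snd c p) e" by (simp add: dist_commute)
    then have "snd c q \<in> snd c ` (fst c \<inter> S)" using e(2) by blast
    then obtain q' where "q' \<in> fst c" "q' \<in> S" "snd c q = snd c q'" by blast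
    then have "q = q'" using cinv_chart[OF c(1)] q(1) by metis
    then show "norm (G c q - G c p) < k \<and> norm (X c q - X c p) < k" using S(3) \<open>q' \<in> S\<close> by blast
  qed
qed

lemma functional_positive_near:
  assumes c: "c \<in> A" "p \<in> fst c" and l: "\<And>v. fcv c p v \<Longrightarrow> l \<bullet> v > 0"
  obtains k e where "k > 0" "e > 0"
    "\<And>q v. q \<in> fst c \<Longrightarrow> dist (snd c q) (snd c p) < e \<Longrightarrow> fcv c q v \<Longrightarrow>
       k * norm v \<le> l \<bullet> v"
proof -
  obtain k where k: "k > 0" "\<forall>Q' x' v. norm (Q' - G c p) < k \<longrightarrow> norm (x' - X c p) < k \<longrightarrow>
    future_causal_vec Q' x' v \<longrightarrow> l \<bullet> v \<ge> k * norm v"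
    using future_cone_functional_stable[OF metric_lorentzian[OF c] orientation_timelike[OF c] l] by blast
  obtain e where e: "e > 0" "\<And>q. q \<in> fst c \<Longrightarrow> dist (snd c q) (snd c p) < e \<Longrightarrow>
    norm (G c q - G c p) < k \<and> norm (X c q - X c p) < k"
    using metric_near[OF c k(1)] by blast
  show ?thesis using that[OF k(1) e(1)] k(2) e(2) by blast
qed

lemma causal_box_exists:
  assumes c: "c \<in> A" "p \<in> fst c"
  obtains r w k where "causal_box c (snd c p) r w k (X c p)"
proof -
  \<comment> \<open>Minus the metric dual of the orientation vector at \<open>p\<close>: by the
    definition of future vectors it is positive on the cone at \<open>p\<close>.\<close>
  define w where "w = - (X c p v* G c p)"
  have "w \<bullet> v > 0" if "fcv c p v" for v
    using that by (simp add: w_def future_causal_vec_def bil_def dot_lmul_matrix)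
  then obtain k1 e1 where 1: "k1 > 0" "e1 > 0"
    "\<And>q v. q \<in> fst c \<Longrightarrow> dist (snd c q) (snd c p) < e1 \<Longrightarrow> fcv c q v \<Longrightarrow>
       k1 * norm v \<le> w \<bullet> v"
    using functional_positive_near[OF c] by blast
  obtain k2 where k2: "k2 > 0" "\<forall>Q' x' v. norm (Q' - G c p) < k2 \<longrightarrow> norm (x' - X c p) < k2 \<longrightarrow>
     norm (v - X c p) < k2 \<longrightarrow> future_causal_vec Q' x' v"
    using timelike_direction_stable[OF orientation_timelike[OF c]] by blast
  obtain e2 where e2: "e2 > 0" "\<And>q. q \<in> fst c \<Longrightarrow> dist (snd c q) (snd c p) < e2 \<Longrightarrow>
    norm (G c q - G c p) < k2 \<and> norm (X c q - X c p) < k2"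
    using metric_near[OF c k2(1)] by blast
  obtain e3 where e3: "e3 > 0" "cball (snd c p) e3 \<subseteq> snd c ` fst c"
    using chart_open(2)[OF c(1)] c(2) unfolding open_contains_cball by blast
  \<comment> \<open>The halves keep the closed ball of radius \<open>r\<close> strictly inside the
    open neighbourhoods of radius \<open>e1\<close> and \<open>e2\<close>.\<close>
  define r where "r = min e3 (min (e1 / 2) (e2 / 2))"
  define k where "k = min k1 k2"
  have r: "r > 0" "r < e1" "r < e2" "r \<le> e3" using 1 e2 e3 by (auto simp: r_def)
  have "causal_box c (snd c p) r w k (X c p)"
    unfolding causal_box_def
  proof (intro conjI ballI allI impI)
    show "c \<in> A" "r > 0" by fact+
    show "k > 0" using 1 k2 by (simp add: k_def)
    show "cball (snd c p) r \<subseteq> snd c ` fst c" using e3(2) r(4) by (meson order_trans subset_cball)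
    fix q v assume "q \<in> closed_box c (snd c p) r"
    then have q: "q \<in> fst c" "dist (snd c q) (snd c p) < e1" "dist (snd c q) (snd c p) < e2"
      using r by (auto simp: closed_box_def dist_commute)
    show "k * norm v \<le> w \<bullet> v" if "fcv c q v"
    proof -
      have "k * norm v \<le> k1 * norm v" by (intro mult_right_mono) (auto simp: k_def)
      also have "\<dots> \<le> w \<bullet> v" using 1(3)[OF q(1,2) that] .
      finally show ?thesis .
    qed
    show "fcv c q v" if "norm (v - X c p) < k"
      using k2(2) e2(2)[OF q(1,3)] that by (simp add: k_def)
  qed
  then show ?thesis by (rule that)
qed

end

section \<open>Geometry inside one causal box\<close>

locale lorentzian_box = lorentzian_spacetime A G X
  for A :: "('m::{t2_space, second_countable_topology}, 'n::finite) chart set"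
    and G :: "('m, 'n) chart \<Rightarrow> 'm \<Rightarrow> real ^ 'n ^ 'n"
    and X :: "('m, 'n) chart \<Rightarrow> 'm \<Rightarrow> real ^ 'n" +
  fixes c :: "('m, 'n) chart" and z :: "real ^ 'n" and r :: real and w :: "real ^ 'n"
    and k :: real and x0 :: "real ^ 'n"
  assumes box: "causal_box c z r w k x0"
begin

lemma c: "c \<in> A" and r: "r > 0" and k: "k > 0" and cball_sub: "cball z r \<subseteq> snd c ` fst c"
  and w: "\<And>p v. p \<in> closed_box c z r \<Longrightarrow> fcv c p v \<Longrightarrow> k * norm v \<le> w \<bullet> v"
  and x0: "\<And>p v. p \<in> closed_box c z r \<Longrightarrow> norm (v - x0) < k \<Longrightarrow> fcv c p v"
  using box unfolding causal_box_def by blast+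

lemma cinv_closed_box: "y \<in> cball z r \<Longrightarrow> cinv c y \<in> closed_box c z r"
  and chart_cinv_cball: "y \<in> cball z r \<Longrightarrow> snd c (cinv c y) = y"
proof -
  assume y: "y \<in> cball z r"
  then have yi: "y \<in> snd c ` fst c" using cball_sub by blast
  then show "snd c (cinv c y) = y" by (rule chart_cinv[OF c])
  with y cinv_in[OF c yi] show "cinv c y \<in> closed_box c z r" by (simp add: closed_box_def)
qed

lemma closed_box_in_chart: "p \<in> closed_box c z s \<Longrightarrow> p \<in> fst c"
  by (simp add: closed_box_def)

lemma compact_closed_box:
  assumes "s \<le> r"
  shows "compact (closed_box c z s)"
proof -
  have sub: "cball z s \<subseteq> snd c ` fst c" using cball_sub assms by (meson order_trans subset_cball)
  have "closed_box c z s = cinv c ` cball z s"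
  proof
    show "closed_box c z s \<subseteq> cinv c ` cball z s"
    proof
      fix p assume "p \<in> closed_box c z s"
      then have "p = cinv c (snd c p)" "snd c p \<in> cball z s"
        using cinv_chart[OF c] by (simp_all add: closed_box_def)
      then show "p \<in> cinv c ` cball z s" by blast
    qed
    show "cinv c ` cball z s \<subseteq> closed_box c z s"
    proof
      fix p assume "p \<in> cinv c ` cball z s"
      then obtain y where y: "y \<in> cball z s" "p = cinv c y" by blast
      then have "y \<in> snd c ` fst c" using sub by blast
      then show "p \<in> closed_box c z s" using y chart_cinv[OF c] cinv_in[OF c] by (simp add: closed_box_def)
    qed
  qed
  moreover have "compact (cinv c ` cball z s)"
    using continuous_on_subset[OF continuous_on_cinv[OF c] sub] by (rule compact_continuous_image) simp
  ultimately show ?thesis by simp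
qed

lemma open_open_box: "open (open_box c z s)"
  unfolding open_box_def by (rule open_chart_preimage[OF c open_ball])

text \<open>Monotonicity is applied to \<open>w\<close> minus \<open>k\<close> times the unit vector
  of the displacement; this functional is still nonnegative on every cone in the box.\<close>

lemma time_increment:
  assumes fd: "fd lam I" and st: "s \<le> t" "{s..t} \<subseteq> I" and lb: "lam ` {s..t} \<subseteq> closed_box c z r"
  shows "k * norm (snd c (lam t) - snd c (lam s)) \<le> w \<bullet> (snd c (lam t) - snd c (lam s))"
proof -
  let ?d = "snd c (lam t) - snd c (lam s)"
  \<comment> \<open>For zero displacement this is the zero vector, by the convention for division by
    zero; hence \<open>norm n \<le> 1\<close> only.\<close>
  define n where "n = ?d /\<^sub>R norm ?d"
  define l where "l = w - k *\<^sub>R n"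
  have n: "norm n \<le> 1" by (cases "?d = 0") (simp_all add: n_def)
  have "l \<bullet> snd c (lam s) \<le> l \<bullet> snd c (lam t)"
  proof (rule fd_functional_mono[OF fd st c])
    show "lam ` {s..t} \<subseteq> fst c" using lb closed_box_in_chart by blast
    fix u v assume u: "u \<in> {s<..<t}" and v: "fcv c (lam u) v"
    have "lam u \<in> closed_box c z r" using lb u by auto
    then have "k * norm v \<le> w \<bullet> v" using w v by blast
    moreover have "k * (n \<bullet> v) \<le> k * norm v"
      using n k norm_cauchy_schwarz[of n v] mult_right_mono[OF n norm_ge_zero[of v]]
      by (intro mult_left_mono) auto
    ultimately show "l \<bullet> v \<ge> 0" by (simp add: l_def inner_diff_left)
  qed
  then have "0 \<le> l \<bullet> ?d" by (simp add: inner_diff_right)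
  moreover have "n \<bullet> ?d = norm ?d"
    by (cases "?d = 0") (simp_all add: n_def dot_square_norm power2_eq_square)
  ultimately show ?thesis by (simp add: l_def inner_diff_left)
qed

text \<open>Without growth of \<open>w\<close> the increment bound freezes the chart position on the
  whole interval; then velocities vanish, while causal velocities exist almost everywhere and are
  nonzero.\<close>

lemma time_strict:
  assumes fd: "fd lam I" and st: "s < t" "{s..t} \<subseteq> I" and lb: "lam ` {s..t} \<subseteq> closed_box c z r"
  shows "w \<bullet> snd c (lam s) < w \<bullet> snd c (lam t)"
proof (rule ccontr)
  assume neg: "\<not> ?thesis"
  have inc: "k * norm (snd c (lam v) - snd c (lam u)) \<le> w \<bullet> (snd c (lam v) - snd c (lam u))"
    if "s \<le> u" "u \<le> v" "v \<le> t" for u v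
  proof (rule time_increment[OF fd that(2)])
    have "{u..v} \<subseteq> {s..t}" using that by auto
    then show "{u..v} \<subseteq> I" "lam ` {u..v} \<subseteq> closed_box c z r" using st(2) lb by blast+
  qed
  have nn: "0 \<le> k * norm y" for y :: "real ^ 'n" using k by simp
  have const: "snd c (lam u) = snd c (lam s)" if "s \<le> u" "u \<le> t" for u
  proof -
    have "w \<bullet> snd c (lam u) \<le> w \<bullet> snd c (lam t)"
      using inc[of u t] that order_trans[OF nn] by (simp add: inner_diff_right) (smt (verit) nn)
    then have "k * norm (snd c (lam u) - snd c (lam s)) \<le> 0"
      using inc[of s u] that neg by (simp add: inner_diff_right)
    then show ?thesis using k by (simp add: mult_le_0_iff)
  qed
  have "\<not> negligible {s<..<t}"
    using st(1) by (simp add: negligible_iff_null_sets null_sets_def)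
  then have "\<not> {s<..<t} \<subseteq> {u \<in> interior I. \<not> causal_at lam u}"
    using fd_negligible[OF fd] negligible_subset by blast
  then obtain u where "u \<in> {s<..<t}" and un: "u \<notin> {u \<in> interior I. \<not> causal_at lam u}" by blast
  then have u: "s < u" "u < t" by auto
  have "{s<..<t} \<subseteq> interior I" using st(2) by (intro interior_maximal) auto
  then have ui: "u \<in> interior I" "causal_at lam u" using u un by auto
  have "lam u \<in> closed_box c z r" using u lb by auto
  then have uc: "lam u \<in> fst c" by (rule closed_box_in_chart)
  obtain v where v: "((snd c \<circ> lam) has_vector_derivative v) (at u)"
    "fcv c (lam u) v"
    using causal_at_chart[OF ui(2) fd_isCont[OF fd ui(1)] c uc] by blast
  have "((\<lambda>_. snd c (lam s)) has_vector_derivative v) (at u)"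
  proof (rule has_vector_derivative_transform_within_open[OF v(1) open_greaterThanLessThan])
    show "u \<in> {s<..<t}" using u by simp
    show "(snd c \<circ> lam) u' = snd c (lam s)" if "u' \<in> {s<..<t}" for u'
      using const[of u'] that by simp
  qed
  then have "v = 0"
    using vector_derivative_unique_at[of "\<lambda>_. snd c (lam s)" v u 0] by simp
  then show False using v(2) by (simp add: future_causal_vec_def)
qed

lemma fd_straight:
  assumes ab: "a < b" and in_box: "\<And>t. t \<in> {a..b} \<Longrightarrow> y + t *\<^sub>R v \<in> cball z r" and v: "norm (v - x0) < k"
  shows "fd (\<lambda>t. cinv c (y + t *\<^sub>R v)) {a..b}"
  unfolding fd_iff
proof (intro conjI ballI)
  let ?lam = "\<lambda>t. cinv c (y + t *\<^sub>R v)"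
  have eq: "snd c (?lam t) = y + t *\<^sub>R v" if "t \<in> {a..b}" for t
    using chart_cinv_cball[OF in_box[OF that]] .
  show "param_interval {a..b}" unfolding param_interval_def using ab
    by (intro conjI is_interval_cc bexI[where x = a] bexI[where x = b]) auto
  show "lipschitz_at ?lam {a..b} t" if "t \<in> {a..b}" for t
  proof -
    have "?lam ` ({a..b} \<inter> ball t 1) \<subseteq> fst c"
      using closed_box_in_chart[OF cinv_closed_box[OF in_box]] by blast
    moreover have "(norm v)-lipschitz_on ({a..b} \<inter> ball t 1) (snd c \<circ> ?lam)"
    proof (rule lipschitz_onI)
      fix s s' assume "s \<in> {a..b} \<inter> ball t 1" "s' \<in> {a..b} \<inter> ball t 1"
      then have "(snd c \<circ> ?lam) s = y + s *\<^sub>R v" "(snd c \<circ> ?lam) s' = y + s' *\<^sub>R v" using eq by simp_all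
      then show "dist ((snd c \<circ> ?lam) s) ((snd c \<circ> ?lam) s') \<le> norm v * dist s s'"
        by (simp add: dist_norm scaleR_diff_left[symmetric] mult.commute)
    qed simp
    ultimately show ?thesis unfolding lipschitz_at_def using c zero_less_one by blast
  qed
  have "causal_at ?lam t" if t: "t \<in> {a<..<b}" for t
  proof -
    have t': "t \<in> {a..b}" using t by auto
    have "((\<lambda>t. y + t *\<^sub>R v) has_vector_derivative v) (at t)"
      by (auto intro!: derivative_eq_intros)
    then have "((snd c \<circ> ?lam) has_vector_derivative v) (at t)"
      by (rule has_vector_derivative_transform_within_open[of _ _ _ "{a<..<b}"]) (use t eq in auto)
    moreover have "?lam t \<in> closed_box c z r" by (rule cinv_closed_box[OF in_box[OF t']])
    ultimately show ?thesis
      unfolding causal_at_def using c closed_box_in_chart x0[OF _ v] by blast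
  qed
  then have "{t \<in> interior {a..b}. \<not> causal_at ?lam t} = {}" by auto
  then show "negligible {t \<in> interior {a..b}. \<not> causal_at ?lam t}" by (simp only: negligible_empty)
qed

lemma segment_in_cball:
  assumes "y \<in> cball z r" "y + b *\<^sub>R v \<in> cball z r" "0 < b" "t \<in> {0..b}"
  shows "y + t *\<^sub>R v \<in> cball z r"
proof -
  have "(1 - t / b) *\<^sub>R y + (t / b) *\<^sub>R (y + b *\<^sub>R v) \<in> cball z r"
    using assms by (intro convexD[OF convex_cball]) auto
  moreover have "(1 - t / b) *\<^sub>R y + (t / b) *\<^sub>R (y + b *\<^sub>R v) = y + t *\<^sub>R v"
    using assms(3) by (simp add: algebra_simps)
  ultimately show ?thesis by simp
qed

lemma straight_box_causal:
  assumes "y \<in> cball z r" "y + b *\<^sub>R v \<in> cball z r" "0 < b" "norm (v - x0) < k"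
  shows "fd (\<lambda>t. cinv c (y + t *\<^sub>R v)) {0..b}"
    "(\<lambda>t. cinv c (y + t *\<^sub>R v)) ` {0..b} \<subseteq> closed_box c z r"
proof -
  have "y + t *\<^sub>R v \<in> cball z r" if "t \<in> {0..b}" for t
    using segment_in_cball[OF assms(1-3) that] .
  then show "fd (\<lambda>t. cinv c (y + t *\<^sub>R v)) {0..b}"
    "(\<lambda>t. cinv c (y + t *\<^sub>R v)) ` {0..b} \<subseteq> closed_box c z r"
    using assms(3,4) cinv_closed_box by (auto intro!: fd_straight simp del: mem_cball)
qed

lemma x0_nonzero: "x0 \<noteq> 0"
proof -
  have "cinv c z \<in> closed_box c z r" using r by (intro cinv_closed_box) simp
  then have "fcv c (cinv c z) x0" using x0[of _ x0] k by simp
  then show ?thesis by (simp add: future_causal_vec_def)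
qed

lemma upward_exit:
  assumes "x \<in> open_box c z r"
  obtains y where "y \<in> closed_box c z r - open_box c z r" "box_causal c z r x y"
proof -
  define y where "y = snd c x"
  have y: "y \<in> ball z r" "x = cinv c y" "x \<in> closed_box c z r"
    using assms cinv_chart[OF c] by (auto simp: open_box_def closed_box_def y_def)
  \<comment> \<open>At time \<open>T\<close> the displacement is \<open>2 * r\<close>, which takes
    any point of the ball of radius \<open>r\<close> to its boundary or beyond.\<close>
  define T where "T = 2 * r / norm x0"
  have T: "T > 0" using r x0_nonzero by (simp add: T_def)
  define h where "h t = norm (y + t *\<^sub>R x0 - z)" for t
  have "h 0 \<le> r" using y by (simp add: h_def dist_norm norm_minus_commute)
  moreover have "r \<le> h T"
  proof -
    have "2 * r = norm (T *\<^sub>R x0)" using r x0_nonzero by (simp add: T_def)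
    also have "\<dots> = norm ((y + T *\<^sub>R x0 - z) - (y - z))" by simp
    also have "\<dots> \<le> h T + norm (y - z)" unfolding h_def by (rule norm_triangle_ineq4)
    finally show ?thesis using y(1) by (simp add: dist_norm norm_minus_commute)
  qed
  moreover have "continuous_on {0..T} h" unfolding h_def by (intro continuous_intros)
  ultimately obtain t where t: "0 \<le> t" "t \<le> T" "h t = r" using IVT'[of h 0 r T] T by auto
  have "t \<noteq> 0" using t(3) y(1) by (auto simp: h_def dist_norm norm_minus_commute)
  then have t0: "0 < t" using t by simp
  have yt: "y + t *\<^sub>R x0 \<in> cball z r" "y + t *\<^sub>R x0 \<notin> ball z r"
    using t(3) by (auto simp: h_def dist_norm norm_minus_commute)
  have yc: "y \<in> cball z r" using y(1) by auto
  have kk: "norm (x0 - x0) < k" using k by simp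
  define q where "q = cinv c (y + t *\<^sub>R x0)"
  have q: "q \<in> closed_box c z r" "snd c q = y + t *\<^sub>R x0"
    unfolding q_def using cinv_closed_box[OF yt(1)] chart_cinv_cball[OF yt(1)] by auto
  show ?thesis
  proof (rule that)
    show "q \<in> closed_box c z r - open_box c z r" using q yt(2) by (auto simp: open_box_def)
    show "box_causal c z r x q"
      unfolding box_causal_def using y(3) q(1) t0 straight_box_causal[OF yc yt(1) t0 kk]
      by (intro conjI disjI2 exI[of _ "\<lambda>s. cinv c (y + s *\<^sub>R x0)"] exI[of _ 0] exI[of _ t]) (simp_all add: y(2) q_def)
  qed
qed

end

text \<open>Without a least element \<open>I\<close> contains all points just above its lower end,
  so the finite and the infinite case of \<open>lower_end\<close> get one description by parameters
  in \<open>I\<close>.\<close>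

lemma eventually_lower_end:
  assumes I: "param_interval I" and nomin: "\<And>t. t \<in> I \<Longrightarrow> \<exists>s\<in>I. s < t"
  shows "eventually P (lower_end I) \<longleftrightarrow> (\<exists>t0\<in>I. \<forall>t\<in>I. t < t0 \<longrightarrow> P t)"
proof -
  obtain t1 where t1: "t1 \<in> I" using I by (auto simp: param_interval_def)
  have ivl: "\<And>a b x. a \<in> I \<Longrightarrow> b \<in> I \<Longrightarrow> a \<le> x \<Longrightarrow> x \<le> b \<Longrightarrow> x \<in> I"
    using I mem_is_interval_1_I unfolding param_interval_def by blast
  show ?thesis
  proof (cases "bdd_below I")
    case True
    have lo: "Inf I < t" if "t \<in> I" for t
      using nomin[OF that] cInf_lower[OF _ True] by force
    have mem: "x \<in> I" if x: "Inf I < x" and t: "t \<in> I" "x \<le> t" for x t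
    proof -
      obtain s where "s \<in> I" "s < x" using cInf_lessD[of I x] t1 x by blast
      then show ?thesis using ivl[of s t x] t by simp
    qed
    show ?thesis
    proof
      assume "eventually P (lower_end I)"
      then obtain b where b: "b > Inf I" "\<forall>y>Inf I. y < b \<longrightarrow> P y"
        using True lo[OF t1] by (auto simp: lower_end_def eventually_at_right[OF lo[OF t1]])
      define t0 where "t0 = min b t1"
      have "t0 \<in> I" using mem[of t0 t1] b(1) lo[OF t1] t1 by (simp add: t0_def)
      then show "\<exists>t0\<in>I. \<forall>t\<in>I. t < t0 \<longrightarrow> P t"
        using b(2) lo by (intro bexI[of _ t0]) (auto simp: t0_def)
    next
      assume "\<exists>t0\<in>I. \<forall>t\<in>I. t < t0 \<longrightarrow> P t"
      then obtain t0 where t0: "t0 \<in> I" "\<And>t. t \<in> I \<Longrightarrow> t < t0 \<Longrightarrow> P t" by blast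
      then have "\<forall>y>Inf I. y < t0 \<longrightarrow> P y" using mem[of _ t0] by auto
      then show "eventually P (lower_end I)"
        using True lo[OF t0(1)] by (auto simp: lower_end_def eventually_at_right[OF lo[OF t0(1)]])
    qed
  next
    case False
    have mem: "x \<in> I" if t: "t \<in> I" "x \<le> t" for x t
    proof -
      obtain s where "s \<in> I" "s < x" using False by (meson bdd_belowI not_le)
      then show ?thesis using ivl[of s t x] t by simp
    qed
    show ?thesis
    proof
      assume "eventually P (lower_end I)"
      then obtain b where b: "\<forall>y<b. P y"
        using False by (auto simp: lower_end_def eventually_at_bot_dense)
      then show "\<exists>t0\<in>I. \<forall>t\<in>I. t < t0 \<longrightarrow> P t"
        using mem[OF t1, of "min b t1"] by (intro bexI[of _ "min b t1"]) auto
    next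
      assume "\<exists>t0\<in>I. \<forall>t\<in>I. t < t0 \<longrightarrow> P t"
      then obtain t0 where t0: "t0 \<in> I" "\<And>t. t \<in> I \<Longrightarrow> t < t0 \<Longrightarrow> P t" by blast
      then have "\<forall>y<t0. P y" using mem[of t0] by auto
      then show "eventually P (lower_end I)"
        using False by (auto simp: lower_end_def eventually_at_bot_dense)
    qed
  qed
qed

lemma lower_end_sequence:
  assumes I: "param_interval I" and nomin: "\<And>t. t \<in> I \<Longrightarrow> \<exists>s\<in>I. s < t"
  obtains s :: "nat \<Rightarrow> real" where "\<And>n. s n \<in> I" "\<And>t. t \<in> I \<Longrightarrow> eventually (\<lambda>n. s n < t) sequentially"
proof -
  obtain t1 where t1: "t1 \<in> I" using I by (auto simp: param_interval_def)
  show ?thesis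
  proof (cases "bdd_below I")
    case True
    have lo: "Inf I < t" if "t \<in> I" for t
      using nomin[OF that] cInf_lower[OF _ True] by force
    have "\<exists>s\<in>I. s < Inf I + inverse (real (Suc n))" for n
      using cInf_lessD[of I "Inf I + inverse (real (Suc n))"] t1 by auto
    then obtain s where s: "\<And>n. s n \<in> I" "\<And>n. s n < Inf I + inverse (real (Suc n))" by metis
    have "eventually (\<lambda>n. s n < t) sequentially" if "t \<in> I" for t
    proof -
      have "(\<lambda>n. Inf I + inverse (real (Suc n))) \<longlonglongrightarrow> Inf I + 0"
        by (intro tendsto_intros LIMSEQ_inverse_real_of_nat)
      then have "eventually (\<lambda>n. Inf I + inverse (real (Suc n)) < t) sequentially"
        using lo[OF that] by (intro order_tendstoD) auto
      then show ?thesis by eventually_elim (use s(2) less_trans in blast)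
    qed
    then show ?thesis using that s(1) by blast
  next
    case False
    then have "\<exists>s\<in>I. s < - real n" for n by (meson bdd_belowI not_le)
    then obtain s where s: "\<And>n. s n \<in> I" "\<And>n. s n < - real n" by metis
    have "eventually (\<lambda>n. s n < t) sequentially" if "t \<in> I" for t
    proof -
      obtain N where "real N > - t" using reals_Archimedean2 by blast
      then have "s n < t" if "n \<ge> N" for n using s(2)[of n] that by (smt (verit) of_nat_le_iff)
      then show ?thesis by (auto simp: eventually_sequentially)
    qed
    then show ?thesis using that s(1) by blast
  qed
qed

context lorentzian_spacetime
begin

text \<open>At a least parameter continuity would supply the endpoint.\<close>

lemma no_endpoint_no_min:
  assumes fd: "fd lam I" and ne: "no_endpoint lam (lower_end I)" and t: "t \<in> I"
  shows "\<exists>s\<in>I. s < t"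
proof (rule ccontr)
  assume neg: "\<not> ?thesis"
  then have min: "\<And>s. s \<in> I \<Longrightarrow> t \<le> s" by force
  then have bdd: "bdd_below I" by (rule bdd_belowI)
  have Inf: "Inf I = t" by (rule cInf_eq_minimum[OF t min])
  obtain a b where ab: "a \<in> I" "b \<in> I" "a < b" using fd_interval[OF fd] by (auto simp: param_interval_def)
  then have tb: "t < b" using min[of a] by simp
  have sub: "{t..b} \<subseteq> I"
    using fd_interval[OF fd] mem_is_interval_1_I[of I t b] t ab(2) unfolding param_interval_def
    by (meson atLeastAtMost_iff subsetI)
  have "continuous_on {t..b} lam" using fd_continuous[OF fd] sub by (rule continuous_on_subset)
  then have "(lam \<longlongrightarrow> lam t) (at t within {t..b})"
    using tb unfolding continuous_on_def by auto
  then have "(lam \<longlongrightarrow> lam t) (at_right t)"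
    using tb by (simp add: at_within_Icc_at_right)
  then show False using ne bdd Inf by (auto simp: no_endpoint_def lower_end_def)
qed

end

section \<open>Trapped curves and limits of curves in a box\<close>

context lorentzian_box
begin

text \<open>Compactness gives one accumulation point \<open>p\<close>. Towards the past
  \<open>w\<close> decreases and is bounded below by its value at \<open>p\<close>, so the remaining
  time increments become small and \<open>time_increment\<close> makes the whole curve
  converge.\<close>

lemma trapped_imp_endpoint:
  assumes fd: "fd lam I" and nomin: "\<And>t. t \<in> I \<Longrightarrow> \<exists>s\<in>I. s < t" and t0: "t0 \<in> I"
    and trap: "\<And>t. t \<in> I \<Longrightarrow> t < t0 \<Longrightarrow> lam t \<in> closed_box c z r"
  obtains p where "(lam \<longlongrightarrow> p) (lower_end I)"
proof -
  have I: "param_interval I" using fd by (rule fd_interval)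
  have ev: "eventually P (lower_end I) \<longleftrightarrow> (\<exists>t0\<in>I. \<forall>t\<in>I. t < t0 \<longrightarrow> P t)" for P
    by (rule eventually_lower_end[OF I]) (rule nomin)
  obtain s' where s': "\<And>n. s' n \<in> I" "\<And>t. t \<in> I \<Longrightarrow> eventually (\<lambda>n. s' n < t) sequentially"
    using lower_end_sequence[OF I nomin] by blast
  obtain N where N: "\<And>n. n \<ge> N \<Longrightarrow> s' n < t0" using s'(2)[OF t0] by (auto simp: eventually_sequentially)
  have sc: "seq_compact (closed_box c z r)" using compact_closed_box[of r] by (intro compact_imp_seq_compact) simp
  have s'_in: "\<forall>n. lam (s' (n + N)) \<in> closed_box c z r" using s'(1) N trap by simp
  obtain p \<sigma> where p: "p \<in> closed_box c z r" "strict_mono \<sigma>" "((\<lambda>n. lam (s' (n + N))) \<circ> \<sigma>) \<longlonglongrightarrow> p"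
    by (rule seq_compactE[OF sc s'_in])
  define s where "s n = s' (\<sigma> n + N)" for n
  have sI: "s n \<in> I" "s n < t0" for n using s'(1) N by (auto simp: s_def)
  have s_ev: "eventually (\<lambda>n. s n < t) sequentially" if tI: "t \<in> I" for t
  proof -
    obtain M where M: "\<And>n. n \<ge> M \<Longrightarrow> s' n < t" using s'(2)[OF tI] by (auto simp: eventually_sequentially)
    have "s n < t" if "n \<ge> M" for n
      unfolding s_def using seq_suble[OF p(2), of n] that by (intro M) simp
    then show ?thesis by (auto simp: eventually_sequentially)
  qed
  let ?f = "\<lambda>t. snd c (lam t)"
  have pc: "p \<in> fst c" using p(1) by (rule closed_box_in_chart)
  have lim: "(\<lambda>n. lam (s n)) \<longlonglongrightarrow> p" using p(3) by (simp add: o_def s_def)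
  then have flim: "(\<lambda>n. ?f (s n)) \<longlonglongrightarrow> snd c p"
    by (rule isCont_tendsto_compose[OF isCont_chart[OF c pc]])
  then have hlim: "(\<lambda>n. w \<bullet> ?f (s n)) \<longlonglongrightarrow> w \<bullet> snd c p" by (intro tendsto_intros)
  have inc: "k * norm (?f b - ?f a) \<le> w \<bullet> ?f b - w \<bullet> ?f a" if "a \<in> I" "b \<in> I" "a \<le> b" "b < t0" for a b
  proof -
    have sub: "{a..b} \<subseteq> I"
      using I mem_is_interval_1_I[of I a b] that unfolding param_interval_def
      by (meson atLeastAtMost_iff subsetI)
    have "lam ` {a..b} \<subseteq> closed_box c z r"
    proof
      fix q assume "q \<in> lam ` {a..b}"
      then obtain t where "t \<in> {a..b}" "q = lam t" by blast
      then show "q \<in> closed_box c z r" using trap[of t] sub that(4) by auto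
    qed
    from time_increment[OF fd that(3) sub this] show ?thesis by (simp add: inner_diff_right)
  qed
  have low: "w \<bullet> snd c p \<le> w \<bullet> ?f t" if "t \<in> I" "t < t0" for t
  proof (rule tendsto_upperbound[OF hlim])
    show "eventually (\<lambda>n. w \<bullet> ?f (s n) \<le> w \<bullet> ?f t) sequentially"
      using s_ev[OF that(1)]
    proof eventually_elim
      case (elim n)
      have "0 \<le> k * norm (?f t - ?f (s n))" using k by simp
      then show ?case using inc[of "s n" t] sI that elim by simp
    qed
  qed simp
  have "(?f \<longlongrightarrow> snd c p) (lower_end I)"
  proof (rule tendstoI)
    fix e :: real assume e: "e > 0"
    have "eventually (\<lambda>n. dist (?f (s n)) (snd c p) < e / 2) sequentially"
      using tendstoD[OF flim, of "e / 2"] e by simp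
    moreover have "eventually (\<lambda>n. w \<bullet> ?f (s n) < w \<bullet> snd c p + k * e / 2) sequentially"
      using hlim e k by (intro order_tendstoD) auto
    ultimately obtain n where n: "dist (?f (s n)) (snd c p) < e / 2" "w \<bullet> ?f (s n) < w \<bullet> snd c p + k * e / 2"
      using eventually_happens[OF eventually_conj] by (metis (no_types, lifting) sequentially_bot)
    have "dist (?f t) (snd c p) < e" if t: "t \<in> I" "t < s n" for t
    proof -
      have "k * norm (?f (s n) - ?f t) \<le> w \<bullet> ?f (s n) - w \<bullet> ?f t"
        using inc[of t "s n"] sI t by simp
      also have "\<dots> < k * (e / 2)" using low[of t] n(2) sI[of n] t by simp
      finally have "norm (?f (s n) - ?f t) < e / 2" using k mult_less_cancel_left_pos by blast
      then show ?thesis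
        using n(1) dist_triangle[of "?f t" "snd c p" "?f (s n)"] by (simp add: dist_norm norm_minus_commute)
    qed
    then show "eventually (\<lambda>t. dist (?f t) (snd c p) < e) (lower_end I)"
      unfolding ev using sI(1)[of n] by (intro bexI[of _ "s n"]) auto
  qed
  then have "((\<lambda>t. cinv c (?f t)) \<longlongrightarrow> cinv c (snd c p)) (lower_end I)"
    by (rule isCont_tendsto_compose[OF isCont_cinv[OF c imageI[OF pc]]])
  moreover have "eventually (\<lambda>t. cinv c (?f t) = lam t) (lower_end I)"
    unfolding ev
    using t0 cinv_chart[OF c closed_box_in_chart[OF trap]] by (intro bexI[of _ t0]) auto
  ultimately have "(lam \<longlongrightarrow> cinv c (snd c p)) (lower_end I)"
    by (rule Lim_transform_eventually)
  then show ?thesis by (rule that)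
qed

text \<open>Causal curves of the box, parametrised by an affine function of the time \<open>w\<close>. The last clause
  encodes causality in a form that survives pointwise limits.\<close>
definition normal_curve :: "(real \<Rightarrow> real ^ 'n) \<Rightarrow> bool" where
  "normal_curve g \<longleftrightarrow> (\<forall>u\<in>{0..1}. g u \<in> cball z r \<and> w \<bullet> g u = (1 - u) * (w \<bullet> g 0) + u * (w \<bullet> g 1)) \<and>
     (\<forall>u u'. 0 \<le> u \<longrightarrow> u \<le> u' \<longrightarrow> u' \<le> 1 \<longrightarrow> k * norm (g u' - g u) \<le> w \<bullet> (g u' - g u)) \<and>
     (\<forall>l u u'. 0 \<le> u \<longrightarrow> u \<le> u' \<longrightarrow> u' \<le> 1 \<longrightarrow>
        (\<forall>t\<in>{u..u'}. \<forall>v. fcv c (cinv c (g t)) v \<longrightarrow> 0 \<le> l \<bullet> v) \<longrightarrow>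
        l \<bullet> g u \<le> l \<bullet> g u')"

text \<open>Time is continuous and strictly increasing along the curve, hence can be inverted:
  \<open>val\<close> is the affine time scale and \<open>th\<close> the resulting change of
  parameter.\<close>

lemma normal_curve_exists:
  assumes fd: "fd lam {a..b}" and ab: "a < b" and lb: "lam ` {a..b} \<subseteq> closed_box c z r"
  obtains g where "normal_curve g" "g 0 = snd c (lam a)" "g 1 = snd c (lam b)"
proof -
  define f where "f t = snd c (lam t)" for t
  define h where "h t = w \<bullet> f t" for t
  have lbt: "lam t \<in> closed_box c z r" if "t \<in> {a..b}" for t using lb that by blast
  have strict: "h s < h t" if "a \<le> s" "s < t" "t \<le> b" for s t
  proof -
    have "{s..t} \<subseteq> {a..b}" using that by auto
    then show ?thesis unfolding h_def f_def using lb by (intro time_strict[OF fd that(2)]) blast+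
  qed
  have "continuous_on {a..b} (\<lambda>t. snd c (lam t))"
  proof (rule continuous_on_compose2[OF continuous_on_chart[OF c] fd_continuous[OF fd]])
    show "lam ` {a..b} \<subseteq> fst c" using lb closed_box_in_chart by blast
  qed
  then have conth: "continuous_on {a..b} h" unfolding h_def f_def by (intro continuous_intros)
  have hab: "h a < h b" using strict ab by simp
  define val where "val u = (1 - u) * h a + u * h b" for u
  have val_eq: "val u = h a + u * (h b - h a)" for u by (simp add: val_def algebra_simps)
  have val_mono: "val u < val u'" if "u < u'" for u u'
    using that hab unfolding val_eq by simp
  have val01: "val 0 = h a" "val 1 = h b" by (simp_all add: val_def)
  have "\<exists>t. t \<in> {a..b} \<and> h t = val u" if "u \<in> {0..1}" for u
  proof -
    have "val 0 \<le> val u" "val u \<le> val 1"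
      using that val_mono by (auto simp: le_less)
    then show ?thesis using IVT'[of h a "val u" b] conth ab val01 by auto
  qed
  then obtain th where th: "\<And>u. u \<in> {0..1} \<Longrightarrow> th u \<in> {a..b} \<and> h (th u) = val u" by metis
  have inj: "s = t" if "s \<in> {a..b}" "t \<in> {a..b}" "h s = h t" for s t
    using strict[of s t] strict[of t s] that by (cases s t rule: linorder_cases) auto
  have th_mono: "th u \<le> th u'" if "u \<in> {0..1}" "u' \<in> {0..1}" "u \<le> u'" for u u'
  proof (rule ccontr)
    assume "\<not> th u \<le> th u'"
    then have "h (th u') < h (th u)"
      using strict[of "th u'" "th u"] th[OF that(1)] th[OF that(2)] by simp
    moreover have "val u \<le> val u'" using val_mono that(3) by (cases "u = u'") (auto simp: less_imp_le)
    ultimately show False using th that by simp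
  qed
  have th0: "th 0 = a" and th1: "th 1 = b"
    using inj[of "th 0" a] inj[of "th 1" b] th[of 0] th[of 1] val01 ab by auto
  define g where "g u = f (th u)" for u
  have cg: "cinv c (g u) = lam (th u)" if "u \<in> {0..1}" for u
    unfolding g_def f_def using th[OF that] lbt closed_box_in_chart cinv_chart[OF c] by blast
  have wg: "w \<bullet> g u = val u" if "u \<in> {0..1}" for u
    using th[OF that] by (simp add: g_def h_def)
  have sub: "{th u..th u'} \<subseteq> {a..b}" if "u \<in> {0..1}" "u' \<in> {0..1}" for u u'
    using th[OF that(1)] th[OF that(2)] by auto
  \<comment> \<open>\<open>th\<close> has no gaps. The cone hypothesis on \<open>l\<close> speaks of
    points of \<open>g\<close> only, while \<open>fd_functional_mono\<close> needs it at every
    parameter of \<open>lam\<close> in between.\<close>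
  have onto: "\<exists>x\<in>{u..u'}. th x = t" if u: "u \<in> {0..1}" "u' \<in> {0..1}" and t: "th u \<le> t" "t \<le> th u'" for u u' t
  proof -
    have tab: "t \<in> {a..b}" using th[OF u(1)] th[OF u(2)] t by auto
    have weak: "h s \<le> h t" if "a \<le> s" "s \<le> t" "t \<le> b" for s t
      using strict[of s t] that by (cases "s = t") auto
    define x where "x = (h t - h a) / (h b - h a)"
    have vx: "val x = h t" using hab by (simp add: val_eq x_def)
    have "val u \<le> val x" "val x \<le> val u'"
      using th[OF u(1)] th[OF u(2)] weak[of "th u" t] weak[of t "th u'"] t tab vx by simp_all
    then have x: "u \<le> x" "x \<le> u'" using val_mono[of x u] val_mono[of u' x] by linarith+
    then have x01: "x \<in> {0..1}" using u by simp
    have "th x = t" using inj[of "th x" t] th[OF x01] vx tab by simp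
    moreover have "x \<in> {u..u'}" using x by simp
    ultimately show ?thesis by blast
  qed
  have "normal_curve g"
    unfolding normal_curve_def
  proof (intro conjI ballI allI impI)
    fix u :: real assume u: "u \<in> {0..1}"
    show "g u \<in> cball z r" using th[OF u] lbt[of "th u"] by (simp add: g_def f_def closed_box_def)
    show "w \<bullet> g u = (1 - u) * (w \<bullet> g 0) + u * (w \<bullet> g 1)"
      using wg[OF u] wg[of 0] wg[of 1] val01 by (simp add: val_def)
  next
    fix u u' :: real assume u: "0 \<le> u" "u \<le> u'" "u' \<le> 1"
    then have u': "u \<in> {0..1}" "u' \<in> {0..1}" by auto
    show "k * norm (g u' - g u) \<le> w \<bullet> (g u' - g u)"
      unfolding g_def f_def
      using sub[OF u'] lb by (intro time_increment[OF fd th_mono[OF u' u(2)]]) blast+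
    fix l
    assume l: "\<forall>t\<in>{u..u'}. \<forall>v. fcv c (cinv c (g t)) v \<longrightarrow> 0 \<le> l \<bullet> v"
    show "l \<bullet> g u \<le> l \<bullet> g u'"
      unfolding g_def f_def
    proof (rule fd_functional_mono[OF fd th_mono[OF u' u(2)] sub[OF u'] c])
      show "lam ` {th u..th u'} \<subseteq> fst c" using sub[OF u'] lb closed_box_in_chart by blast
      fix t v assume t: "t \<in> {th u<..<th u'}" and v: "fcv c (lam t) v"
      obtain x where x: "x \<in> {u..u'}" "th x = t" using onto[OF u', of t] t by auto
      then have "cinv c (g x) = lam t" using cg[of x] u by auto
      then show "0 \<le> l \<bullet> v" using l x(1) v by metis
    qed
  qed
  then show ?thesis using that[of g] by (simp add: g_def f_def th0 th1)
qed

text \<open>The time increment over \<open>{0..1}\<close> is at most \<open>norm w\<close> times the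
  diameter \<open>2 * r\<close>, and distance is at most time divided by \<open>k\<close>. The
  constant depends on the box alone, which gives equicontinuity.\<close>

lemma normal_curve_lipschitz:
  assumes g: "normal_curve g" and u: "0 \<le> u" "u \<le> 1" "0 \<le> u'" "u' \<le> 1"
  shows "norm (g u - g u') \<le> (norm w * (2 * r) / k) * \<bar>u - u'\<bar>"
proof -
  have main: "norm (g u' - g u) \<le> (norm w * (2 * r) / k) * (u' - u)" if "0 \<le> u" "u \<le> u'" "u' \<le> 1" for u u'
  proof -
    have u: "u \<in> {0..1}" "u' \<in> {0..1}" using that by auto
    have "k * norm (g u' - g u) \<le> w \<bullet> (g u' - g u)" using g that unfolding normal_curve_def by blast
    also have "\<dots> = (u' - u) * (w \<bullet> (g 1 - g 0))"
    proof -
      have "w \<bullet> g u = (1 - u) * (w \<bullet> g 0) + u * (w \<bullet> g 1)" "w \<bullet> g u' = (1 - u') * (w \<bullet> g 0) + u' * (w \<bullet> g 1)"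
        using g u unfolding normal_curve_def by blast+
      then show ?thesis by (simp add: inner_diff_right algebra_simps)
    qed
    also have "\<dots> \<le> (u' - u) * (norm w * (2 * r))"
    proof (rule mult_left_mono)
      have "g 0 \<in> cball z r" "g 1 \<in> cball z r" using g unfolding normal_curve_def by auto
      then have "norm (g 1 - g 0) \<le> 2 * r"
        using dist_triangle2[of "g 1" "g 0" z] by (simp add: dist_norm norm_minus_commute)
      then have "norm w * norm (g 1 - g 0) \<le> norm w * (2 * r)" by (intro mult_left_mono) auto
      then show "w \<bullet> (g 1 - g 0) \<le> norm w * (2 * r)"
        using norm_cauchy_schwarz[of w "g 1 - g 0"] by simp
    qed (use that in simp)
    finally show ?thesis using k by (simp add: field_simps)
  qed
  show ?thesis
    using main[of u u'] main[of u' u] u by (cases "u \<le> u'") (auto simp: norm_minus_commute)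
qed

text \<open>The uniform Lipschitz constant keeps the approximating curves near \<open>g u\<close>
  for a common time after \<open>u\<close>. There \<open>l\<close> is monotone along them, and
  monotonicity passes to the pointwise limit and hence to its derivative.\<close>

lemma normal_curve_limit_functional:
  assumes gs: "\<And>n. normal_curve (gs n)"
    and lim: "\<And>u. u \<in> {0..1} \<Longrightarrow> (\<lambda>n. gs n u) \<longlonglongrightarrow> g u"
    and u: "0 < u" "u < 1" and e: "e > 0"
    and l: "\<And>q v. q \<in> closed_box c z r \<Longrightarrow> dist (snd c q) (g u) < e \<Longrightarrow>
      fcv c q v \<Longrightarrow> 0 \<le> l \<bullet> v"
    and der: "(g has_vector_derivative v) (at u)"
  shows "0 \<le> l \<bullet> v"
proof (rule ccontr)
  assume neg: "\<not> 0 \<le> l \<bullet> v"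
  define K where "K = norm w * (2 * r) / k"
  have K: "0 \<le> K" using r k by (simp add: K_def)
  have u01: "u \<in> {0..1}" using u by simp
  \<comment> \<open>The curves move by at most \<open>e / 2\<close> within \<open>d\<close> after
    \<open>u\<close>; the other \<open>e / 2\<close> is for the distance of \<open>gs n u\<close>
    from \<open>g u\<close>. The summand 1 avoids division by zero.\<close>
  define d where "d = min (1 - u) (e / (2 * (K + 1)))"
  have d: "0 < d" "u + d \<le> 1" using u e K by (auto simp: d_def)
  have Kd: "K * d \<le> e / 2"
  proof -
    have "K * d \<le> (K + 1) * (e / (2 * (K + 1)))" using K d(1) by (intro mult_mono) (auto simp: d_def)
    also have "\<dots> = e / 2" using K by (simp add: field_simps)
    finally show ?thesis .
  qed
  have mono: "l \<bullet> g u \<le> l \<bullet> g u'" if u': "u \<le> u'" "u' \<le> u + d" for u'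
  proof (rule LIMSEQ_le)
    show "(\<lambda>n. l \<bullet> gs n u) \<longlonglongrightarrow> l \<bullet> g u" by (intro tendsto_intros lim u01)
    show "(\<lambda>n. l \<bullet> gs n u') \<longlonglongrightarrow> l \<bullet> g u'" using u' u d by (intro tendsto_intros lim) auto
    have "eventually (\<lambda>n. dist (gs n u) (g u) < e / 2) sequentially"
      using tendstoD[OF lim[OF u01], of "e / 2"] e by simp
    then have "eventually (\<lambda>n. l \<bullet> gs n u \<le> l \<bullet> gs n u') sequentially"
    proof eventually_elim
      case (elim n)
      have "0 \<le> l \<bullet> v'" if t: "t \<in> {u..u'}" and v': "fcv c (cinv c (gs n t)) v'" for t v'
      proof (rule l[OF _ _ v'])
        have t01: "t \<in> {0..1}" using t u u' d by simp
        have cb: "gs n t \<in> cball z r" using gs[of n] t01 unfolding normal_curve_def by blast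
        show "cinv c (gs n t) \<in> closed_box c z r" by (rule cinv_closed_box[OF cb])
        have "norm (gs n t - gs n u) \<le> K * \<bar>t - u\<bar>"
          unfolding K_def using t01 u01 by (intro normal_curve_lipschitz[OF gs]) auto
        also have "\<dots> \<le> K * d" using t u' K by (intro mult_left_mono) auto
        finally have "norm (gs n t - gs n u) \<le> e / 2" using Kd by simp
        then have "dist (gs n t) (g u) < e"
          using elim dist_triangle[of "gs n t" "g u" "gs n u"] by (simp add: dist_norm)
        then show "dist (snd c (cinv c (gs n t))) (g u) < e" by (simp add: chart_cinv_cball[OF cb])
      qed
      moreover have "0 \<le> u" "u' \<le> 1" using u u' d by auto
      ultimately show ?case using gs[of n] u'(1) unfolding normal_curve_def by blast
    qed
    then show "\<exists>N. \<forall>n\<ge>N. l \<bullet> gs n u \<le> l \<bullet> gs n u'" by (simp add: eventually_sequentially)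
  qed
  have "((\<lambda>t. l \<bullet> g t) has_vector_derivative l \<bullet> v) (at u)"
    by (rule bounded_linear.has_vector_derivative[OF bounded_linear_inner_right der])
  then have "((\<lambda>t. l \<bullet> g t) has_real_derivative l \<bullet> v) (at u)"
    by (simp add: has_real_derivative_iff_has_vector_derivative)
  then obtain d' where d': "d' > 0" "\<forall>h>0. h < d' \<longrightarrow> l \<bullet> g (u + h) < l \<bullet> g u"
    using DERIV_neg_dec_right[of "\<lambda>t. l \<bullet> g t" "l \<bullet> v" u] neg by auto
  define h where "h = min (d' / 2) d"
  have "0 < h" "h < d'" "h \<le> d" using d' d by (auto simp: h_def)
  then have "l \<bullet> g (u + h) < l \<bullet> g u" "l \<bullet> g u \<le> l \<bullet> g (u + h)" using d'(2) mono[of "u + h"] by auto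
  then show False by simp
qed

text \<open>Almost everywhere the Lipschitz limit has a derivative \<open>v\<close>; distinct
  endpoints give \<open>w \<bullet> v = m > 0\<close>, so \<open>v\<close> is nonzero. If
  \<open>v\<close> were spacelike, a functional nonnegative on all nearby cones would be negative on
  \<open>v\<close>, against \<open>normal_curve_limit_functional\<close>.\<close>

lemma normal_curve_limit:
  assumes gs: "\<And>n. normal_curve (gs n)"
    and lim: "\<And>u. u \<in> {0..1} \<Longrightarrow> (\<lambda>n. gs n u) \<longlonglongrightarrow> g u" and ne: "g 0 \<noteq> g 1"
  shows "fd (\<lambda>u. cinv c (g u)) {0..1}" and "\<And>u. u \<in> {0..1} \<Longrightarrow> g u \<in> cball z r"
proof -
  define K where "K = norm w * (2 * r) / k"
  have K: "0 \<le> K" using r k by (simp add: K_def)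
  have z01: "(0::real) \<in> {0..1}" "(1::real) \<in> {0..1}" by auto
  show cb: "g u \<in> cball z r" if "u \<in> {0..1}" for u
  proof (rule Lim_in_closed_set[OF closed_cball _ _ lim[OF that]])
    show "eventually (\<lambda>n. gs n u \<in> cball z r) sequentially"
      using gs that unfolding normal_curve_def by (intro always_eventually) blast
  qed simp
  have lip: "norm (g u - g u') \<le> K * \<bar>u - u'\<bar>" if "u \<in> {0..1}" "u' \<in> {0..1}" for u u'
  proof (rule tendsto_upperbound)
    show "(\<lambda>n. norm (gs n u - gs n u')) \<longlonglongrightarrow> norm (g u - g u')" by (intro tendsto_intros lim that)
    show "eventually (\<lambda>n. norm (gs n u - gs n u') \<le> K * \<bar>u - u'\<bar>) sequentially"
      unfolding K_def using that by (intro always_eventually allI normal_curve_lipschitz[OF gs]) auto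
  qed simp
  have Klip: "K-lipschitz_on {0..1} g"
    using lip K by (intro lipschitz_onI) (auto simp: dist_norm)
  define m where "m = w \<bullet> (g 1 - g 0)"
  have m: "m > 0"
  proof -
    have "k * norm (g 1 - g 0) \<le> m"
      unfolding m_def
    proof (rule LIMSEQ_le)
      show "(\<lambda>n. k * norm (gs n 1 - gs n 0)) \<longlonglongrightarrow> k * norm (g 1 - g 0)" by (intro tendsto_intros lim z01)
      show "(\<lambda>n. w \<bullet> (gs n 1 - gs n 0)) \<longlonglongrightarrow> w \<bullet> (g 1 - g 0)" by (intro tendsto_intros lim z01)
      show "\<exists>N. \<forall>n\<ge>N. k * norm (gs n 1 - gs n 0) \<le> w \<bullet> (gs n 1 - gs n 0)"
        using gs unfolding normal_curve_def by auto
    qed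
    moreover have "0 < k * norm (g 1 - g 0)" using k ne by simp
    ultimately show ?thesis by simp
  qed
  have wg: "w \<bullet> g u = w \<bullet> g 0 + u * m" if "u \<in> {0..1}" for u
  proof (rule LIMSEQ_unique)
    show "(\<lambda>n. w \<bullet> gs n u) \<longlonglongrightarrow> w \<bullet> g u" by (intro tendsto_intros lim that)
    have "w \<bullet> gs n u = w \<bullet> gs n 0 + u * (w \<bullet> (gs n 1 - gs n 0))" for n
    proof -
      have "w \<bullet> gs n u = (1 - u) * (w \<bullet> gs n 0) + u * (w \<bullet> gs n 1)"
        using gs[of n] that unfolding normal_curve_def by blast
      then show ?thesis by (simp add: inner_diff_right algebra_simps)
    qed
    then show "(\<lambda>n. w \<bullet> gs n u) \<longlonglongrightarrow> w \<bullet> g 0 + u * m"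
      unfolding m_def by (simp only:) (intro tendsto_intros lim z01)
  qed
  let ?lam = "\<lambda>u. cinv c (g u)"
  have sl: "snd c (?lam u) = g u" and lb: "?lam u \<in> closed_box c z r" if "u \<in> {0..1}" for u
    using chart_cinv_cball[OF cb[OF that]] cinv_closed_box[OF cb[OF that]] by auto
  have causal: "causal_at ?lam u" if u: "0 < u" "u < 1" and diff: "g differentiable at u" for u
  proof -
    have u01: "u \<in> {0..1}" using u by simp
    let ?p = "?lam u"
    have p: "?p \<in> closed_box c z r" "?p \<in> fst c" using lb[OF u01] closed_box_in_chart by blast+
    obtain v where v: "(g has_vector_derivative v) (at u)"
      using diff vector_derivative_works by blast
    have "((\<lambda>t. w \<bullet> g t) has_vector_derivative w \<bullet> v) (at u)"
      by (rule bounded_linear.has_vector_derivative[OF bounded_linear_inner_right v])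
    then have "((\<lambda>t. w \<bullet> g 0 + t * m) has_vector_derivative w \<bullet> v) (at u)"
    proof (rule has_vector_derivative_transform_within_open[OF _ open_greaterThanLessThan])
      show "u \<in> {0<..<1}" using u by simp
      show "w \<bullet> g t = w \<bullet> g 0 + t * m" if "t \<in> {0<..<1}" for t using that by (intro wg) auto
    qed
    moreover have "((\<lambda>t. w \<bullet> g 0 + t * m) has_vector_derivative m) (at u)"
      by (auto intro!: derivative_eq_intros simp: has_real_derivative_iff_has_vector_derivative[symmetric])
    ultimately have wv: "w \<bullet> v = m" using vector_derivative_unique_at by blast
    have v0: "v \<noteq> 0" using wv m by auto
    let ?Q = "G c ?p" and ?x = "X c ?p"
    have Q: "lorentzian_matrix ?Q" "bil ?Q ?x ?x < 0"
      using metric_lorentzian[OF c p(2)] orientation_timelike[OF c p(2)] by auto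
    have "bil ?Q v v \<le> 0"
    proof (rule ccontr)
      assume "\<not> bil ?Q v v \<le> 0"
      then obtain l where l: "l \<bullet> v \<le> 0" "\<And>y. future_causal_vec ?Q ?x y \<Longrightarrow> l \<bullet> y > 0"
        using lorentzian_separate_spacelike[OF Q, of v] by auto
      obtain k' e where k': "k' > 0" "e > 0"
        "\<And>q y. q \<in> fst c \<Longrightarrow> dist (snd c q) (snd c ?p) < e \<Longrightarrow> fcv c q y \<Longrightarrow> k' * norm y \<le> l \<bullet> y"
        using functional_positive_near[OF c p(2) l(2)] by blast
      \<comment> \<open>The separation gives only \<open>l \<bullet> v \<le> 0\<close>. Subtracting
        a small multiple of \<open>w\<close> makes the value at \<open>v\<close> negative; since
        \<open>s * norm w \<le> k'\<close>, the margin \<open>k'\<close> keeps the functional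
        nonnegative on nearby cones.\<close>
      define s where "s = k' / (norm w + 1)"
      have nw: "norm w + 1 > 0" by (simp add: add_nonneg_pos)
      then have s: "s > 0" "s * norm w \<le> k'"
        using k'(1) by (simp_all add: s_def pos_divide_le_eq)
      have "0 \<le> (l - s *\<^sub>R w) \<bullet> v"
      proof (rule normal_curve_limit_functional[OF gs lim u k'(2) _ v])
        fix q y assume q: "q \<in> closed_box c z r" "dist (snd c q) (g u) < e" "fcv c q y"
        have "k' * norm y \<le> l \<bullet> y" using k'(3)[OF closed_box_in_chart[OF q(1)] _ q(3)] q(2) sl[OF u01] by simp
        moreover have "s * (w \<bullet> y) \<le> s * (norm w * norm y)"
          using s(1) norm_cauchy_schwarz by (intro mult_left_mono) auto
        moreover have "s * (norm w * norm y) \<le> k' * norm y"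
          using s(2) by (simp add: mult.assoc[symmetric] mult_right_mono)
        ultimately show "0 \<le> (l - s *\<^sub>R w) \<bullet> y" by (simp add: inner_diff_left)
      qed
      moreover have "s * (w \<bullet> v) > 0" using s(1) m wv by simp
      ultimately show False using l(1) by (simp add: inner_diff_left)
    qed
    \<comment> \<open>Otherwise \<open>- v\<close> would be future causal, so \<open>w\<close> would
      be positive on it, contrary to \<open>w \<bullet> v = m > 0\<close>.\<close>
    moreover have "bil ?Q ?x v < 0"
    proof (rule ccontr)
      assume "\<not> bil ?Q ?x v < 0"
      then have "bil ?Q ?x v > 0"
        using lorentzian_timelike_causal_not_orthogonal[OF Q \<open>bil ?Q v v \<le> 0\<close> v0] by simp
      then have "future_causal_vec ?Q ?x (- v)"
        using \<open>bil ?Q v v \<le> 0\<close> v0 by (simp add: future_causal_vec_def)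
      then have "k * norm (- v) \<le> w \<bullet> (- v)" by (rule w[OF p(1)])
      moreover have "0 < k * norm v" using k v0 by simp
      ultimately show False using wv m by simp
    qed
    ultimately have fc: "future_causal_vec ?Q ?x v" using v0 by (simp add: future_causal_vec_def)
    have "((snd c \<circ> ?lam) has_vector_derivative v) (at u)"
    proof (rule has_vector_derivative_transform_within_open[OF v open_greaterThanLessThan])
      show "u \<in> {0<..<1}" using u by simp
      show "g t = (snd c \<circ> ?lam) t" if "t \<in> {0<..<1}" for t using sl[of t] that by simp
    qed
    then show ?thesis unfolding causal_at_def using c p(2) fc by blast
  qed
  show "fd ?lam {0..1}"
    unfolding fd_iff
  proof (intro conjI ballI)
    show "param_interval {0..1::real}" unfolding param_interval_def
      by (intro conjI is_interval_cc bexI[where x = 0] bexI[where x = 1]) auto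
    show "lipschitz_at ?lam {0..1} t" if t: "t \<in> {0..1}" for t
    proof -
      have "K-lipschitz_on ({0..1} \<inter> ball t 1) (snd c \<circ> ?lam)"
      proof (rule lipschitz_on_transform)
        show "K-lipschitz_on ({0..1} \<inter> ball t 1) g" by (rule lipschitz_on_subset[OF Klip]) simp
        show "(snd c \<circ> ?lam) x = g x" if "x \<in> {0..1} \<inter> ball t 1" for x using sl[of x] that by simp
      qed
      moreover have "?lam ` ({0..1} \<inter> ball t 1) \<subseteq> fst c" using closed_box_in_chart[OF lb] by blast
      ultimately show ?thesis unfolding lipschitz_at_def using c zero_less_one by blast
    qed
    have "negligible {u \<in> {0<..<1}. \<not> g differentiable at u}"
      by (rule lipschitz_vec_differentiable_ae[OF Klip])
    then show "negligible {t \<in> interior {0..1}. \<not> causal_at ?lam t}"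
      by (rule negligible_subset) (use causal in auto)
  qed
qed

lemma box_causal_closed:
  assumes R: "\<And>n. box_causal c z r (xs n) (ys n)" and xs: "xs \<longlonglongrightarrow> x" and ys: "ys \<longlonglongrightarrow> y"
  shows "box_causal c z r x y"
proof -
  have cl: "closed (closed_box c z r)" using compact_closed_box[of r] by (simp add: compact_imp_closed)
  have xys: "xs n \<in> closed_box c z r" "ys n \<in> closed_box c z r" for n using R[of n] by (auto simp: box_causal_def)
  have xy: "x \<in> closed_box c z r" "y \<in> closed_box c z r"
    using closed_sequentially[OF cl _ xs] closed_sequentially[OF cl _ ys] xys by auto
  show ?thesis
  proof (cases "x = y")
    case True
    then show ?thesis using xy by (simp add: box_causal_def)
  next
    case False
    have xyc: "x \<in> fst c" "y \<in> fst c" using xy closed_box_in_chart by auto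
    have lims: "(\<lambda>n. snd c (xs n)) \<longlonglongrightarrow> snd c x" "(\<lambda>n. snd c (ys n)) \<longlonglongrightarrow> snd c y"
      using isCont_tendsto_compose[OF isCont_chart[OF c xyc(1)] xs]
        isCont_tendsto_compose[OF isCont_chart[OF c xyc(2)] ys] by auto
    have ne: "snd c x \<noteq> snd c y" using False cinv_chart[OF c] xyc by metis
    \<comment> \<open>Distinct limits force \<open>xs n\<close> and \<open>ys n\<close> to differ
      from some \<open>N\<close> on, where \<open>box_causal\<close> then provides genuine
      curves.\<close>
    have "(\<lambda>n. dist (snd c (xs n)) (snd c (ys n))) \<longlonglongrightarrow> dist (snd c x) (snd c y)"
      by (intro tendsto_intros lims)
    then have "eventually (\<lambda>n. 0 < dist (snd c (xs n)) (snd c (ys n))) sequentially"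
      using ne by (intro order_tendstoD) auto
    then obtain N where N': "\<forall>n\<ge>N. 0 < dist (snd c (xs n)) (snd c (ys n))"
      unfolding eventually_sequentially by blast
    have N: "xs n \<noteq> ys n" if "n \<ge> N" for n using N' that by auto
    have "\<exists>g. normal_curve g \<and> g 0 = snd c (xs (n + N)) \<and> g 1 = snd c (ys (n + N))" for n
    proof -
      obtain lam a b where "a < b" "fd lam {a..b}" "lam a = xs (n + N)" "lam b = ys (n + N)"
        "lam ` {a..b} \<subseteq> closed_box c z r"
        using R[of "n + N"] N[of "n + N"] unfolding box_causal_def by auto
      then show ?thesis using normal_curve_exists[of lam a b] by metis
    qed
    then have "\<forall>n. \<exists>g. normal_curve g \<and> g 0 = snd c (xs (n + N)) \<and> g 1 = snd c (ys (n + N))" ..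
    from choice[OF this] obtain gs where
      gs': "\<forall>n. normal_curve (gs n) \<and> gs n 0 = snd c (xs (n + N)) \<and> gs n 1 = snd c (ys (n + N))" ..
    then have gs: "\<And>n. normal_curve (gs n)" "\<And>n. gs n 0 = snd c (xs (n + N))" "\<And>n. gs n 1 = snd c (ys (n + N))"
      by blast+
    define K where "K = norm w * (2 * r) / k"
    have K: "0 \<le> K" using r k by (simp add: K_def)
    obtain g \<sigma> where g: "strict_mono (\<sigma> :: nat \<Rightarrow> nat)"
      "\<And>e. 0 < e \<Longrightarrow> \<exists>N. \<forall>n x. n \<ge> N \<and> x \<in> {0..1} \<longrightarrow> norm (gs (\<sigma> n) x - g x) < e"
    proof (rule Arzela_Ascoli[of "{0..1::real}" gs "norm z + r"])
      show "norm (gs n u) \<le> norm z + r" if "u \<in> {0..1}" for n u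
      proof -
        have "gs n u \<in> cball z r" using gs(1)[of n] that unfolding normal_curve_def by blast
        then show ?thesis using norm_triangle_sub[of "gs n u" z] by (simp add: dist_norm norm_minus_commute)
      qed
      show "\<exists>d. 0 < d \<and> (\<forall>n y. y \<in> {0..1} \<and> norm (u - y) < d \<longrightarrow> norm (gs n u - gs n y) < e)"
        if u: "u \<in> {0..1}" and e: "0 < e" for u e
      proof (intro exI[of _ "e / (K + 1)"] conjI allI impI)
        show "0 < e / (K + 1)" using e K by simp
        fix n y assume y: "y \<in> {0..1} \<and> norm (u - y) < e / (K + 1)"
        have "norm (gs n u - gs n y) \<le> K * \<bar>u - y\<bar>"
          unfolding K_def using u y by (intro normal_curve_lipschitz[OF gs(1)]) auto
        also have "\<dots> \<le> (K + 1) * \<bar>u - y\<bar>" by (intro mult_right_mono) auto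
        also have "\<dots> < e" using y K by (simp add: field_simps)
        finally show "norm (gs n u - gs n y) < e" .
      qed
    qed (use that in auto)
    have lim: "(\<lambda>n. gs (\<sigma> n) u) \<longlonglongrightarrow> g u" if "u \<in> {0..1}" for u
      unfolding LIMSEQ_iff using g(2) that by blast
    have z01: "(0::real) \<in> {0..1}" "(1::real) \<in> {0..1}" by auto
    have "(\<lambda>n. snd c (xs (\<sigma> n + N))) \<longlonglongrightarrow> snd c x" "(\<lambda>n. snd c (ys (\<sigma> n + N))) \<longlonglongrightarrow> snd c y"
      using LIMSEQ_subseq_LIMSEQ[OF LIMSEQ_ignore_initial_segment[OF lims(1), of N] g(1)]
        LIMSEQ_subseq_LIMSEQ[OF LIMSEQ_ignore_initial_segment[OF lims(2), of N] g(1)]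
      by (simp_all add: o_def)
    then have g01: "g 0 = snd c x" "g 1 = snd c y"
      using LIMSEQ_unique[OF lim[OF z01(1)]] LIMSEQ_unique[OF lim[OF z01(2)]] by (simp_all add: gs)
    then have gne: "g 0 \<noteq> g 1" using ne by simp
    have "fd (\<lambda>u. cinv c (g u)) {0..1}"
      by (rule normal_curve_limit(1)[OF gs(1) lim gne])
    moreover have "(\<lambda>u. cinv c (g u)) ` {0..1} \<subseteq> closed_box c z r"
      using cinv_closed_box[OF normal_curve_limit(2)[OF gs(1) lim gne]] by blast
    moreover have "cinv c (g 0) = x" "cinv c (g 1) = y" using g01 cinv_chart[OF c] xyc by simp_all
    ultimately show ?thesis
      unfolding box_causal_def using xy zero_less_one by blast
  qed
qed

lemma box_exit:
  assumes fd: "fd lam I" and a: "a \<in> I" "lam a \<in> open_box c z r" and b: "b \<in> I" "a \<le> b" "lam b \<notin> open_box c z r"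
  obtains t where "a < t" "t \<le> b" "t \<in> I" "lam t \<in> closed_box c z r - open_box c z r"
    "box_causal c z r (lam a) (lam t)"
proof -
  have sub: "{a..b} \<subseteq> I"
    using fd_interval[OF fd] mem_is_interval_1_I[of I a b] a b unfolding param_interval_def
    by (meson atLeastAtMost_iff subsetI)
  have cont: "continuous_on {a..b} lam" using fd_continuous[OF fd] sub by (rule continuous_on_subset)
  \<comment> \<open>Its least element is the first exit: before it the curve is in the open box, and
    at it in the closed box by continuity.\<close>
  define T where "T = {t \<in> {a..b}. lam t \<notin> open_box c z r}"
  have "closed T"
  proof -
    have "T = {a..b} \<inter> lam -` (- open_box c z r)" by (auto simp: T_def)
    moreover have "closed (- open_box c z r)" using open_open_box by blast
    ultimately show ?thesis using continuous_closed_preimage[OF cont] by simp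
  qed
  moreover have "T \<subseteq> {a..b}" by (auto simp: T_def)
  ultimately have "compact T" using compact_Icc closed_Int_compact by (metis inf.absorb1)
  moreover have "b \<in> T" using b by (simp add: T_def)
  ultimately obtain t where t: "t \<in> T" "\<And>s. s \<in> T \<Longrightarrow> t \<le> s" using compact_attains_inf[of T] by blast
  have tab: "t \<in> {a..b}" "lam t \<notin> open_box c z r" using t(1) by (auto simp: T_def)
  have before: "lam s \<in> open_box c z r" if "a \<le> s" "s < t" for s
    using t(2)[of s] that tab by (force simp: T_def)
  have at: "a < t" using tab a(2) by (cases "a = t") auto
  have oc: "open_box c z r \<subseteq> closed_box c z r" by (auto simp: open_box_def closed_box_def)
  have "lam t \<in> closed_box c z r"
  proof (rule Lim_in_closed_set)
    show "closed (closed_box c z r)" using compact_closed_box[of r] by (simp add: compact_imp_closed)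
    show "(lam \<longlongrightarrow> lam t) (at t within {a..t})"
      using continuous_on_subset[OF cont, of "{a..t}"] tab(1) unfolding continuous_on_def by auto
    show "eventually (\<lambda>s. lam s \<in> closed_box c z r) (at t within {a..t})"
      unfolding eventually_at_filter using before oc by (intro always_eventually) (auto simp: less_le)
    show "\<not> trivial_limit (at t within {a..t})"
      using at by (simp add: trivial_limit_within islimpt_Icc)
  qed
  moreover have "lam ` {a..t} \<subseteq> closed_box c z r"
  proof
    fix q assume "q \<in> lam ` {a..t}"
    then obtain s where "s \<in> {a..t}" "q = lam s" by blast
    then show "q \<in> closed_box c z r"
      using before[of s] oc \<open>lam t \<in> closed_box c z r\<close> by (cases "s = t") auto
  qed
  moreover have "fd lam {a..t}"
  proof (rule fd_subset[OF fd])
    show "{a..t} \<subseteq> I" using sub tab(1) by auto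
    show "param_interval {a..t}" unfolding param_interval_def using at
      by (intro conjI is_interval_cc bexI[where x = a] bexI[where x = t]) auto
  qed
  ultimately have "box_causal c z r (lam a) (lam t)"
    unfolding box_causal_def using at a(2) oc by blast
  moreover have "t \<in> I" using sub tab(1) by blast
  ultimately show ?thesis using that[of t] at tab \<open>lam t \<in> closed_box c z r\<close> by simp
qed

end

text \<open>The curve is the straight segment rising to \<open>p\<close> in direction
  \<open>X c p\<close>. From its point at parameter \<open>- d\<close> all directions within
  \<open>k\<close> of \<open>X c p\<close> are causal, and in time \<open>d\<close> they sweep out
  the ball of radius \<open>d * k\<close> around \<open>p\<close>, cut off at the size of the
  box.\<close>

lemma (in lorentzian_spacetime) past_neighbourhoods:
  obtains lam e where "e > 0" "fd lam {-e..0}" "lam 0 = p"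
    "\<And>t. t \<in> {-e..<0} \<Longrightarrow> \<exists>W. open W \<and> p \<in> W \<and> (\<forall>y\<in>W. cc (lam t) y)"
proof -
  obtain c where c: "c \<in> A" "p \<in> fst c" using chart_cover by blast
  obtain r w k where "causal_box c (snd c p) r w k (X c p)"
    using causal_box_exists[OF c] by blast
  then interpret B: lorentzian_box A G X c "snd c p" r w k "X c p"
    by unfold_locales
  let ?z = "snd c p" and ?x = "X c p"
  define e where "e = r / norm ?x"
  have e: "e > 0" using B.r B.x0_nonzero by (simp add: e_def)
  have inb: "?z + t *\<^sub>R ?x \<in> cball ?z r" if "t \<in> {-e..0}" for t
  proof -
    have "\<bar>t\<bar> * norm ?x \<le> e * norm ?x" using that by (intro mult_right_mono) auto
    also have "\<dots> = r" using B.x0_nonzero by (simp add: e_def)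
    finally show ?thesis by (simp add: dist_norm)
  qed
  define lam where "lam t = cinv c (?z + t *\<^sub>R ?x)" for t
  show ?thesis
  proof (rule that[OF e])
    show "fd lam {-e..0}"
      unfolding lam_def using B.fd_straight[of "-e" 0 ?z ?x] e inb B.k by simp
    show "lam 0 = p" using c by (simp add: lam_def)
    fix t assume t: "t \<in> {-e..<0}"
    define d where "d = - t"
    have d: "d > 0" using t by (simp add: d_def)
    define W where "W = open_box c ?z (min (d * k) r)"
    have "open W" unfolding W_def by (rule B.open_open_box)
    moreover have "p \<in> W" using c d B.k B.r by (simp add: W_def open_box_def)
    moreover have "cc (lam t) y" if y: "y \<in> W" for y
    proof -
      have yc: "y \<in> fst c" "dist ?z (snd c y) < d * k" "dist ?z (snd c y) < r" using y by (auto simp: W_def open_box_def)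
      define v where "v = (snd c y - (?z - d *\<^sub>R ?x)) /\<^sub>R d"
      have "v - ?x = (snd c y - ?z) /\<^sub>R d" using d by (simp add: v_def scaleR_add_right scaleR_diff_right)
      then have "norm (v - ?x) = dist ?z (snd c y) / d"
        using d by (simp add: dist_norm norm_minus_commute divide_inverse mult.commute)
      then have v: "norm (v - ?x) < k" using yc(2) d by (simp add: pos_divide_less_eq mult.commute)
      have st: "?z - d *\<^sub>R ?x \<in> cball ?z r" using inb[of t] t by (simp add: d_def)
      have en: "(?z - d *\<^sub>R ?x) + d *\<^sub>R v = snd c y" using d by (simp add: v_def)
      have "fd (\<lambda>s. cinv c ((?z - d *\<^sub>R ?x) + s *\<^sub>R v)) {0..d}"
        using B.straight_box_causal(1)[OF st _ d v] yc(3) en by simp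
      from ccI[OF this d] show ?thesis using en yc(1) c by (simp add: lam_def d_def)
    qed
    ultimately show "\<exists>W. open W \<and> p \<in> W \<and> (\<forall>y\<in>W. cc (lam t) y)" by blast
  qed
qed

section \<open>Countable box covers and inextendible chains\<close>

lemma no_endpoint_reflect:
  assumes "no_endpoint lam (upper_end I)"
  shows "no_endpoint (\<lambda>t. lam (- t)) (lower_end {t. - t \<in> I})"
proof -
  let ?I = "{t. - t \<in> I}"
  have img: "?I = uminus ` I" by (auto intro!: image_eqI[of _ uminus "- _"])
  have bdd: "bdd_below ?I \<longleftrightarrow> bdd_above I"
    unfolding img using bdd_above_uminus[of "uminus ` I"] by (simp add: image_image)
  have "lower_end ?I = filtermap uminus (upper_end I)"
  proof (cases "bdd_above I")
    case True
    have "Inf ?I = - Sup I" unfolding img Inf_real_def by (simp add: image_image)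
    then show ?thesis using True bdd by (simp add: lower_end_def upper_end_def at_right_minus)
  next
    case False
    then show ?thesis using bdd by (simp add: lower_end_def upper_end_def at_bot_mirror)
  qed
  then show ?thesis using assms by (simp add: no_endpoint_def filterlim_filtermap)
qed

context lorentzian_spacetime
begin

definition box_cover :: "(nat \<Rightarrow> ('m, 'n) chart \<times> (real ^ 'n) \<times> real) \<Rightarrow> bool" where
  "box_cover b \<longleftrightarrow> (\<forall>j. \<exists>w k x. causal_box (fst (b j)) (fst (snd (b j))) (snd (snd (b j))) w k x) \<and>
     (\<Union>j. open_box (fst (b j)) (fst (snd (b j))) (snd (snd (b j)) / 2)) = UNIV"

text \<open>Second countability enters through Lindelof's theorem; the countable indexing is what
  later permits a least index.\<close>

lemma box_cover_exists: "\<exists>b. box_cover b"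
proof -
  define F where "F = {V. \<exists>c z r w k x. causal_box c z r w k x \<and> V = open_box c z (r / 2)}"
  have op: "open V" if "V \<in> F" for V
  proof -
    obtain c z r w k x where b: "causal_box c z r w k x" "V = open_box c z (r / 2)"
      using \<open>V \<in> F\<close> unfolding F_def by blast
    then interpret lorentzian_box A G X c z r w k x by unfold_locales
    show ?thesis unfolding b(2) by (rule open_open_box)
  qed
  have cov: "\<Union>F = UNIV"
  proof -
    have "p \<in> \<Union>F" for p
    proof -
      obtain c where c: "c \<in> A" "p \<in> fst c" using chart_cover by blast
      obtain r w k where b: "causal_box c (snd c p) r w k (X c p)" using causal_box_exists[OF c] by blast
      then have "r > 0" by (simp add: causal_box_def)
      then have "p \<in> open_box c (snd c p) (r / 2)" using c by (simp add: open_box_def)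
      then show ?thesis using b unfolding F_def by blast
    qed
    then show ?thesis by blast
  qed
  obtain F' where F': "F' \<subseteq> F" "countable F'" "\<Union>F' = \<Union>F" using Lindelof[OF op] by blast
  have ne: "F' \<noteq> {}" using F'(3) cov by auto
  have "\<exists>t. (\<exists>w k x. causal_box (fst t) (fst (snd t)) (snd (snd t)) w k x) \<and>
      from_nat_into F' j = open_box (fst t) (fst (snd t)) (snd (snd t) / 2)" for j
  proof -
    have "from_nat_into F' j \<in> F" using from_nat_into[OF ne] F'(1) by blast
    then obtain c z r w k x where "causal_box c z r w k x" "from_nat_into F' j = open_box c z (r / 2)"
      unfolding F_def by blast
    then show ?thesis by (intro exI[of _ "(c, z, r)"]) auto
  qed
  then have "\<forall>j. \<exists>t. (\<exists>w k x. causal_box (fst t) (fst (snd t)) (snd (snd t)) w k x) \<and>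
      from_nat_into F' j = open_box (fst t) (fst (snd t)) (snd (snd t) / 2)" ..
  from choice[OF this] obtain b where b: "\<forall>j. (\<exists>w k x. causal_box (fst (b j)) (fst (snd (b j))) (snd (snd (b j))) w k x) \<and>
      from_nat_into F' j = open_box (fst (b j)) (fst (snd (b j))) (snd (snd (b j)) / 2)" ..
  have "(\<Union>j. from_nat_into F' j) = UNIV"
    using range_from_nat_into[OF ne F'(2)] F'(3) cov by simp
  then have "box_cover b" unfolding box_cover_def using b by simp
  then show ?thesis by blast
qed

definition cover_box :: "nat \<Rightarrow> ('m, 'n) chart \<times> (real ^ 'n) \<times> real" where
  "cover_box = (SOME b. box_cover b)"

abbreviation bc :: "nat \<Rightarrow> ('m, 'n) chart" where "bc j \<equiv> fst (cover_box j)"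
abbreviation bz :: "nat \<Rightarrow> real ^ 'n" where "bz j \<equiv> fst (snd (cover_box j))"
abbreviation br :: "nat \<Rightarrow> real" where "br j \<equiv> snd (snd (cover_box j))"

text \<open>Four nested versions: points of \<open>inner_box\<close> have their limits in the closed
  \<open>mid_box\<close>, which still lies inside the open \<open>outer_box\<close>;
  \<open>full_box\<close> supplies compactness.\<close>

definition inner_box where "inner_box j = open_box (bc j) (bz j) (br j / 2)"
definition mid_box where "mid_box j = closed_box (bc j) (bz j) (br j / 2)"
definition outer_box where "outer_box j = open_box (bc j) (bz j) (br j)"
definition full_box where "full_box j = closed_box (bc j) (bz j) (br j)"
definition bcausal where "bcausal j = box_causal (bc j) (bz j) (br j)"

lemma box_cover_cover_box: "box_cover cover_box"
  unfolding cover_box_def using box_cover_exists by (rule someI_ex)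

lemma cover_box_causal: obtains w k x where "lorentzian_box A G X (bc j) (bz j) (br j) w k x"
proof -
  obtain w k x where "causal_box (bc j) (bz j) (br j) w k x"
    using box_cover_cover_box unfolding box_cover_def by blast
  then have "lorentzian_box A G X (bc j) (bz j) (br j) w k x"
    by unfold_locales
  then show ?thesis by (rule that)
qed

lemma inner_box_cover: "\<exists>j. p \<in> inner_box j"
  using box_cover_cover_box unfolding box_cover_def inner_box_def by blast

lemma box_subsets: "inner_box j \<subseteq> mid_box j" "mid_box j \<subseteq> outer_box j" "outer_box j \<subseteq> full_box j"
proof -
  obtain w k x where "lorentzian_box A G X (bc j) (bz j) (br j) w k x" by (rule cover_box_causal)
  then interpret lorentzian_box A G X "bc j" "bz j" "br j" w k x .
  show "inner_box j \<subseteq> mid_box j" "mid_box j \<subseteq> outer_box j" "outer_box j \<subseteq> full_box j"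
    using r by (auto simp: inner_box_def mid_box_def outer_box_def full_box_def open_box_def closed_box_def)
qed

lemma open_inner_box: "open (inner_box j)" and open_outer_box: "open (outer_box j)"
  and compact_full_box: "compact (full_box j)" and closed_mid_box: "closed (mid_box j)"
proof -
  obtain w k x where "lorentzian_box A G X (bc j) (bz j) (br j) w k x" by (rule cover_box_causal)
  then interpret lorentzian_box A G X "bc j" "bz j" "br j" w k x .
  show "open (inner_box j)" "open (outer_box j)"
    unfolding inner_box_def outer_box_def by (rule open_open_box)+
  show "compact (full_box j)" unfolding full_box_def by (rule compact_closed_box) simp
  show "closed (mid_box j)" unfolding mid_box_def using r by (intro compact_imp_closed compact_closed_box) simp
qed

lemma bcausal_imp_J: "bcausal j x y \<Longrightarrow> J x y"
  unfolding bcausal_def by (rule box_causal_imp_J)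

lemma bcausal_closed:
  assumes "\<And>n. bcausal j (xs n) (ys n)" "xs \<longlonglongrightarrow> x" "ys \<longlonglongrightarrow> y"
  shows "bcausal j x y"
proof -
  obtain w k x where "lorentzian_box A G X (bc j) (bz j) (br j) w k x" by (rule cover_box_causal)
  then interpret lorentzian_box A G X "bc j" "bz j" "br j" w k x .
  show ?thesis using assms unfolding bcausal_def by (rule box_causal_closed)
qed

lemma box_upward: 
  assumes "x \<in> outer_box j"
  shows "\<exists>y. y \<in> full_box j - outer_box j \<and> bcausal j x y"
proof -
  obtain w k x where "lorentzian_box A G X (bc j) (bz j) (br j) w k x" by (rule cover_box_causal)
  then interpret lorentzian_box A G X "bc j" "bz j" "br j" w k x .
  show ?thesis using assms upward_exit unfolding bcausal_def full_box_def outer_box_def by metis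
qed

lemma box_curve_exit:
  assumes "fd lam I" "a \<in> I" "lam a \<in> outer_box j" "b \<in> I" "a \<le> b" "lam b \<notin> outer_box j"
  shows "\<exists>t. a < t \<and> t \<le> b \<and> t \<in> I \<and> lam t \<in> full_box j - outer_box j \<and> bcausal j (lam a) (lam t)"
proof -
  obtain w k x where "lorentzian_box A G X (bc j) (bz j) (br j) w k x" by (rule cover_box_causal)
  then interpret lorentzian_box A G X "bc j" "bz j" "br j" w k x .
  show ?thesis
    using box_exit[OF assms(1,2) _ assms(4,5)] assms(3,6) unfolding bcausal_def full_box_def outer_box_def by metis
qed

text \<open>Otherwise \<open>trapped_imp_endpoint\<close> yields a past endpoint. As
  \<open>t0\<close> is arbitrary, the curve is outside each given box at arbitrarily early
  parameters.\<close>

lemma not_trapped: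
  assumes fd: "fd lam I" and ne: "no_endpoint lam (lower_end I)" and t0: "t0 \<in> I"
  shows "\<exists>t\<in>I. t < t0 \<and> lam t \<notin> full_box j"
proof (rule ccontr)
  assume neg: "\<not> ?thesis"
  obtain w k x where "lorentzian_box A G X (bc j) (bz j) (br j) w k x" by (rule cover_box_causal)
  then interpret lorentzian_box A G X "bc j" "bz j" "br j" w k x .
  obtain p where "(lam \<longlongrightarrow> p) (lower_end I)"
  proof (rule trapped_imp_endpoint[OF fd no_endpoint_no_min[OF fd ne] t0])
    show "lam t \<in> closed_box (bc j) (bz j) (br j)" if "t \<in> I" "t < t0" for t
      using neg that unfolding full_box_def by blast
  qed
  then show False using ne unfolding no_endpoint_def by blast
qed

text \<open>A connecting curve either stays in the box or is cut at its first exit; the rest of it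
  is remembered only as \<open>J q y\<close>.\<close>

lemma box_step:
  assumes x: "x \<in> outer_box j" and xy: "J x y"
  shows "bcausal j x y \<or> (\<exists>q. q \<in> full_box j - outer_box j \<and> bcausal j x q \<and> J q y)"
proof (cases "x = y")
  case True
  then show ?thesis using x box_subsets(3)[of j] unfolding bcausal_def box_causal_def full_box_def by blast
next
  case False
  then obtain lam a b where lam: "a < b" "fd lam {a..b}" "lam a = x" "lam b = y"
    using xy unfolding J_def cc_iff by blast
  show ?thesis
  proof (cases "\<forall>t\<in>{a..b}. lam t \<in> outer_box j")
    case True
    then have "lam ` {a..b} \<subseteq> full_box j" using box_subsets(3)[of j] by blast
    moreover have "x \<in> lam ` {a..b}" "y \<in> lam ` {a..b}" using lam by auto
    ultimately show ?thesis using lam unfolding bcausal_def box_causal_def full_box_def by blast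
  next
    case False
    then obtain b' where b': "b' \<in> {a..b}" "lam b' \<notin> outer_box j" by blast
    have "lam a \<in> outer_box j" using x lam by simp
    then obtain t where t: "a < t" "t \<le> b'" "t \<in> {a..b}" "lam t \<in> full_box j - outer_box j" "bcausal j (lam a) (lam t)"
      using box_curve_exit[OF lam(2) _ _ b'(1) _ b'(2)] b'(1) lam(1) by auto
    have "J (lam t) (lam b)"
    proof (cases "t = b")
      case False
      then have "cc (lam t) (lam b)" using t lam by (intro ccI_sub[OF lam(2)]) auto
      then show ?thesis by (rule cc_imp_J)
    qed simp
    then show ?thesis using t lam by auto
  qed
qed

section \<open>Crossing chains and future rays\<close>

definition idx :: "'m \<Rightarrow> nat" where
  "idx p = (LEAST j. p \<in> inner_box j)"

lemma idx_mem: "p \<in> inner_box (idx p)"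
  unfolding idx_def using inner_box_cover by (rule LeastI_ex)

lemma idx_le: "p \<in> inner_box m \<Longrightarrow> idx p \<le> m"
  unfolding idx_def by (rule Least_le)

definition crossing :: "'m \<Rightarrow> 'm \<Rightarrow> bool" where
  "crossing x y \<longleftrightarrow> bcausal (idx x) x y \<and> y \<in> full_box (idx x) - outer_box (idx x)"

lemma crossing_imp_cc: "crossing x y \<Longrightarrow> cc x y"
proof -
  assume c: "crossing x y"
  then have "J x y" unfolding crossing_def using bcausal_imp_J by blast
  moreover have "x \<in> outer_box (idx x)" using idx_mem box_subsets by blast
  then have "x \<noteq> y" using c unfolding crossing_def by blast
  ultimately show "cc x y" by (simp add: J_def)
qed

text \<open>Near a limit point only finitely many indices can be least, so one box would be crossed from its
  inner part to its boundary infinitely often.\<close>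
lemma crossing_chain_not_convergent:
  assumes ch: "\<And>i. crossing (e i) (e (Suc i))"
  shows "\<not> e \<longlonglongrightarrow> p"
proof
  assume lim: "e \<longlonglongrightarrow> p"
  have "eventually (\<lambda>i. e i \<in> inner_box (idx p)) sequentially"
    using topological_tendstoD[OF lim open_inner_box idx_mem] .
  then have bd: "eventually (\<lambda>i. idx (e i) \<le> idx p) sequentially"
    by eventually_elim (rule idx_le)
  have "\<exists>j\<le>idx p. frequently (\<lambda>i. idx (e i) = j) sequentially"
  proof (rule ccontr)
    assume "\<not> ?thesis"
    then have "\<forall>j\<in>{..idx p}. eventually (\<lambda>i. idx (e i) \<noteq> j) sequentially"
      by (simp add: frequently_def)
    then have "eventually (\<lambda>i. \<forall>j\<in>{..idx p}. idx (e i) \<noteq> j) sequentially"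
      by (intro eventually_ball_finite) auto
    with bd have "eventually (\<lambda>i::nat. False) sequentially"
      by eventually_elim auto
    then show False by simp
  qed
  then obtain j where fr: "frequently (\<lambda>i. idx (e i) = j) sequentially" by blast
  have "p \<in> mid_box j"
  proof (rule ccontr)
    assume "p \<notin> mid_box j"
    then have "eventually (\<lambda>i. e i \<in> - mid_box j) sequentially"
      using closed_mid_box by (intro topological_tendstoD[OF lim]) auto
    then have "eventually (\<lambda>i. idx (e i) \<noteq> j) sequentially"
      by eventually_elim (use idx_mem box_subsets(1) in blast)
    then show False using fr by (simp add: frequently_def)
  qed
  then have "p \<in> outer_box j" using box_subsets(2) by blast
  then have "eventually (\<lambda>i. e (Suc i) \<in> outer_box j) sequentially"
    using open_outer_box by (intro topological_tendstoD[OF LIMSEQ_Suc[OF lim]]) auto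
  then have "eventually (\<lambda>i. idx (e i) \<noteq> j) sequentially"
    by eventually_elim (use ch in \<open>auto simp: crossing_def\<close>)
  then show False using fr by (simp add: frequently_def)
qed

text \<open>A discrete substitute for a future inextendible curve: if the nodes do not converge,
  neither does a curve running through them.\<close>

definition future_ray :: "(nat \<Rightarrow> 'm) \<Rightarrow> bool" where
  "future_ray e \<longleftrightarrow> (\<forall>i. cc (e i) (e (Suc i))) \<and> (\<forall>p. \<not> e \<longlonglongrightarrow> p)"

text \<open>Dependent choice: a property that survives some crossing from each point is carried
  along a ray. It serves for plain extension, for limits of causally related points, and for the
  limit set of a curve.\<close>

lemma future_ray_induct:
  assumes start: "P p" and step: "\<And>x. P x \<Longrightarrow> \<exists>y. crossing x y \<and> P y"
  obtains e where "future_ray e" "e 0 = p" "\<And>i. P (e i)"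
proof -
  have "\<exists>f. \<forall>n. (P (f n) \<and> (n = 0 \<longrightarrow> f n = p)) \<and> crossing (f n) (f (Suc n))"
  proof (rule dependent_nat_choice)
    show "\<exists>x. P x \<and> ((0::nat) = 0 \<longrightarrow> x = p)" using start by blast
    show "\<exists>y. (P y \<and> (Suc n = 0 \<longrightarrow> y = p)) \<and> crossing x y" if "P x \<and> (n = 0 \<longrightarrow> x = p)" for x n
      using step[of x] that by blast
  qed
  then obtain e where e: "\<forall>n. (P (e n) \<and> (n = 0 \<longrightarrow> e n = p)) \<and> crossing (e n) (e (Suc n))" ..
  then have "\<And>i. crossing (e i) (e (Suc i))" by blast
  then have "future_ray e"
    unfolding future_ray_def using crossing_imp_cc crossing_chain_not_convergent by blast
  then show ?thesis using that e by blast
qed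

lemma future_ray_curve:
  assumes "future_ray e"
  obtains lam where "fd lam {0..}" "\<And>i. lam (real i) = e i" "no_endpoint lam at_top"
proof -
  have "\<And>i. cc (e i) (e (Suc i))" using assms unfolding future_ray_def by blast
  then obtain lam where lam: "fd lam {0..}" "\<And>i. lam (real i) = e i" using concat_curves by blast
  have "no_endpoint lam at_top"
    unfolding no_endpoint_def
  proof
    assume "\<exists>p. (lam \<longlongrightarrow> p) at_top"
    then obtain p where "(lam \<longlongrightarrow> p) at_top" ..
    then have "(\<lambda>i. lam (real i)) \<longlonglongrightarrow> p"
      using filterlim_compose filterlim_real_sequentially by blast
    then have "e \<longlonglongrightarrow> p" using lam(2) by simp
    then show False using assms unfolding future_ray_def by blast
  qed
  then show ?thesis using that lam by blast
qed

lemma future_curve_exists: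
  obtains lam where "fd lam {0..}" "lam 0 = p" "no_endpoint lam at_top"
proof -
  have "\<exists>y. crossing x y \<and> True" for x
  proof -
    have "x \<in> outer_box (idx x)" using idx_mem box_subsets by blast
    from box_upward[OF this] show ?thesis unfolding crossing_def by blast
  qed
  then obtain e where e: "future_ray e" "e 0 = p" using future_ray_induct[of "\<lambda>_. True" p] by blast
  obtain lam where lam: "fd lam {0..}" "\<And>i. lam (real i) = e i" "no_endpoint lam at_top"
    using future_ray_curve[OF e(1)] by blast
  then show ?thesis using that[of lam] lam(2)[of 0] e(2) by simp
qed

lemma past_curve_exists:
  obtains lam where "fd lam {..0}" "lam 0 = p" "no_endpoint lam at_bot"
proof -
  interpret D: lorentzian_spacetime A G "\<lambda>c p. - X c p" by (rule dual)
  obtain mu where mu: "D.fd mu {0..}" "mu 0 = p" "no_endpoint mu at_top" by (rule D.future_curve_exists)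
  have "{t. - t \<in> {0..}} = {..0::real}" by auto
  then have "fd (\<lambda>t. mu (- t)) {..0}" using D.fd_reverse[OF mu(1)] by simp
  moreover have "no_endpoint (\<lambda>t. mu (- t)) at_bot"
    using mu(3) by (simp add: no_endpoint_def at_bot_mirror filterlim_filtermap)
  ultimately show ?thesis using that[of "\<lambda>t. mu (- t)"] mu(2) by simp
qed

section \<open>Time duality of the causal relation\<close>

lemma dual_cc: "lorentzian_spacetime.cc A G (\<lambda>c p. - X c p) p q \<longleftrightarrow> cc q p"
proof -
  interpret D: lorentzian_spacetime A G "\<lambda>c p. - X c p" by (rule dual)
  have refl: "{t. - t \<in> {0..1}} = {-1..0::real}" by auto
  show ?thesis
  proof
    assume "D.cc p q"
    then obtain lam where "D.fd lam {0..1}" "lam 0 = p" "lam 1 = q" unfolding D.cc_def by blast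
    then have "fd (\<lambda>t. lam (- t)) {-1..0}" using D.fd_reverse[of lam "{0..1}"] refl by simp
    from ccI[OF this] show "cc q p" using \<open>lam 0 = p\<close> \<open>lam 1 = q\<close> by simp
  next
    assume "cc q p"
    then obtain lam where "fd lam {0..1}" "lam 0 = q" "lam 1 = p" unfolding cc_def by blast
    then have "D.fd (\<lambda>t. lam (- t)) {-1..0}" using fd_reverse[of lam "{0..1}"] refl by simp
    from D.ccI[OF this] show "D.cc p q" using \<open>lam 0 = q\<close> \<open>lam 1 = p\<close> by simp
  qed
qed

lemma dual_J: "lorentzian_spacetime.J A G (\<lambda>c p. - X c p) p q \<longleftrightarrow> J q p"
proof -
  interpret D: lorentzian_spacetime A G "\<lambda>c p. - X c p" by (rule dual)
  show ?thesis unfolding J_def D.J_def dual_cc by auto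
qed

lemma pd_iff_dual_fd: "pd_causal_curve A G X lam I \<longleftrightarrow> fd_causal_curve A G (\<lambda>c p. - X c p) lam I"
  unfolding pd_causal_curve_def fd_causal_curve_def past_causal_vec_def future_causal_vec_def by simp

end

section \<open>Spacetimes with a Cauchy hypersurface\<close>

lemma no_endpoint_shift:
  fixes h :: "real \<Rightarrow> 'a::topological_space"
  assumes h: "no_endpoint h at_top" and f: "\<And>t. b < t \<Longrightarrow> f t = h (t - b)"
  shows "no_endpoint f at_top"
  unfolding no_endpoint_def
proof
  assume "\<exists>p. (f \<longlongrightarrow> p) at_top"
  then obtain p where p: "(f \<longlongrightarrow> p) at_top" ..
  have "eventually (\<lambda>t. f t = h (t - b)) at_top"
    using eventually_gt_at_top[of b] by eventually_elim (rule f)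
  then have "((\<lambda>t. h (t - b)) \<longlongrightarrow> p) at_top" by (rule Lim_transform_eventually[OF p])
  moreover have "filterlim (\<lambda>s::real. s + b) at_top at_top"
    unfolding filterlim_at_top
  proof
    fix Z :: real
    show "eventually (\<lambda>s. Z \<le> s + b) at_top"
      using eventually_ge_at_top[of "Z - b"] by eventually_elim simp
  qed
  ultimately have "((\<lambda>s. h (s + b - b)) \<longlongrightarrow> p) at_top" by (rule filterlim_compose)
  then show False using h unfolding no_endpoint_def by auto
qed

locale cauchy_spacetime = lorentzian_spacetime A G X
  for A :: "('m::{t2_space, second_countable_topology}, 'n::finite) chart set"
    and G :: "('m, 'n) chart \<Rightarrow> 'm \<Rightarrow> real ^ 'n ^ 'n"
    and X :: "('m, 'n) chart \<Rightarrow> 'm \<Rightarrow> real ^ 'n" +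
  fixes S :: "'m set"
  assumes cauchy: "cauchy_hypersurface A G X S"
begin

text \<open>The defining condition refers to causal curves of both orientations, and reversing
  \<open>X\<close> only swaps the two kinds.\<close>

lemma dual_cauchy: "cauchy_spacetime A G (\<lambda>c p. - X c p) S"
proof -
  interpret D: lorentzian_spacetime A G "\<lambda>c p. - X c p" by (rule dual)
  have "inextendible_causal A G (\<lambda>c p. - X c p) lam I \<longleftrightarrow> inextendible_causal A G X lam I" for lam I
    unfolding inextendible_causal_def causal_curve_def pd_iff_dual_fd D.pd_iff_dual_fd by auto
  then have "cauchy_hypersurface A G (\<lambda>c p. - X c p) S"
    using cauchy unfolding cauchy_hypersurface_def by blast
  then show ?thesis by unfold_locales
qed

lemma complete_curve_hits:
  assumes "fd lam UNIV" "no_endpoint lam at_top" "no_endpoint lam at_bot"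
  shows "\<exists>!t. lam t \<in> S"
proof -
  have "\<not> bdd_above (UNIV :: real set)"
    unfolding bdd_above_def by (meson UNIV_I gt_ex not_le)
  moreover have "\<not> bdd_below (UNIV :: real set)"
    unfolding bdd_below_def by (meson UNIV_I lt_ex not_le)
  ultimately have "upper_end (UNIV :: real set) = at_top" "lower_end (UNIV :: real set) = at_bot"
    by (simp_all add: upper_end_def lower_end_def)
  then have "inextendible_causal A G X lam UNIV"
    using assms unfolding inextendible_causal_def causal_curve_def by simp
  then have "\<exists>!t. t \<in> UNIV \<and> lam t \<in> S" using cauchy unfolding cauchy_hypersurface_def by blast
  then show ?thesis by simp
qed

section \<open>Inextendible extensions and their meeting points with the hypersurface\<close>

lemma extend_past:
  assumes f: "fd f {a..}" "no_endpoint f at_top"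
  obtains lam where "fd lam UNIV" "no_endpoint lam at_top" "no_endpoint lam at_bot" "\<And>t. a \<le> t \<Longrightarrow> lam t = f t"
proof -
  obtain g where g: "fd g {..0}" "g 0 = f a" "no_endpoint g at_bot" by (rule past_curve_exists)
  have "{t. 1 * t + - a \<in> {..0}} = {..a}" by auto
  then have g': "fd (\<lambda>t. g (t - a)) {..a}" using fd_affine[OF g(1), of 1 "- a"] by simp
  define lam where "lam t = (if t \<le> a then g (t - a) else f t)" for t
  have lf: "lam t = f t" if "a \<le> t" for t using that g(2) by (cases "t = a") (auto simp: lam_def)
  have "fd lam ({..a} \<union> {a..})"
    unfolding lam_def by (rule fd_join[OF g' _ _ f(1)]) (use g(2) in auto)
  moreover have "{..a} \<union> {a..} = (UNIV :: real set)" by auto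
  ultimately have "fd lam UNIV" by simp
  moreover have "no_endpoint lam at_top"
    unfolding no_endpoint_def
  proof
    assume "\<exists>p. (lam \<longlongrightarrow> p) at_top"
    then obtain p where p: "(lam \<longlongrightarrow> p) at_top" ..
    have "eventually (\<lambda>t. lam t = f t) at_top"
      using eventually_ge_at_top[of a] by eventually_elim (rule lf)
    then have "(f \<longlongrightarrow> p) at_top" by (rule Lim_transform_eventually[OF p])
    then show False using f(2) unfolding no_endpoint_def by blast
  qed
  moreover have "no_endpoint lam at_bot"
    unfolding no_endpoint_def
  proof
    assume "\<exists>p. (lam \<longlongrightarrow> p) at_bot"
    then obtain p where p: "(lam \<longlongrightarrow> p) at_bot" ..
    have "eventually (\<lambda>t. lam t = g (t - a)) at_bot"
      using eventually_le_at_bot[of a] by eventually_elim (simp add: lam_def)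
    then have "((\<lambda>t. g (t - a)) \<longlongrightarrow> p) at_bot" by (rule Lim_transform_eventually[OF p])
    moreover have "filterlim (\<lambda>s::real. s + a) at_bot at_bot"
      unfolding filterlim_at_bot
    proof
      fix Z :: real
      show "eventually (\<lambda>s. s + a \<le> Z) at_bot"
        using eventually_le_at_bot[of "Z - a"] by eventually_elim simp
    qed
    ultimately have "((\<lambda>s. g (s + a - a)) \<longlongrightarrow> p) at_bot" by (rule filterlim_compose)
    then show False using g(3) unfolding no_endpoint_def by auto
  qed
  ultimately show ?thesis using that lf by blast
qed

lemma extend_segment:
  assumes g: "fd g {a..b}" "a < b"
  obtains lam where "fd lam UNIV" "no_endpoint lam at_top" "no_endpoint lam at_bot" "\<And>t. t \<in> {a..b} \<Longrightarrow> lam t = g t"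
proof -
  obtain h where h: "fd h {0..}" "h 0 = g b" "no_endpoint h at_top" by (rule future_curve_exists)
  have "{t. 1 * t + - b \<in> {0..}} = {b..}" by auto
  then have h': "fd (\<lambda>t. h (t - b)) {b..}" using fd_affine[OF h(1), of 1 "- b"] by simp
  define f where "f t = (if t \<le> b then g t else h (t - b))" for t
  have "fd f ({a..b} \<union> {b..})"
    unfolding f_def by (rule fd_join[OF g(1) _ _ h']) (use g(2) h(2) in auto)
  moreover have "{a..b} \<union> {b..} = {a..}" using g(2) by auto
  ultimately have fd: "fd f {a..}" by simp
  have ne: "no_endpoint f at_top"
    by (rule no_endpoint_shift[OF h(3), of b]) (simp add: f_def)
  obtain lam where lam: "fd lam UNIV" "no_endpoint lam at_top" "no_endpoint lam at_bot" "\<And>t. a \<le> t \<Longrightarrow> lam t = f t"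
    using extend_past[OF fd ne] by blast
  have "lam t = g t" if "t \<in> {a..b}" for t using lam(4)[of t] that by (simp add: f_def)
  then show ?thesis using that lam by blast
qed

lemma acausal: "s \<in> S \<Longrightarrow> s' \<in> S \<Longrightarrow> \<not> cc s s'"
proof
  assume s: "s \<in> S" "s' \<in> S" "cc s s'"
  then obtain g where g: "fd g {0..1}" "g 0 = s" "g 1 = s'" unfolding cc_def by blast
  obtain lam where lam: "fd lam UNIV" "no_endpoint lam at_top" "no_endpoint lam at_bot" "\<And>t. t \<in> {0..1} \<Longrightarrow> lam t = g t"
    using extend_segment[OF g(1)] by auto
  have "lam 0 \<in> S" "lam 1 \<in> S" using lam(4)[of 0] lam(4)[of 1] g s by auto
  then have "(0::real) = 1" using complete_curve_hits[OF lam(1-3)] by blast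
  then show False by simp
qed

text \<open>The inextendible extension meets \<open>S\<close> before, on or after the segment; the
  first and last case are recorded as causal relations with its ends.\<close>

lemma segment_hits:
  assumes g: "fd g {a..b}" "a < b"
  obtains s where "s \<in> S" "s \<in> g ` {a..b} \<or> cc (g b) s \<or> cc s (g a)"
proof -
  obtain lam where lam: "fd lam UNIV" "no_endpoint lam at_top" "no_endpoint lam at_bot" "\<And>t. t \<in> {a..b} \<Longrightarrow> lam t = g t"
    using extend_segment[OF g] by blast
  obtain t where t: "lam t \<in> S" using complete_curve_hits[OF lam(1-3)] by blast
  have ab: "lam a = g a" "lam b = g b" using lam(4) g(2) by auto
  consider "t < a" | "t > b" | "t \<in> {a..b}" by fastforce
  then have "lam t \<in> g ` {a..b} \<or> cc (g b) (lam t) \<or> cc (lam t) (g a)"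
  proof cases
    case 1
    then show ?thesis using ccI_sub[OF lam(1), of t a] ab by simp
  next
    case 2
    then show ?thesis using ccI_sub[OF lam(1), of b t] ab by simp
  next
    case 3
    then show ?thesis using lam(4)[of t] by simp
  qed
  then show ?thesis using that t by blast
qed

section \<open>Strict future and past of the hypersurface\<close>

definition Up :: "'m set" where "Up = {y. \<exists>s\<in>S. cc s y}"
definition Dn :: "'m set" where "Dn = {y. \<exists>s\<in>S. cc y s}"

lemma Up_J: "x \<in> Up \<Longrightarrow> J x y \<Longrightarrow> y \<in> Up"
  unfolding Up_def using cc_J by blast

lemma Up_not_before: "x \<in> Up \<Longrightarrow> s \<in> S \<Longrightarrow> \<not> J x s"
  unfolding Up_def using cc_J acausal by blast

lemma Up_Dn_S: "x \<in> Up \<Longrightarrow> x \<notin> Dn" "x \<in> Up \<Longrightarrow> x \<notin> S" "x \<in> Dn \<Longrightarrow> x \<notin> S"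
  unfolding Up_def Dn_def using cc_trans acausal by blast+

text \<open>The ray is first extended to the past, so that the Cauchy property applies; all nodes
  after the meeting point lie in its strict future.\<close>

lemma future_ray_Up:
  assumes "future_ray e"
  shows "\<exists>i. e i \<in> Up"
proof -
  obtain f where f: "fd f {0..}" "\<And>i. f (real i) = e i" "no_endpoint f at_top"
    using future_ray_curve[OF assms] by blast
  obtain lam where lam: "fd lam UNIV" "no_endpoint lam at_top" "no_endpoint lam at_bot" "\<And>t. 0 \<le> t \<Longrightarrow> lam t = f t"
    using extend_past[OF f(1,3)] by blast
  obtain t where t: "lam t \<in> S" using complete_curve_hits[OF lam(1-3)] by blast
  obtain i where i: "t < real i" using reals_Archimedean2 by blast
  have "cc (lam t) (lam (real i))" using ccI_sub[OF lam(1)] i by blast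
  moreover have "lam (real i) = e i" using lam(4)[of "real i"] f(2) by simp
  ultimately show ?thesis unfolding Up_def using t by auto
qed

lemma open_Up: "open Up"
proof (subst open_subopen, intro ballI)
  fix p assume p: "p \<in> Up"
  obtain e lam where lam: "e > 0" "fd lam {-e..0}" "lam 0 = p"
    "\<And>t. t \<in> {-e..<0} \<Longrightarrow> \<exists>W. open W \<and> p \<in> W \<and> (\<forall>y\<in>W. cc (lam t) y)"
  proof (rule past_neighbourhoods[of p])
    fix lam and e :: real
    assume a: "e > 0" "fd lam {-e..0}" "lam 0 = p"
      "\<And>t. t \<in> {-e..<0} \<Longrightarrow> \<exists>W. open W \<and> p \<in> W \<and> (\<forall>y\<in>W. cc (lam t) y)"
    show thesis by (rule that[OF a])
  qed
  obtain s where s: "s \<in> S" "s \<in> lam ` {-e..0} \<or> cc (lam 0) s \<or> cc s (lam (-e))"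
    using segment_hits[OF lam(2)] lam(1) by auto
  \<comment> \<open>Excludes a meeting point after \<open>p\<close>; as \<open>p\<close> itself is
    not in \<open>S\<close>, the hypersurface is met at or before some \<open>lam t\<close> with
    \<open>t < 0\<close>.\<close>
  have "\<not> cc (lam 0) s" using Up_not_before[OF p s(1)] cc_imp_J lam(3) by blast
  then obtain t where t: "t \<in> {-e..<0}" "J s (lam t)"
  proof -
    consider "s \<in> lam ` {-e..0}" | "cc s (lam (-e))" using s(2) \<open>\<not> cc (lam 0) s\<close> by blast
    then show ?thesis
    proof cases
      case 1
      then obtain t where t: "t \<in> {-e..0}" "s = lam t" by blast
      have "t \<noteq> 0" using t lam(3) p s(1) Up_Dn_S(2) by blast
      then show ?thesis using that[of t] t by simp
    next
      case 2
      then show ?thesis using that[of "-e"] lam(1) cc_imp_J by simp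
    qed
  qed
  obtain W where W: "open W" "p \<in> W" "\<forall>y\<in>W. cc (lam t) y" using lam(4)[OF t(1)] by blast
  have "W \<subseteq> Up" unfolding Up_def using W(3) t(2) J_cc s(1) by blast
  then show "\<exists>T. open T \<and> p \<in> T \<and> T \<subseteq> Up" using W by blast
qed

text \<open>Suppose there is no such subsequence. \<open>P e\<close> says that \<open>e\<close> is a
  limit of points that have a subsequence of \<open>xs\<close> ahead of them. Eventually these
  relations must leave the box around \<open>e\<close>, and their exit points accumulate at a point
  \<open>y\<close> with \<open>crossing e y\<close> and \<open>P y\<close>. The resulting ray enters
  the open set \<open>Up\<close>, which draws some \<open>xs n\<close> into
  \<open>Up\<close>.\<close>

lemma subsequence_of_bounded_future:
  assumes ps: "ps \<longlonglongrightarrow> p" and J: "\<And>n. J (ps n) (xs n)" and nUp: "\<And>n. xs n \<notin> Up"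
  obtains x \<sigma> where "strict_mono (\<sigma> :: nat \<Rightarrow> nat)" "(xs \<circ> \<sigma>) \<longlonglongrightarrow> x" "J p x"
proof (rule ccontr)
  assume "\<not> thesis"
  then have none: "\<not> (strict_mono \<sigma> \<and> (xs \<circ> \<sigma>) \<longlonglongrightarrow> x \<and> J p x)" for \<sigma> :: "nat \<Rightarrow> nat" and x
    using that by blast
  \<comment> \<open>Each node keeps its own subsequence \<open>\<sigma>\<close>; only one node of
    the ray is used at the end, so no diagonal sequence is formed.\<close>
  define P where "P e \<longleftrightarrow> J p e \<and> (\<exists>\<sigma> es. strict_mono (\<sigma> :: nat \<Rightarrow> nat) \<and> es \<longlonglongrightarrow> e \<and> (\<forall>n. J (es n) (xs (\<sigma> n))))" for e
  have "P p" unfolding P_def using ps J by (intro conjI exI[of _ id] exI[of _ ps]) (auto simp: strict_mono_id)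
  moreover have "\<exists>y. crossing e y \<and> P y" if Pe: "P e" for e
  proof -
    obtain \<sigma> es where pe: "J p e" and \<sigma>: "strict_mono (\<sigma> :: nat \<Rightarrow> nat)" and es: "es \<longlonglongrightarrow> e"
      and Jes: "\<And>n. J (es n) (xs (\<sigma> n))" using Pe unfolding P_def by blast
    let ?j = "idx e"
    have "e \<in> outer_box ?j" using idx_mem box_subsets by blast
    then have ev: "eventually (\<lambda>n. es n \<in> outer_box ?j) sequentially"
      by (rule topological_tendstoD[OF es open_outer_box])
    have sc: "seq_compact (full_box ?j)" using compact_full_box by (rule compact_imp_seq_compact)
    \<comment> \<open>If infinitely many of the relations were realised inside the box, compactness
      and \<open>bcausal_closed\<close> would produce exactly the limit point excluded by
      \<open>none\<close>.\<close>
    have "eventually (\<lambda>n. \<not> bcausal ?j (es n) (xs (\<sigma> n))) sequentially"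
    proof (rule ccontr)
      assume "\<not> ?thesis"
      from not_eventually_sequentiallyD[OF this] obtain \<tau> where \<tau>: "strict_mono (\<tau> :: nat \<Rightarrow> nat)"
        "\<And>n. bcausal ?j (es (\<tau> n)) (xs (\<sigma> (\<tau> n)))" by blast
      then have inb: "\<forall>n. xs (\<sigma> (\<tau> n)) \<in> full_box ?j"
        unfolding bcausal_def box_causal_def full_box_def by blast
      obtain x \<rho> where x: "x \<in> full_box ?j" "strict_mono (\<rho> :: nat \<Rightarrow> nat)" "((\<lambda>n. xs (\<sigma> (\<tau> n))) \<circ> \<rho>) \<longlonglongrightarrow> x"
        by (rule seq_compactE[OF sc inb])
      have "bcausal ?j e x"
      proof (rule bcausal_closed)
        show "bcausal ?j (es (\<tau> (\<rho> n))) (xs (\<sigma> (\<tau> (\<rho> n))))" for n by (rule \<tau>(2))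
        show "(\<lambda>n. es (\<tau> (\<rho> n))) \<longlonglongrightarrow> e"
          using LIMSEQ_subseq_LIMSEQ[OF LIMSEQ_subseq_LIMSEQ[OF es \<tau>(1)] x(2)] by (simp add: o_def)
        show "(\<lambda>n. xs (\<sigma> (\<tau> (\<rho> n)))) \<longlonglongrightarrow> x" using x(3) by (simp add: o_def)
      qed
      then have "J p x" using pe bcausal_imp_J J_trans by blast
      moreover have "strict_mono (\<sigma> \<circ> \<tau> \<circ> \<rho>)" using \<sigma> \<tau>(1) x(2) by (simp add: strict_mono_o)
      moreover have "(xs \<circ> (\<sigma> \<circ> \<tau> \<circ> \<rho>)) \<longlonglongrightarrow> x" using x(3) by (simp add: o_def)
      ultimately show False using none by blast
    qed
    with ev have "eventually (\<lambda>n. \<exists>q. q \<in> full_box ?j - outer_box ?j \<and> bcausal ?j (es n) q \<and> J q (xs (\<sigma> n))) sequentially"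
      by eventually_elim (use box_step[OF _ Jes] in blast)
    then obtain N where "\<forall>n\<ge>N. \<exists>q. q \<in> full_box ?j - outer_box ?j \<and> bcausal ?j (es n) q \<and> J q (xs (\<sigma> n))"
      unfolding eventually_sequentially by blast
    then have "\<forall>n. \<exists>q. q \<in> full_box ?j - outer_box ?j \<and> bcausal ?j (es (n + N)) q \<and> J q (xs (\<sigma> (n + N)))" by simp
    from choice[OF this] obtain q where q: "\<forall>n. q n \<in> full_box ?j - outer_box ?j \<and> bcausal ?j (es (n + N)) (q n) \<and> J (q n) (xs (\<sigma> (n + N)))" ..
    then have "\<forall>n. q n \<in> full_box ?j" by blast
    then obtain y \<rho> where y: "y \<in> full_box ?j" "strict_mono (\<rho> :: nat \<Rightarrow> nat)" "(q \<circ> \<rho>) \<longlonglongrightarrow> y"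
      by (rule seq_compactE[OF sc])
    have "y \<notin> outer_box ?j"
    proof
      assume "y \<in> outer_box ?j"
      then have "eventually (\<lambda>n. (q \<circ> \<rho>) n \<in> outer_box ?j) sequentially"
        by (rule topological_tendstoD[OF y(3) open_outer_box])
      then show False using q by (simp add: o_def)
    qed
    moreover have "bcausal ?j e y"
    proof (rule bcausal_closed)
      show "bcausal ?j (es (\<rho> n + N)) (q (\<rho> n))" for n using q by blast
      show "(\<lambda>n. es (\<rho> n + N)) \<longlonglongrightarrow> e"
        using LIMSEQ_subseq_LIMSEQ[OF LIMSEQ_ignore_initial_segment[OF es, of N] y(2)] by (simp add: o_def)
      show "(\<lambda>n. q (\<rho> n)) \<longlonglongrightarrow> y" using y(3) by (simp add: o_def)
    qed
    ultimately have cr: "crossing e y" unfolding crossing_def using y(1) by blast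
    have "J p y" using J_trans[OF pe cc_imp_J[OF crossing_imp_cc[OF cr]]] .
    moreover have "strict_mono (\<lambda>n. \<sigma> (\<rho> n + N))"
      using \<sigma> y(2) by (simp add: strict_mono_def)
    moreover have "\<forall>n. J ((q \<circ> \<rho>) n) (xs (\<sigma> (\<rho> n + N)))" using q by simp
    ultimately have "P y" unfolding P_def using y(3) by blast
    then show ?thesis using cr by blast
  qed
  ultimately obtain e where e: "future_ray e" "\<And>i. P (e i)" using future_ray_induct[of P p] by blast
  obtain i where "e i \<in> Up" using future_ray_Up[OF e(1)] by blast
  moreover obtain \<sigma> es where "es \<longlonglongrightarrow> e i" and Jes: "\<And>n. J (es n) (xs (\<sigma> n))"
    using e(2)[of i] unfolding P_def by blast
  ultimately have "eventually (\<lambda>n. es n \<in> Up) sequentially"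
    using topological_tendstoD[OF _ open_Up] by blast
  then obtain n where "es n \<in> Up" unfolding eventually_sequentially by blast
  then have "xs (\<sigma> n) \<in> Up" using Up_J Jes by blast
  then show False using nUp by blast
qed

text \<open>The part of \<open>lam\<close> up to \<open>b\<close> is continued by an inextendible
  future curve, and the Cauchy property is applied to the result. The lower end of \<open>I\<close>
  may be finite, so the joined curve lives on \<open>K'\<close> and not on the whole line.\<close>

lemma past_unbounded_meets_S_later:
  assumes fd: "fd lam I" and ne: "no_endpoint lam (lower_end I)"
  obtains t0 s where "t0 \<in> I" "s \<in> S" "\<And>t. t \<in> I \<Longrightarrow> t < t0 \<Longrightarrow> cc (lam t) s"
proof -
  have I: "param_interval I" using fd by (rule fd_interval)
  have nomin: "\<exists>s\<in>I. s < t" if "t \<in> I" for t by (rule no_endpoint_no_min[OF fd ne that])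
  obtain a b where ab: "a \<in> I" "b \<in> I" "a < b" using I by (auto simp: param_interval_def)
  define K where "K = I \<inter> {..b}"
  have "param_interval K"
    unfolding param_interval_def
  proof (intro conjI)
    show "is_interval K" unfolding K_def using I
      by (intro is_interval_Int is_interval_ic) (simp add: param_interval_def)
    show "\<exists>x\<in>K. \<exists>y\<in>K. x < y" using ab by (intro bexI[of _ a] bexI[of _ b]) (auto simp: K_def)
  qed
  then have fdK: "fd lam K" by (rule fd_subset[OF fd, rotated]) (simp add: K_def)
  obtain h where h: "fd h {0..}" "h 0 = lam b" "no_endpoint h at_top" by (rule future_curve_exists)
  have "{t. 1 * t + - b \<in> {0..}} = {b..}" by auto
  then have h': "fd (\<lambda>t. h (t - b)) {b..}" using fd_affine[OF h(1), of 1 "- b"] by simp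
  define mu where "mu t = (if t \<le> b then lam t else h (t - b))" for t
  define K' where "K' = K \<union> {b..}"
  have bK: "b \<in> K" "K \<subseteq> {..b}" using ab by (auto simp: K_def)
  have fdm: "fd mu K'"
    unfolding mu_def K'_def by (rule fd_join[OF fdK bK h']) (use h(2) in auto)
  have K': "param_interval K'" using fdm by (rule fd_interval)
  have inK': "t \<in> K' \<longleftrightarrow> t \<in> I" if "t \<le> b" for t using that ab(2) by (auto simp: K'_def K_def)
  have nominK': "\<exists>s\<in>K'. s < t" if t: "t \<in> K'" for t
  proof (cases "t \<le> b")
    case True
    then obtain s where "s \<in> I" "s < t" using nomin inK' t by blast
    then show ?thesis using inK'[of s] True by auto
  next
    case False
    then show ?thesis using inK'[of b] ab by (intro bexI[of _ b]) auto
  qed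
  have evI: "eventually P (lower_end I) \<longleftrightarrow> (\<exists>t0\<in>I. \<forall>t\<in>I. t < t0 \<longrightarrow> P t)" for P
    by (rule eventually_lower_end[OF I]) (rule nomin)
  have evK: "eventually P (lower_end K') \<longleftrightarrow> (\<exists>t0\<in>K'. \<forall>t\<in>K'. t < t0 \<longrightarrow> P t)" for P
    by (rule eventually_lower_end[OF K']) (rule nominK')
  have "no_endpoint mu (lower_end K')"
    unfolding no_endpoint_def
  proof
    assume "\<exists>p. (mu \<longlongrightarrow> p) (lower_end K')"
    then obtain p where p: "(mu \<longlongrightarrow> p) (lower_end K')" ..
    have "(lam \<longlongrightarrow> p) (lower_end I)"
    proof (rule topological_tendstoI)
      fix U assume U: "open U" "p \<in> U"
      have "eventually (\<lambda>t. mu t \<in> U) (lower_end K')" using topological_tendstoD[OF p U] .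
      then obtain t0 where t0: "t0 \<in> K'" "\<And>t. t \<in> K' \<Longrightarrow> t < t0 \<Longrightarrow> mu t \<in> U"
        unfolding evK by blast
      have "min t0 b \<in> I" using t0(1) inK'[of "min t0 b"] ab by (cases "t0 \<le> b") (auto simp: min_def)
      moreover have "lam t \<in> U" if "t \<in> I" "t < min t0 b" for t
        using t0(2)[of t] inK'[of t] that by (simp add: mu_def)
      ultimately show "eventually (\<lambda>t. lam t \<in> U) (lower_end I)"
        unfolding evI by blast
    qed
    then show False using ne unfolding no_endpoint_def by blast
  qed
  moreover have "no_endpoint mu (upper_end K')"
  proof -
    have "\<not> bdd_above K'"
    proof
      assume "bdd_above K'"
      then obtain M where M: "\<And>t. t \<in> K' \<Longrightarrow> t \<le> M" unfolding bdd_above_def by blast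
      have "max (M + 1) b \<in> K'" by (simp add: K'_def)
      from M[OF this] show False by simp
    qed
    then have ue: "upper_end K' = at_top" by (simp add: upper_end_def)
    show ?thesis
      unfolding ue by (rule no_endpoint_shift[OF h(3), of b]) (simp add: mu_def)
  qed
  ultimately have "inextendible_causal A G X mu K'"
    using fdm unfolding inextendible_causal_def causal_curve_def by blast
  then obtain t1 where t1: "t1 \<in> K'" "mu t1 \<in> S" using cauchy unfolding cauchy_hypersurface_def by blast
  \<comment> \<open>Before the minimum the joined curve still agrees with \<open>lam\<close> and has
    not yet met \<open>S\<close>.\<close>
  have "min t1 b \<in> I" using t1(1) inK'[of "min t1 b"] ab by (cases "t1 \<le> b") (auto simp: min_def)
  moreover have "cc (lam t) (mu t1)" if "t \<in> I" "t < min t1 b" for t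
  proof -
    have "cc (mu t) (mu t1)" using that inK'[of t] t1(1) by (intro ccI_sub[OF fdm]) auto
    then show ?thesis using that by (simp add: mu_def)
  qed
  ultimately show ?thesis using that t1(2) by blast
qed

text \<open>\<open>P\<close> describes the limit set of \<open>lam\<close> at its lower end. Since
  \<open>lam\<close> leaves every box, from each limit point some crossing leads to another one; so
  the limit set contains a future ray, and the ray enters the open set \<open>Up\<close>. Then
  arbitrarily early points of \<open>lam\<close> lie in \<open>Up\<close>, although all sufficiently
  early points precede a point of \<open>S\<close>.\<close>

lemma not_past_imprisoned:
  assumes fd: "fd lam I" and ne: "no_endpoint lam (lower_end I)" and K: "compact K" "lam ` I \<subseteq> K"
  shows False
proof -
  have I: "param_interval I" using fd by (rule fd_interval)
  have nomin: "\<exists>s\<in>I. s < t" if "t \<in> I" for t by (rule no_endpoint_no_min[OF fd ne that])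
  define P where "P e \<longleftrightarrow> (\<exists>t. (\<forall>n. t n \<in> I) \<and> (\<forall>s\<in>I. eventually (\<lambda>n. t n < s) sequentially) \<and>
     (\<lambda>n. lam (t n)) \<longlonglongrightarrow> e)" for e
  have sub: "eventually (\<lambda>n. t (\<rho> n) < s) sequentially"
    if "eventually (\<lambda>n. t n < s) sequentially" "strict_mono (\<rho> :: nat \<Rightarrow> nat)" for t :: "nat \<Rightarrow> real" and s \<rho>
    using eventually_compose_filterlim[OF that(1) filterlim_subseq[OF that(2)]] .
  have "\<exists>e. P e"
  proof -
    obtain t where t: "\<And>n. t n \<in> I" "\<And>s. s \<in> I \<Longrightarrow> eventually (\<lambda>n. t n < s) sequentially"
      using lower_end_sequence[OF I nomin] by blast
    have sc: "seq_compact K" using K(1) by (rule compact_imp_seq_compact)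
    have inK: "\<forall>n. lam (t n) \<in> K" using t(1) K(2) by blast
    obtain e \<rho> where e: "e \<in> K" "strict_mono (\<rho> :: nat \<Rightarrow> nat)" "((\<lambda>n. lam (t n)) \<circ> \<rho>) \<longlonglongrightarrow> e"
      by (rule seq_compactE[OF sc inK])
    have "P e" unfolding P_def
      using t(1) sub[OF t(2) e(2)] e(3) by (intro exI[of _ "\<lambda>n. t (\<rho> n)"]) (simp add: o_def)
    then show ?thesis ..
  qed
  then obtain e0 where "P e0" ..
  moreover have "\<exists>y. crossing e y \<and> P y" if Pe: "P e" for e
  proof -
    obtain t where t: "\<And>n. t n \<in> I" "\<And>s. s \<in> I \<Longrightarrow> eventually (\<lambda>n. t n < s) sequentially"
      "(\<lambda>n. lam (t n)) \<longlonglongrightarrow> e" using Pe unfolding P_def by blast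
    let ?j = "idx e"
    have "e \<in> outer_box ?j" using idx_mem box_subsets by blast
    then have ev: "eventually (\<lambda>n. lam (t n) \<in> outer_box ?j) sequentially"
      by (rule topological_tendstoD[OF t(3) open_outer_box])
    \<comment> \<open>\<open>t n\<close> is so early that \<open>lam (t n)\<close> is in the box
      around \<open>e\<close> and the excursion at \<open>b\<close> is still ahead; \<open>u\<close>
      is the exit in between. The bound \<open>u < t m\<close> makes the exits run to the lower end
      as well.\<close>
    have "\<exists>n u. m \<le> n \<and> u \<in> I \<and> u < t m \<and> lam u \<in> full_box ?j - outer_box ?j \<and> bcausal ?j (lam (t n)) (lam u)" for m
    proof -
      obtain b where b: "b \<in> I" "b < t m" "lam b \<notin> full_box ?j" using not_trapped[OF fd ne t(1)] by blast
      then have bo: "lam b \<notin> outer_box ?j" using box_subsets(3) by blast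
      have "eventually (\<lambda>n. lam (t n) \<in> outer_box ?j \<and> t n < b \<and> m \<le> n) sequentially"
        using ev t(2)[OF b(1)] eventually_ge_at_top[of m] by eventually_elim simp
      then obtain n where n: "lam (t n) \<in> outer_box ?j" "t n < b" "m \<le> n"
        unfolding eventually_sequentially by blast
      obtain u where "t n < u" "u \<le> b" "u \<in> I" "lam u \<in> full_box ?j - outer_box ?j" "bcausal ?j (lam (t n)) (lam u)"
        using box_curve_exit[OF fd t(1) n(1) b(1) _ bo] n(2) by auto
      then show ?thesis using n(3) b(2) by (intro exI[of _ n] exI[of _ u]) auto
    qed
    then have "\<forall>m. \<exists>nu. m \<le> fst nu \<and> snd nu \<in> I \<and> snd nu < t m \<and> lam (snd nu) \<in> full_box ?j - outer_box ?j \<and>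
        bcausal ?j (lam (t (fst nu))) (lam (snd nu))" by simp
    from choice[OF this] obtain nu where nu: "\<forall>m. m \<le> fst (nu m) \<and> snd (nu m) \<in> I \<and> snd (nu m) < t m \<and>
        lam (snd (nu m)) \<in> full_box ?j - outer_box ?j \<and> bcausal ?j (lam (t (fst (nu m)))) (lam (snd (nu m)))" ..
    define n u where "n m = fst (nu m)" and "u m = snd (nu m)" for m
    have nu': "m \<le> n m" "u m \<in> I" "u m < t m" "lam (u m) \<in> full_box ?j - outer_box ?j"
      "bcausal ?j (lam (t (n m))) (lam (u m))" for m using nu by (simp_all add: n_def u_def)
    have sc: "seq_compact (full_box ?j)" using compact_full_box by (rule compact_imp_seq_compact)
    have inb: "\<forall>m. lam (u m) \<in> full_box ?j" using nu'(4) by blast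
    obtain y \<rho> where y: "y \<in> full_box ?j" "strict_mono (\<rho> :: nat \<Rightarrow> nat)" "((\<lambda>m. lam (u m)) \<circ> \<rho>) \<longlonglongrightarrow> y"
      by (rule seq_compactE[OF sc inb])
    have "y \<notin> outer_box ?j"
    proof
      assume "y \<in> outer_box ?j"
      then have "eventually (\<lambda>m. ((\<lambda>m. lam (u m)) \<circ> \<rho>) m \<in> outer_box ?j) sequentially"
        by (rule topological_tendstoD[OF y(3) open_outer_box])
      then show False using nu'(4) by (simp add: o_def)
    qed
    moreover have "bcausal ?j e y"
    proof (rule bcausal_closed)
      show "bcausal ?j (lam (t (n (\<rho> m)))) (lam (u (\<rho> m)))" for m by (rule nu'(5))
      have "filterlim n at_top sequentially"
        by (rule filterlim_at_top_mono[OF filterlim_ident]) (simp add: nu'(1))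
      then have "filterlim (\<lambda>m. n (\<rho> m)) at_top sequentially"
        using filterlim_compose filterlim_subseq[OF y(2)] by blast
      then show "(\<lambda>m. lam (t (n (\<rho> m)))) \<longlonglongrightarrow> e" using filterlim_compose[OF t(3)] by blast
      show "(\<lambda>m. lam (u (\<rho> m))) \<longlonglongrightarrow> y" using y(3) by (simp add: o_def)
    qed
    ultimately have cr: "crossing e y" unfolding crossing_def using y(1) by blast
    have "eventually (\<lambda>m. u m < s) sequentially" if "s \<in> I" for s
      using t(2)[OF that] by eventually_elim (use nu'(3) less_trans in blast)
    then have "P y" unfolding P_def
      using nu'(2) sub[OF _ y(2)] y(3) by (intro exI[of _ "\<lambda>m. u (\<rho> m)"]) (simp add: o_def)
    then show ?thesis using cr by blast
  qed
  ultimately obtain e where e: "future_ray e" "\<And>i. P (e i)" using future_ray_induct[of P e0] by blast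
  obtain i where i: "e i \<in> Up" using future_ray_Up[OF e(1)] by blast
  obtain t where t: "\<And>n. t n \<in> I" "\<And>s. s \<in> I \<Longrightarrow> eventually (\<lambda>n. t n < s) sequentially"
    "(\<lambda>n. lam (t n)) \<longlonglongrightarrow> e i" using e(2)[of i] unfolding P_def by blast
  obtain t0 s where t0: "t0 \<in> I" "s \<in> S" "\<And>t. t \<in> I \<Longrightarrow> t < t0 \<Longrightarrow> cc (lam t) s"
    using past_unbounded_meets_S_later[OF fd ne] by blast
  have "eventually (\<lambda>n. lam (t n) \<in> Up \<and> t n < t0) sequentially"
    using topological_tendstoD[OF t(3) open_Up i] t(2)[OF t0(1)] by eventually_elim simp
  then obtain n where "lam (t n) \<in> Up" "t n < t0" unfolding eventually_sequentially by blast
  then show False using t0(3)[OF t(1)] Up_not_before[OF _ t0(2)] cc_imp_J by blast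
qed

section \<open>Closedness of the causal relation and compact diamonds\<close>

lemma dual_Up: "cauchy_spacetime.Up A G (\<lambda>c p. - X c p) S = Dn"
proof -
  interpret D: cauchy_spacetime A G "\<lambda>c p. - X c p" S by (rule dual_cauchy)
  show ?thesis unfolding D.Up_def Dn_def dual_cc ..
qed

lemma subsequence_of_bounded_past:
  assumes "qs \<longlonglongrightarrow> q" "\<And>n. J (xs n) (qs n)" "\<And>n. xs n \<notin> Dn"
  obtains x \<sigma> where "strict_mono (\<sigma> :: nat \<Rightarrow> nat)" "(xs \<circ> \<sigma>) \<longlonglongrightarrow> x" "J x q"
proof -
  interpret D: cauchy_spacetime A G "\<lambda>c p. - X c p" S by (rule dual_cauchy)
  show ?thesis
    using D.subsequence_of_bounded_future[of qs q xs] assms that unfolding dual_J dual_Up by blast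
qed

text \<open>Membership in \<open>Dn\<close> excludes a point of \<open>S\<close> before
  \<open>p\<close>, membership in \<open>Up\<close> one after \<open>q\<close>, so the extended
  curve meets \<open>S\<close> on the segment itself.\<close>

lemma meets_S_between:
  assumes "J p q" "p \<in> Dn" "q \<in> Up"
  obtains s where "s \<in> S" "J p s" "J s q"
proof -
  have "p \<noteq> q" using assms(2,3) Up_Dn_S(1) by blast
  then obtain g where g: "fd g {0..1}" "g 0 = p" "g 1 = q" using assms(1) unfolding J_def cc_def by blast
  obtain s where s: "s \<in> S" "s \<in> g ` {0..1} \<or> cc (g 1) s \<or> cc s (g 0)"
    using segment_hits[OF g(1)] by auto
  have "\<not> cc (g 1) s" using assms(3) g(3) s(1) Up_not_before cc_imp_J by blast
  moreover have "\<not> cc s (g 0)" using assms(2) g(2) s(1) cc_trans acausal unfolding Dn_def by blast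
  ultimately obtain t where t: "t \<in> {0..1}" "s = g t" using s(2) by blast
  have "J (g 0) (g t)" using t(1) ccI_sub[OF g(1), of 0 t] by (cases "t = 0") (auto simp: J_def)
  moreover have "J (g t) (g 1)" using t(1) ccI_sub[OF g(1), of t 1] by (cases "t = 1") (auto simp: J_def)
  ultimately show ?thesis using that s(1) t(2) g by blast
qed

text \<open>If \<open>qs\<close> is out of \<open>Up\<close>, or \<open>ps\<close> out of
  \<open>Dn\<close>, infinitely often, a subsequence lemma applies and uniqueness of limits
  identifies its limit point. Otherwise the relations are cut at points of \<open>S\<close>, which
  lie in neither \<open>Up\<close> nor \<open>Dn\<close>, and both lemmas apply to the
  pieces.\<close>

lemma J_closed:
  assumes ps: "ps \<longlonglongrightarrow> p" and qs: "qs \<longlonglongrightarrow> q" and J: "\<And>n. J (ps n) (qs n)"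
  shows "J p q"
proof -
  have fut: "J p' q'" if lim: "ps' \<longlonglongrightarrow> p'" "qs' \<longlonglongrightarrow> q'" and J': "\<And>n. J (ps' n) (qs' n)" and n: "\<And>n. qs' n \<notin> Up" for ps' qs' p' q'
  proof -
    obtain x \<sigma> where x: "strict_mono (\<sigma> :: nat \<Rightarrow> nat)" "(qs' \<circ> \<sigma>) \<longlonglongrightarrow> x" "J p' x"
      using subsequence_of_bounded_future[OF lim(1) J' n] by blast
    then have "x = q'" using LIMSEQ_unique[OF x(2) LIMSEQ_subseq_LIMSEQ[OF lim(2) x(1)]] by simp
    then show ?thesis using x(3) by simp
  qed
  have past: "J p' q'" if lim: "ps' \<longlonglongrightarrow> p'" "qs' \<longlonglongrightarrow> q'" and J': "\<And>n. J (ps' n) (qs' n)" and n: "\<And>n. ps' n \<notin> Dn" for ps' qs' p' q'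
  proof -
    obtain x \<sigma> where x: "strict_mono (\<sigma> :: nat \<Rightarrow> nat)" "(ps' \<circ> \<sigma>) \<longlonglongrightarrow> x" "J x q'"
      using subsequence_of_bounded_past[OF lim(2) J' n] by blast
    then have "x = p'" using LIMSEQ_unique[OF x(2) LIMSEQ_subseq_LIMSEQ[OF lim(1) x(1)]] by simp
    then show ?thesis using x(3) by simp
  qed
  have sub: "(\<lambda>n. ps (\<tau> n)) \<longlonglongrightarrow> p" "(\<lambda>n. qs (\<tau> n)) \<longlonglongrightarrow> q" if "strict_mono (\<tau> :: nat \<Rightarrow> nat)" for \<tau>
    using LIMSEQ_subseq_LIMSEQ[OF ps that] LIMSEQ_subseq_LIMSEQ[OF qs that] by (simp_all add: o_def)
  show ?thesis
  proof (cases "eventually (\<lambda>n. ps n \<in> Dn \<and> qs n \<in> Up) sequentially")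
    case True
    then obtain N where N: "\<And>n. n \<ge> N \<Longrightarrow> ps n \<in> Dn \<and> qs n \<in> Up" unfolding eventually_sequentially by blast
    have "\<exists>s. s \<in> S \<and> J (ps (n + N)) s \<and> J s (qs (n + N))" for n
      using meets_S_between[OF J] N[of "n + N"] by (metis le_add2)
    then have "\<forall>n. \<exists>s. s \<in> S \<and> J (ps (n + N)) s \<and> J s (qs (n + N))" ..
    from choice[OF this] obtain s where s: "\<forall>n. s n \<in> S \<and> J (ps (n + N)) (s n) \<and> J (s n) (qs (n + N))" ..
    have psN: "(\<lambda>n. ps (n + N)) \<longlonglongrightarrow> p" using ps by (rule LIMSEQ_ignore_initial_segment)
    have qsN: "(\<lambda>n. qs (n + N)) \<longlonglongrightarrow> q" using qs by (rule LIMSEQ_ignore_initial_segment)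
    have sU: "s n \<notin> Up" "s n \<notin> Dn" for n using s Up_Dn_S by blast+
    obtain x \<sigma> where x: "strict_mono (\<sigma> :: nat \<Rightarrow> nat)" "(s \<circ> \<sigma>) \<longlonglongrightarrow> x" "J p x"
    proof (rule subsequence_of_bounded_future[OF psN _ sU(1)])
      show "J (ps (n + N)) (s n)" for n using s by blast
    qed
    have "J x q"
    proof (rule past[OF x(2)])
      show "(\<lambda>n. qs (\<sigma> n + N)) \<longlonglongrightarrow> q" using LIMSEQ_subseq_LIMSEQ[OF qsN x(1)] by (simp add: o_def)
    qed (use s sU in auto)
    then show ?thesis using x(3) J_trans by blast
  next
    case False
    then have "\<not> eventually (\<lambda>n. ps n \<in> Dn) sequentially \<or> \<not> eventually (\<lambda>n. qs n \<in> Up) sequentially"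
      using eventually_conj by blast
    then show ?thesis
    proof
      assume "\<not> eventually (\<lambda>n. ps n \<in> Dn) sequentially"
      from not_eventually_sequentiallyD[OF this] obtain \<tau> where \<tau>: "strict_mono (\<tau> :: nat \<Rightarrow> nat)" "\<And>n. ps (\<tau> n) \<notin> Dn" by blast
      show ?thesis by (rule past[OF sub[OF \<tau>(1)] J \<tau>(2)])
    next
      assume "\<not> eventually (\<lambda>n. qs n \<in> Up) sequentially"
      from not_eventually_sequentiallyD[OF this] obtain \<tau> where \<tau>: "strict_mono (\<tau> :: nat \<Rightarrow> nat)" "\<And>n. qs (\<tau> n) \<notin> Up" by blast
      show ?thesis by (rule fut[OF sub[OF \<tau>(1)] J \<tau>(2)])
    qed
  qed
qed

text \<open>A sequence in the diamond is out of \<open>Up\<close> infinitely often, and then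
  controlled from \<open>p\<close>, or eventually out of \<open>Dn\<close>, and then controlled from
  \<open>q\<close>. Closedness of \<open>J\<close> keeps the limit in the diamond; second
  countability identifies sequential compactness with compactness.\<close>

lemma compact_diamond: "compact (J_future A G X p \<inter> J_past A G X q)"
proof -
  have "seq_compact {x. J p x \<and> J x q}"
    unfolding seq_compact_def
  proof (intro allI impI)
    fix xs :: "nat \<Rightarrow> 'm" assume xs: "\<forall>n. xs n \<in> {x. J p x \<and> J x q}"
    have "\<exists>x \<sigma>. strict_mono (\<sigma> :: nat \<Rightarrow> nat) \<and> (xs \<circ> \<sigma>) \<longlonglongrightarrow> x"
    proof (cases "eventually (\<lambda>n. xs n \<in> Up) sequentially")
      case False
      from not_eventually_sequentiallyD[OF this] obtain \<tau> where \<tau>: "strict_mono (\<tau> :: nat \<Rightarrow> nat)" "\<And>n. xs (\<tau> n) \<notin> Up" by blast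
      obtain x \<sigma> where "strict_mono (\<sigma> :: nat \<Rightarrow> nat)" "((\<lambda>n. xs (\<tau> n)) \<circ> \<sigma>) \<longlonglongrightarrow> x" "J p x"
      proof (rule subsequence_of_bounded_future[OF tendsto_const _ \<tau>(2)])
        show "J p (xs (\<tau> n))" for n using xs by simp
      qed
      then show ?thesis using \<tau>(1) by (intro exI[of _ x] exI[of _ "\<tau> \<circ> \<sigma>"]) (simp add: strict_mono_def o_def)
    next
      case True
      then obtain N where N: "\<And>n. n \<ge> N \<Longrightarrow> xs n \<in> Up" unfolding eventually_sequentially by blast
      have nD: "xs (n + N) \<notin> Dn" for n using N[of "n + N"] Up_Dn_S(1) by simp
      obtain x \<sigma> where "strict_mono (\<sigma> :: nat \<Rightarrow> nat)" "((\<lambda>n. xs (n + N)) \<circ> \<sigma>) \<longlonglongrightarrow> x" "J x q"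
      proof (rule subsequence_of_bounded_past[OF tendsto_const _ nD])
        show "J (xs (n + N)) q" for n using xs by simp
      qed
      then show ?thesis by (intro exI[of _ x] exI[of _ "\<lambda>n. \<sigma> n + N"]) (simp add: strict_mono_def o_def)
    qed
    then obtain x \<sigma> where x: "strict_mono (\<sigma> :: nat \<Rightarrow> nat)" "(xs \<circ> \<sigma>) \<longlonglongrightarrow> x" by blast
    have "J p x" by (rule J_closed[OF tendsto_const x(2)]) (use xs in simp)
    moreover have "J x q" by (rule J_closed[OF x(2) tendsto_const]) (use xs in simp)
    ultimately show "\<exists>l\<in>{x. J p x \<and> J x q}. \<exists>r. strict_mono r \<and> (xs \<circ> r) \<longlonglongrightarrow> l" using x by blast
  qed
  moreover have "J_future A G X p \<inter> J_past A G X q = {x. J p x \<and> J x q}"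
    unfolding J_future_eq J_past_eq by blast
  ultimately show ?thesis using seq_compact_eq_compact by metis
qed

lemma not_future_imprisoned:
  assumes fd: "fd lam I" and ne: "no_endpoint lam (upper_end I)" and K: "compact K" "lam ` I \<subseteq> K"
  shows False
proof -
  interpret D: cauchy_spacetime A G "\<lambda>c p. - X c p" S by (rule dual_cauchy)
  show False
  proof (rule D.not_past_imprisoned)
    show "D.fd (\<lambda>t. lam (- t)) {t. - t \<in> I}" by (rule fd_reverse[OF fd])
    show "no_endpoint (\<lambda>t. lam (- t)) (lower_end {t. - t \<in> I})" by (rule no_endpoint_reflect[OF ne])
    show "(\<lambda>t. lam (- t)) ` {t. - t \<in> I} \<subseteq> K" using K(2) by blast
  qed (rule K(1))
qed

lemma globally_hyperbolic: "globally_hyperbolic A G X"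
proof -
  interpret D: cauchy_spacetime A G "\<lambda>c p. - X c p" S by (rule dual_cauchy)
  have "non_totally_imprisoning A G X"
    unfolding non_totally_imprisoning_def
  proof
    assume "\<exists>lam I K. compact K \<and> lam ` I \<subseteq> K \<and> (future_inextendible A G X lam I \<or> past_inextendible A G X lam I)"
    then obtain lam I K where K: "compact K" "lam ` I \<subseteq> K"
      and "future_inextendible A G X lam I \<or> past_inextendible A G X lam I" by blast
    \<comment> \<open>A past directed curve is future directed for the reversed orientation, so two
      orientations and two ends give four cases.\<close>
    then consider "fd lam I" "no_endpoint lam (upper_end I)" | "fd lam I" "no_endpoint lam (lower_end I)"
      | "D.fd lam I" "no_endpoint lam (upper_end I)" | "D.fd lam I" "no_endpoint lam (lower_end I)"
      unfolding future_inextendible_def past_inextendible_def pd_iff_dual_fd by blast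
    then show False
      by cases (use K not_past_imprisoned not_future_imprisoned D.not_past_imprisoned D.not_future_imprisoned in metis)+
  qed
  then show ?thesis unfolding globally_hyperbolic_def using compact_diamond by blast
qed

end

theorem theorem5p6:
  fixes A :: "('m::{t2_space, second_countable_topology}, 'n::finite) chart set"
    and G :: "('m, 'n) chart \<Rightarrow> 'm \<Rightarrow> real ^ 'n ^ 'n"
    and X :: "('m, 'n) chart \<Rightarrow> 'm \<Rightarrow> real ^ 'n"
    and S :: "'m set"
  assumes "spacetime A G X"
    and "cauchy_hypersurface A G X S"
  shows "globally_hyperbolic A G X"
proof -
  interpret cauchy_spacetime A G X S by unfold_locales (rule assms)+
  show ?thesis by (rule globally_hyperbolic)
qed

end
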